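(* For all integers $p,q\ge0$, \[e_3^{p,q}(p+q+1,E)_p=\left[{p+q\atop p}\right].\] Equivalently, for all integers $k\ge0$ and $n\ge k+1$, $e_3^{k,n-1-k}(n,E)_k=\left[{n-1\atop k}\right]$.
   Context: Let $E$ be a complex elliptic curve, $x,y$ a basis of $H^1(E;\mathbb{Q})$ with $xy$ generating $H^2$. For $n\ge1$ let $E_2(n)$ be the quotient of the free graded-commutative algebra (for total degree) over $\mathbb{Q}$ on $x_i,y_i$ ($1\le i\le n$) of bidegree $(1,0)$ and $\omega_{ij}=\omega_{ji}$ ($i\ne j$) of bidegree $(0,1)$ by the relations $(x_i-x_j)\omega_{ij}=0$, $(y_i-y_j)\omega_{ij}=0$, $\omega_{ij}\omega_{jk}+\omega_{jk}\omega_{ki}+\omega_{ki}\omega_{ij}=0$ (distinct $i,j,k$), with the derivation $d_2$ of bidegree $(2,-1)$, $d_2x_i=d_2y_i=0$, $d_2\omega_{ij}=(x_i-x_j)(y_i-y_j)$; this is the second page of the rational Leray spectral sequence of the inclusion into $E^n$ of the configuration space of $n$ distinct ordered points of $E$. Let $E_2(n,E)$ be the sub-differential bigraded algebra generated by the $x_i-x_j$, $y_i-y_j$, $\omega_{ij}$ (the corresponding $E_2$ page for the quotient by diagonal translation by $E$), and $E_3^{p,q}(n,E)$ its $d_2$-cohomology in bidegree $(p,q)$. $\mathrm{SL}_2(\mathbb{Q})$ acts through its standard representation on each pair $(x_i,y_i)$ (as on $(x,y)$), trivially on the $\omega_{ij}$, commuting with $d_2$; $e_3^{p,q}(n,E)_k$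 is the multiplicity of the irreducible $(k+1)$-dimensional representation $\mathbb{V}_k$ in $E_3^{p,q}(n,E)$. $\left[{a\atop b}\right]$ denotes the unsigned Stirling number of the first kind. *)

theory Defs
  imports Complex_Main "HOL-Library.Function_Algebras" "HOL-Library.Nat_Bijection"
          "HOL-Combinatorics.Stirling"
begin

text \<open>All generators x_i, y_i (bidegree (1,0)) and omega_ij (bidegree (0,1)) have odd
total degree, so the free graded-commutative algebra on them is the exterior algebra.
Generators are encoded as natural numbers: x_i = 3i, y_i = 3i+1,
omega_ij = omega_ji = 3 * prod_encode (min i j, max i j) + 2.
An element is its coefficient function on basis monomials e_S (S a finite set of
generators, e_S the product of its elements in increasing order).\<close>

type_synonym el = "nat set \<Rightarrow> rat"

definition gx :: "nat \<Rightarrow> nat" where "gx i = 3 * i"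
definition gy :: "nat \<Rightarrow> nat" where "gy i = 3 * i + 1"
definition gw :: "nat \<Rightarrow> nat \<Rightarrow> nat" where
  "gw i j = 3 * prod_encode (min i j, max i j) + 2"

definition gens :: "nat \<Rightarrow> nat set" where
  "gens n = gx ` {1..n} \<union> gy ` {1..n} \<union>
            {gw i j | i j. i \<in> {1..n} \<and> j \<in> {1..n} \<and> i \<noteq> j}"

definition mon :: "nat set \<Rightarrow> el" where "mon S = (\<lambda>U. if U = S then 1 else 0)"
definition one :: el where "one = mon {}"
definition gen :: "nat \<Rightarrow> el" where "gen s = mon {s}"
definition sc :: "rat \<Rightarrow> el \<Rightarrow> el" where "sc c f = (\<lambda>U. c * f U)"

text \<open>Sign of e_S * e_T = sgn S T * e_(S union T).\<close>
definition sgn :: "nat set \<Rightarrow> nat set \<Rightarrow> rat" where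
  "sgn S T = (if S \<inter> T = {} then (-1) ^ card {(s, t). s \<in> S \<and> t \<in> T \<and> t < s} else 0)"

definition mult :: "el \<Rightarrow> el \<Rightarrow> el" where
  "mult f g = (\<lambda>U. if finite U then (\<Sum>S\<in>Pow U. f S * g (U - S) * sgn S (U - S)) else 0)"

definition prodlist :: "el list \<Rightarrow> el" where "prodlist fs = foldr mult fs one"

text \<open>Linear extension of a map on basis monomials (elements are finitely supported).\<close>
definition lin :: "(nat set \<Rightarrow> el) \<Rightarrow> el \<Rightarrow> el" where
  "lin \<phi> f = (\<lambda>U. \<Sum>S\<in>{S. f S \<noteq> 0}. f S * \<phi> S U)"

definition alg_ext :: "(nat \<Rightarrow> el) \<Rightarrow> el \<Rightarrow> el" where
  "alg_ext \<phi> = lin (\<lambda>S. prodlist (map \<phi> (sorted_list_of_set S)))"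

definition Lam :: "nat \<Rightarrow> el set" where
  "Lam n = {f. \<forall>S. f S \<noteq> 0 \<longrightarrow> S \<subseteq> gens n}"

definition om :: "nat \<Rightarrow> nat \<Rightarrow> el" where "om i j = gen (gw i j)"
definition xx :: "nat \<Rightarrow> el" where "xx i = gen (gx i)"
definition yy :: "nat \<Rightarrow> el" where "yy i = gen (gy i)"

definition rels :: "nat \<Rightarrow> el set" where
  "rels n = {mult (xx i - xx j) (om i j) | i j. i \<in> {1..n} \<and> j \<in> {1..n} \<and> i \<noteq> j}
          \<union> {mult (yy i - yy j) (om i j) | i j. i \<in> {1..n} \<and> j \<in> {1..n} \<and> i \<noteq> j}
          \<union> {mult (om i j) (om j k) + mult (om j k) (om k i) + mult (om k i) (om i j) | i j k.
               i \<in> {1..n} \<and> j \<in> {1..n} \<and> k \<in> {1..n} \<and> i \<noteq> j \<and> j \<noteq> k \<and> k \<noteq> i}"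

text \<open>The two-sided ideal of Lam n generated by the relations; E_2(n) = Lam n / Id n.\<close>
inductive_set Id :: "nat \<Rightarrow> el set" for n where
  rel: "r \<in> rels n \<Longrightarrow> r \<in> Id n"
| zero: "0 \<in> Id n"
| add: "a \<in> Id n \<Longrightarrow> b \<in> Id n \<Longrightarrow> a + b \<in> Id n"
| scal: "a \<in> Id n \<Longrightarrow> sc c a \<in> Id n"
| lmult: "a \<in> Id n \<Longrightarrow> u \<in> Lam n \<Longrightarrow> mult u a \<in> Id n"
| rmult: "a \<in> Id n \<Longrightarrow> u \<in> Lam n \<Longrightarrow> mult a u \<in> Id n"

text \<open>Subalgebra of Lam n generated by x_i - x_j, y_i - y_j, omega_ij; its image
(Sub n + Id n)/Id n is E_2(n,E).\<close>
inductive_set Sub :: "nat \<Rightarrow> el set" for n where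
  unit: "one \<in> Sub n"
| genx: "i \<in> {1..n} \<Longrightarrow> j \<in> {1..n} \<Longrightarrow> xx i - xx j \<in> Sub n"
| geny: "i \<in> {1..n} \<Longrightarrow> j \<in> {1..n} \<Longrightarrow> yy i - yy j \<in> Sub n"
| genw: "i \<in> {1..n} \<Longrightarrow> j \<in> {1..n} \<Longrightarrow> i \<noteq> j \<Longrightarrow> om i j \<in> Sub n"
| add: "a \<in> Sub n \<Longrightarrow> b \<in> Sub n \<Longrightarrow> a + b \<in> Sub n"
| scal: "a \<in> Sub n \<Longrightarrow> sc c a \<in> Sub n"
| mul: "a \<in> Sub n \<Longrightarrow> b \<in> Sub n \<Longrightarrow> mult a b \<in> Sub n"

definition dgen :: "nat \<Rightarrow> el" where
  "dgen s = (if s mod 3 = 2 then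
     (case prod_decode (s div 3) of (i, j) \<Rightarrow> mult (xx i - xx j) (yy i - yy j))
   else 0)"

text \<open>d_2 is the derivation of odd total degree (all generators are odd):
d(e_(s_0) ... e_(s_m)) = sum_k (-1)^k e_(s_0)...d(e_(s_k))...e_(s_m).\<close>
definition dmon :: "nat set \<Rightarrow> el" where
  "dmon S = (let L = sorted_list_of_set S in
     (\<Sum>k<length L. sc ((-1) ^ k)
        (prodlist (map gen (take k L) @ [dgen (L ! k)] @ map gen (drop (Suc k) L)))))"

definition d2 :: "el \<Rightarrow> el" where "d2 = lin dmon"

definition Lampq :: "nat \<Rightarrow> nat \<Rightarrow> nat \<Rightarrow> el set" where
  "Lampq n p q = {f \<in> Lam n. \<forall>S. f S \<noteq> 0 \<longrightarrow>
      card {s \<in> S. s mod 3 \<noteq> 2} = p \<and> card {s \<in> S. s mod 3 = 2} = q}"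

text \<open>Representatives of cocycles and coboundaries of (E_2(n,E), d_2) in bidegree (p,q);
E_3^{p,q}(n,E) = Zc n p q / Bc n p q.\<close>
definition Zc :: "nat \<Rightarrow> nat \<Rightarrow> nat \<Rightarrow> el set" where
  "Zc n p q = {z \<in> Lampq n p q. (\<exists>a\<in>Sub n. \<exists>i\<in>Id n. z = a + i) \<and> d2 z \<in> Id n}"

definition Bc :: "nat \<Rightarrow> nat \<Rightarrow> nat \<Rightarrow> el set" where
  "Bc n p q = {b \<in> Lampq n p q. \<exists>a\<in>Sub n. \<exists>i\<in>Id n. b = d2 a + i}"

type_synonym mat2 = "rat \<times> rat \<times> rat \<times> rat"   \<comment> \<open>(a,b,c,d) = [[a,b],[c,d]]\<close>

definition SL2 :: "mat2 set" where
  "SL2 = {(a, b, c, d). a * d - b * c = 1}"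

definition genact :: "mat2 \<Rightarrow> nat \<Rightarrow> el" where
  "genact g s = (case g of (a, b, c, d) \<Rightarrow>
     (if s mod 3 = 0 then sc a (xx (s div 3)) + sc c (yy (s div 3))
      else if s mod 3 = 1 then sc b (xx (s div 3)) + sc d (yy (s div 3))
      else gen s))"

definition act :: "mat2 \<Rightarrow> el \<Rightarrow> el" where "act g = alg_ext (genact g)"

text \<open>V_k = Sym^k of the standard representation, basis v_j = x^(k-j) y^j (j \<le> k);
g v_j = sum_m vmat k g m j v_m.\<close>
definition vmat :: "nat \<Rightarrow> mat2 \<Rightarrow> nat \<Rightarrow> nat \<Rightarrow> rat" where
  "vmat k g m j = (case g of (a, b, c, d) \<Rightarrow>
     (\<Sum>r\<le>k - j. \<Sum>s\<le>j. if r + s = m then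
        of_nat ((k - j) choose r) * a ^ (k - j - r) * c ^ r * of_nat (j choose s) * b ^ (j - s) * d ^ s
      else 0))"

text \<open>Linear maps V_k \<rightarrow> Zc given by images F 0, ..., F k that are SL_2-equivariant
modulo Bc, i.e. lifts of elements of Hom_SL2(V_k, E_3^{p,q}(n,E)).\<close>
definition HomLift :: "nat \<Rightarrow> nat \<Rightarrow> nat \<Rightarrow> nat \<Rightarrow> (nat \<Rightarrow> el) set" where
  "HomLift n p q k = {F. (\<forall>j>k. F j = 0) \<and> (\<forall>j\<le>k. F j \<in> Zc n p q) \<and>
     (\<forall>g\<in>SL2. \<forall>j\<le>k. (\<Sum>m\<le>k. sc (vmat k g m j) (F m)) - act g (F j) \<in> Bc n p q)}"

definition HomZero :: "nat \<Rightarrow> nat \<Rightarrow> nat \<Rightarrow> nat \<Rightarrow> (nat \<Rightarrow> el) set" where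
  "HomZero n p q k = {F. (\<forall>j>k. F j = 0) \<and> (\<forall>j\<le>k. F j \<in> Bc n p q)}"

definition scF :: "rat \<Rightarrow> (nat \<Rightarrow> el) \<Rightarrow> (nat \<Rightarrow> el)" where
  "scF c F = (\<lambda>j. sc c (F j))"

definition qdim :: "(nat \<Rightarrow> el) set \<Rightarrow> nat" where
  "qdim = Vector_Spaces.vector_space.dim scF"

text \<open>e_3^{p,q}(n,E)_k = dim_Q Hom_SL2(V_k, E_3^{p,q}(n,E)) = dim HomLift - dim HomZero.\<close>
definition e3 :: "nat \<Rightarrow> nat \<Rightarrow> nat \<Rightarrow> nat \<Rightarrow> nat" where
  "e3 n p q k = qdim (HomLift n p q k) - qdim (HomZero n p q k)"

end

theory Submission
  imports Defs
begin

text \<open>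
  Highest weight vectors of type \<open>V_p\<close> in bidegree \<open>(p, q)\<close> involve no \<open>y\<close>, and no coboundary has
  a component of this kind; so the multiplicity is the dimension of the space \<open>K\<close> of classes of
  cocycles in the differences \<open>x_i - x_j\<close> and the \<open>omega_ij\<close>. In the relevant degree
  \<open>p + q = n - 1\<close>, multiplication by any further \<open>x_i - x_k\<close> vanishes modulo the relations.

  Fix points \<open>j \<noteq> k\<close>. Modulo the relations a cocycle on \<open>J\<close> has the form
  \<open>(x_j - x_k) c + (\<Sum>l. omega_lj b_l)\<close> with \<open>c\<close>, \<open>b_l\<close> on \<open>J - {j}\<close>; it is closed iff each \<open>b_l\<close> is
  closed, \<open>(\<Sum>l. b_l) = 0\<close> and \<open>d c = - (\<Sum>l. y_l b_l)\<close>. Every family of cocycles \<open>b_l\<close> with sum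
  zero occurs, because \<open>(y_l - y_k) b\<close> is a coboundary for each top-degree cocycle \<open>b\<close>. This gives
  \<open>dim K(n, p) = dim K(n - 1, p - 1) + (n - 2) dim K(n - 1, p)\<close>, the recurrence of the Stirling numbers.
\<close>

section \<open>The exterior algebra as a ring\<close>

text \<open>In the y-free part, two factors at the point j can always be traded: modulo the
  relations their product is zero or a combination of products with a single factor at j. Each point
  except the last thus contributes at most one factor, whence the bound n - 1 on the total degree.

  The obstacle in the recurrence is to solve d c = - (\<Sum>l. y_l b_l) with c free of y. As the b_l
  add up to zero, y_l may be replaced by y_l - y_k, so primitives can be found for each l
  separately. The cocycle b_k is determined by the others; this leaves n - 2 independent residues
  and a closed c, the two summands of the recurrence.

  The passage to highest weight vectors rests on the factor y_i - y_j in d omega_ij: setting all y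
  to zero annihilates every coboundary. Complete reducibility of representations is not invoked.
  Equivariance under diagonal and lower unipotent matrices is evaluated at sufficiently many
  rational parameters, and interpolation modulo the space of coboundaries separates the
  coefficients.\<close>

definition inv_count :: "nat set \<Rightarrow> nat set \<Rightarrow> nat" where
  "inv_count S T = card {(s, t). s \<in> S \<and> t \<in> T \<and> t < s}"

lemma finite_inversions:
  assumes "finite S" "finite T"
  shows "finite {(s, t). s \<in> S \<and> t \<in> T \<and> t < (s::nat)}"
  by (rule finite_subset[of _ "S \<times> T"]) (use assms in auto)

lemma inv_count_Un_left:
  assumes "finite S" "finite T" "finite R" "S \<inter> T = {}"
  shows "inv_count (S \<union> T) R = inv_count S R + inv_count T R"
proof -
  have "{(s, t). s \<in> S \<union> T \<and> t \<in> R \<and> t < s} =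
        {(s, t). s \<in> S \<and> t \<in> R \<and> t < s} \<union> {(s, t). s \<in> T \<and> t \<in> R \<and> t < s}"
    by auto
  then show ?thesis
    unfolding inv_count_def using assms
    by (simp add: card_Un_disjoint finite_inversions disjoint_iff)
qed

lemma inv_count_Un_right:
  assumes "finite S" "finite T" "finite R" "T \<inter> R = {}"
  shows "inv_count S (T \<union> R) = inv_count S T + inv_count S R"
proof -
  have "{(s, t). s \<in> S \<and> t \<in> T \<union> R \<and> t < s} =
        {(s, t). s \<in> S \<and> t \<in> T \<and> t < s} \<union> {(s, t). s \<in> S \<and> t \<in> R \<and> t < s}"
    by auto
  then show ?thesis
    unfolding inv_count_def using assms
    by (simp add: card_Un_disjoint finite_inversions disjoint_iff)
qed

lemma sgn_eq: "sgn S T = (if S \<inter> T = {} then (-1) ^ inv_count S T else 0)"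
  by (simp add: sgn_def inv_count_def)

text \<open>Both sides count the inversions between the three pairs of blocks. This is the sign
  identity to which associativity of \<open>mult\<close> reduces.\<close>

lemma sgn_cocycle:
  assumes "finite S" "finite T" "finite R" "S \<inter> T = {}" "S \<inter> R = {}" "T \<inter> R = {}"
  shows "sgn S T * sgn (S \<union> T) R = sgn T R * sgn S (T \<union> R)"
proof -
  have "(S \<union> T) \<inter> R = {}" "S \<inter> (T \<union> R) = {}" using assms by auto
  then show ?thesis
    using assms inv_count_Un_left[of S T R] inv_count_Un_right[of S T R]
    by (simp add: sgn_eq power_add)
qed

text \<open>Either side is a sum over ordered partitions of \<open>U\<close> into three blocks; the
  pair \<open>(A, S)\<close> with \<open>S \<subseteq> A\<close> is traded for the blocks
  \<open>S\<close>, \<open>A - S\<close>, \<open>U - A\<close>.\<close>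

lemma mult_assoc_finite:
  assumes U: "finite U"
  shows "mult (mult f g) h U = mult f (mult g h) U"
proof -
  have fin: "finite A" if "A \<subseteq> U" for A using U that finite_subset by blast
  have "mult (mult f g) h U =
      (\<Sum>A\<in>Pow U. (\<Sum>S\<in>Pow A. f S * g (A - S) * sgn S (A - S)) * h (U - A) * sgn A (U - A))"
    using U fin by (auto simp: mult_def intro!: sum.cong)
  also have "\<dots> = (\<Sum>A\<in>Pow U. \<Sum>S\<in>Pow A. f S * g (A - S) * h (U - A) * (sgn S (A - S) * sgn A (U - A)))"
    by (simp add: sum_distrib_right sum_distrib_left mult_ac)
  also have "\<dots> = (\<Sum>(A, S)\<in>Sigma (Pow U) Pow. f S * g (A - S) * h (U - A) * (sgn S (A - S) * sgn A (U - A)))"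
    by (rule sum.Sigma) (use U fin in auto)
  also have "\<dots> = (\<Sum>(S, T)\<in>Sigma (Pow U) (\<lambda>S. Pow (U - S)).
       f S * g T * h (U - S - T) * (sgn T (U - S - T) * sgn S (U - S)))"
  proof (rule sum.reindex_bij_witness[where i = "\<lambda>(S, T). (S \<union> T, S)" and j = "\<lambda>(A, S). (S, A - S)"], goal_cases)
    case (1 a) then show ?case by auto
  next
    case (2 a) then show ?case by auto
  next
    case (3 b) then show ?case by auto
  next
    case (4 b) then show ?case by auto
  next
    case (5 a)
    then obtain A S where a: "a = (A, S)" "A \<subseteq> U" "S \<subseteq> A" by auto
    have "sgn S (A - S) * sgn (S \<union> (A - S)) (U - A) = sgn (A - S) (U - A) * sgn S ((A - S) \<union> (U - A))"
      by (rule sgn_cocycle) (use a fin[of S] fin[of A] U in auto)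
    moreover have "S \<union> (A - S) = A" "(A - S) \<union> (U - A) = U - S" "U - S - (A - S) = U - A"
      using a by auto
    ultimately show ?case using a by simp
  qed
  also have "\<dots> = (\<Sum>S\<in>Pow U. \<Sum>T\<in>Pow (U - S). f S * g T * h (U - S - T) * (sgn T (U - S - T) * sgn S (U - S)))"
    by (rule sum.Sigma[symmetric]) (use U fin in auto)
  also have "\<dots> = mult f (mult g h) U"
    using U fin by (auto simp: mult_def sum_distrib_right sum_distrib_left mult_ac intro!: sum.cong)
  finally show ?thesis .
qed

lemma mult_assoc: "mult (mult f g) h = mult f (mult g h)"
proof
  fix U show "mult (mult f g) h U = mult f (mult g h) U"
    by (cases "finite U") (simp add: mult_assoc_finite, simp add: mult_def)
qed

lemma mult_nonzeroD:
  assumes "mult f g U \<noteq> 0"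
  obtains S T where "f S \<noteq> 0" "g T \<noteq> 0" "S \<inter> T = {}" "U = S \<union> T" "finite U"
proof -
  from assms have U: "finite U" "(\<Sum>S\<in>Pow U. f S * g (U - S) * sgn S (U - S)) \<noteq> 0"
    by (auto simp: mult_def split: if_splits)
  from U(2) obtain S where "S \<in> Pow U" "f S * g (U - S) * sgn S (U - S) \<noteq> 0"
    by (meson sum.not_neutral_contains_not_neutral)
  with U(1) that[of S "U - S"] show thesis by auto
qed

lemma sgn_empty [simp]: "sgn {} T = 1" "sgn S {} = 1"
  by (auto simp: sgn_def)

lemma mult_mon:
  assumes "finite S" "finite T"
  shows "mult (mon S) (mon T) = sc (sgn S T) (mon (S \<union> T))"
proof
  fix U
  show "mult (mon S) (mon T) U = sc (sgn S T) (mon (S \<union> T)) U"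
  proof (cases "finite U")
    case True
    have "mult (mon S) (mon T) U = (\<Sum>A\<in>Pow U. if A = S then mon T (U - S) * sgn S (U - S) else 0)"
      unfolding mult_def if_P[OF True] by (intro sum.cong) (auto simp: mon_def)
    also have "\<dots> = (if S \<subseteq> U then mon T (U - S) * sgn S (U - S) else 0)"
      using True by (simp add: sum.delta)
    also have "\<dots> = sc (sgn S T) (mon (S \<union> T)) U"
    proof (cases "S \<inter> T = {}")
      case True
      then have "(S \<subseteq> U \<and> U - S = T) = (U = S \<union> T)" by blast
      then show ?thesis by (auto simp: sc_def mon_def)
    next
      case False
      then have "U - S \<noteq> T" by auto
      with False show ?thesis by (auto simp: sc_def mon_def sgn_def)
    qed
    finally show ?thesis .
  next
    case False
    with assms have "U \<noteq> S \<union> T" by auto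
    with False show ?thesis by (simp add: mult_def sc_def mon_def)
  qed
qed

lemma mult_one_left:
  assumes "\<And>S. f S \<noteq> 0 \<Longrightarrow> finite S"
  shows "mult one f = f"
proof
  fix U
  show "mult one f U = f U"
  proof (cases "finite U")
    case True
    have "mult one f U = (\<Sum>A\<in>Pow U. if A = {} then f U else 0)"
      unfolding mult_def if_P[OF True] by (intro sum.cong) (auto simp: mon_def one_def)
    also have "\<dots> = f U" using True by (simp add: sum.delta)
    finally show ?thesis .
  qed (use assms in \<open>auto simp: mult_def\<close>)
qed

lemma mult_one_right:
  assumes "\<And>S. f S \<noteq> 0 \<Longrightarrow> finite S"
  shows "mult f one = f"
proof
  fix U
  show "mult f one U = f U"
  proof (cases "finite U")
    case True
    have "mult f one U = (\<Sum>A\<in>Pow U. if A = U then f U else 0)"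
      unfolding mult_def if_P[OF True] by (intro sum.cong) (auto simp: mon_def one_def)
    also have "\<dots> = f U" using True by (simp add: sum.delta)
    finally show ?thesis .
  qed (use assms in \<open>auto simp: mult_def\<close>)
qed

text \<open>\<open>one\<close> is neutral only on functions supported on finite sets, and sums over
  the support, as in \<open>lin\<close>, are meaningful only if the support is finite. With both
  conditions built into a type the ring laws hold unconditionally, and all point sets share one
  ring.\<close>

typedef ext = "{f :: el. finite {S. f S \<noteq> 0} \<and> (\<forall>S. f S \<noteq> 0 \<longrightarrow> finite S)}"
  morphisms cf Ext
  by (rule exI[of _ "\<lambda>_. 0"]) auto

setup_lifting type_definition_ext

lemma finite_mult_support:
  assumes "finite {S. f S \<noteq> 0}" "finite {S. g S \<noteq> 0}"
  shows "finite {U. mult f g U \<noteq> 0}"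
proof (rule finite_subset)
  show "{U. mult f g U \<noteq> 0} \<subseteq> (\<lambda>(S, T). S \<union> T) ` ({S. f S \<noteq> 0} \<times> {S. g S \<noteq> 0})"
    by (force elim: mult_nonzeroD)
qed (use assms in auto)

instantiation ext :: ring_1
begin

lift_definition zero_ext :: ext is 0 by auto

lift_definition one_ext :: ext is one by (auto simp: one_def mon_def)

lift_definition plus_ext :: "ext \<Rightarrow> ext \<Rightarrow> ext" is "(+)"
proof -
  fix f g :: el
  assume f: "finite {S. f S \<noteq> 0} \<and> (\<forall>S. f S \<noteq> 0 \<longrightarrow> finite S)"
    and g: "finite {S. g S \<noteq> 0} \<and> (\<forall>S. g S \<noteq> 0 \<longrightarrow> finite S)"
  have "{S. (f + g) S \<noteq> 0} \<subseteq> {S. f S \<noteq> 0} \<union> {S. g S \<noteq> 0}" by auto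
  then have "finite {S. (f + g) S \<noteq> 0}" using f g by (auto intro: finite_subset)
  moreover have "finite S" if "(f + g) S \<noteq> 0" for S
    using that f g by (cases "f S = 0") auto
  ultimately show "finite {S. (f + g) S \<noteq> 0} \<and> (\<forall>S. (f + g) S \<noteq> 0 \<longrightarrow> finite S)"
    by blast
qed

lift_definition uminus_ext :: "ext \<Rightarrow> ext" is uminus by auto

lift_definition minus_ext :: "ext \<Rightarrow> ext \<Rightarrow> ext" is "(-)"
proof -
  fix f g :: el
  assume f: "finite {S. f S \<noteq> 0} \<and> (\<forall>S. f S \<noteq> 0 \<longrightarrow> finite S)"
    and g: "finite {S. g S \<noteq> 0} \<and> (\<forall>S. g S \<noteq> 0 \<longrightarrow> finite S)"
  have "{S. (f - g) S \<noteq> 0} \<subseteq> {S. f S \<noteq> 0} \<union> {S. g S \<noteq> 0}" by auto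
  then have "finite {S. (f - g) S \<noteq> 0}" using f g by (auto intro: finite_subset)
  moreover have "finite S" if "(f - g) S \<noteq> 0" for S
    using that f g by (cases "f S = 0") auto
  ultimately show "finite {S. (f - g) S \<noteq> 0} \<and> (\<forall>S. (f - g) S \<noteq> 0 \<longrightarrow> finite S)"
    by blast
qed

lift_definition times_ext :: "ext \<Rightarrow> ext \<Rightarrow> ext" is mult
  by (auto intro: finite_mult_support elim: mult_nonzeroD)

instance
proof
  fix a b c :: ext
  show "a * b * c = a * (b * c)" by transfer (rule mult_assoc)
  show "1 * a = a" by transfer (simp add: mult_one_left)
  show "a * 1 = a" by transfer (simp add: mult_one_right)
  show "(a + b) * c = a * c + b * c"
    by transfer (auto simp: mult_def fun_eq_iff algebra_simps sum.distrib)
  show "a * (b + c) = a * b + a * c"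
    by transfer (auto simp: mult_def fun_eq_iff algebra_simps sum.distrib)
  show "(0::ext) \<noteq> 1" by transfer (auto simp: one_def mon_def fun_eq_iff)
qed (transfer, simp add: fun_eq_iff)+

end

section \<open>Scalars, coefficients and basis monomials\<close>

lift_definition smul :: "rat \<Rightarrow> ext \<Rightarrow> ext" is sc
  by (auto simp: sc_def)

lift_definition monE :: "nat set \<Rightarrow> ext" is "\<lambda>S. if finite S then mon S else 0"
  by (auto simp: mon_def)

abbreviation e :: "nat \<Rightarrow> ext" where "e s \<equiv> monE {s}"

lemma smul_add: "smul c (a + b) = smul c a + smul c b"
  by transfer (simp add: sc_def fun_eq_iff algebra_simps)
lemma add_smul: "smul (c + d) a = smul c a + smul d a"
  by transfer (simp add: sc_def fun_eq_iff algebra_simps)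
lemma smul_smul [simp]: "smul c (smul d a) = smul (c * d) a"
  by transfer (simp add: sc_def fun_eq_iff algebra_simps)
lemma smul_one [simp]: "smul 1 a = a"
  by transfer (simp add: sc_def fun_eq_iff)
lemma smul_mult_left [simp]: "smul c a * b = smul c (a * b)"
  by transfer (auto simp: sc_def mult_def fun_eq_iff sum_distrib_left mult_ac)
lemma smul_mult_right [simp]: "a * smul c b = smul c (a * b)"
  by transfer (auto simp: sc_def mult_def fun_eq_iff sum_distrib_left mult_ac)

interpretation smul: module smul
  by standard (simp_all add: smul_add add_smul)

lemma smul_minus_one: "smul (-1) a = - a"
  by (simp add: smul.scale_minus_left)

text \<open>Characteristic zero enters here: anticommutation yields vanishing squares because 2 is
  invertible.\<close>

lemma self_neg_zero:
  assumes "(a::ext) = - a" shows "a = 0"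
proof -
  have "smul 2 a = a + a" using add_smul[of 1 1 a] by simp
  also have "\<dots> = 0" using assms by (metis add.right_inverse)
  finally have "smul (1/2) (smul 2 a) = 0" by simp
  then show ?thesis by (simp only: smul_smul) simp
qed

lemma monE_empty [simp]: "monE {} = 1"
  by transfer (simp add: one_def)

lemma cf_add [simp]: "cf (a + b) S = cf a S + cf b S" by transfer simp
lemma cf_diff [simp]: "cf (a - b) S = cf a S - cf b S" by transfer simp
lemma cf_minus [simp]: "cf (- a) S = - cf a S" by transfer simp
lemma cf_zero [simp]: "cf 0 S = 0" by transfer simp
lemma cf_smul [simp]: "cf (smul c a) S = c * cf a S" by transfer (simp add: sc_def)
lemma cf_monE: "cf (monE S) U = (if finite S \<and> U = S then 1 else 0)"
  by transfer (auto simp: mon_def)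
lemma cf_sum [simp]: "cf (\<Sum>i\<in>A. f i) S = (\<Sum>i\<in>A. cf (f i) S)"
  by (induction A rule: infinite_finite_induct) auto
lemma ext_eqI: "(\<And>S. cf a S = cf b S) \<Longrightarrow> a = b"
  by transfer auto
lemma finite_support [simp]: "finite {S. cf a S \<noteq> 0}" by transfer simp
lemma support_finite: "cf a S \<noteq> 0 \<Longrightarrow> finite S" by transfer simp

lemma cf_mult_nonzeroD:
  assumes "cf (a * b) U \<noteq> 0"
  obtains S T where "cf a S \<noteq> 0" "cf b T \<noteq> 0" "S \<inter> T = {}" "U = S \<union> T" "finite U"
  using assms by (auto simp: times_ext.rep_eq elim: mult_nonzeroD)

lemma monE_mult:
  assumes "finite S" "finite T"
  shows "monE S * monE T = smul (sgn S T) (monE (S \<union> T))"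
  using assms by transfer (simp add: mult_mon)

text \<open>A factor prepended below all others creates no inversion. Inductions over monomials
  therefore add the least generator, so that the product carries no sign.\<close>

lemma e_mult_monE_min:
  assumes "finite S" "\<And>s. s \<in> S \<Longrightarrow> m < s"
  shows "e m * monE S = monE (insert m S)"
proof -
  have "{(s, t). s \<in> {m} \<and> t \<in> S \<and> t < s} = {}" "m \<notin> S"
    using assms(2) less_asym by blast+
  then have "sgn {m} S = 1"
    unfolding sgn_def by (simp only:) simp
  then show ?thesis using assms(1) by (simp add: monE_mult)
qed

lemma e_anticomm: "e s * e t = - (e t * e s)"
proof -
  have lt: "e t * e s = - (e s * e t)" if "s < t" for s t
  proof -
    have "{(a, b). a \<in> {s} \<and> b \<in> {t} \<and> b < a} = {}" "{(a, b). a \<in> {t} \<and> b \<in> {s} \<and> b < a} = {(t, s)}"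
      using that by auto
    then have "inv_count {s} {t} = 0" "inv_count {t} {s} = 1" by (simp_all only: inv_count_def) simp_all
    then have "sgn {s} {t} = 1" "sgn {t} {s} = -1" using that by (simp_all add: sgn_eq)
    then have "e s * e t = monE {s, t}" "e t * e s = - monE {t, s}"
      by (simp_all add: monE_mult smul_minus_one insert_commute)
    then show ?thesis by (simp add: insert_commute)
  qed
  consider "s < t" | "t < s" | "s = t" by linarith
  then show ?thesis
  proof cases
    case 3
    have "e s * e s = 0" by (simp add: monE_mult sgn_def)
    with 3 show ?thesis by simp
  qed (use lt[of s t] lt[of t s] in auto)
qed

lemma ext_as_sum: "a = (\<Sum>S\<in>{S. cf a S \<noteq> 0}. smul (cf a S) (monE S))"
proof (rule ext_eqI)
  fix U
  have "cf (\<Sum>S\<in>{S. cf a S \<noteq> 0}. smul (cf a S) (monE S)) U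
      = (\<Sum>S\<in>{S. cf a S \<noteq> 0}. if S = U then cf a U else 0)"
    unfolding cf_sum by (intro sum.cong) (auto simp: cf_monE support_finite)
  also have "\<dots> = cf a U" by (simp add: sum.delta)
  finally show "cf a U = cf (\<Sum>S\<in>{S. cf a S \<noteq> 0}. smul (cf a S) (monE S)) U" by simp
qed

section \<open>Subalgebras on a set of generators, and induction over them\<close>

definition LamG :: "nat set \<Rightarrow> ext set" where
  "LamG G = {a. \<forall>S. cf a S \<noteq> 0 \<longrightarrow> S \<subseteq> G}"

lemma LamG_UNIV [simp]: "a \<in> LamG UNIV" by (simp add: LamG_def)
lemma LamG_zero [simp]: "0 \<in> LamG G" by (simp add: LamG_def)
lemma LamG_monE: "S \<subseteq> G \<Longrightarrow> monE S \<in> LamG G" by (auto simp: LamG_def cf_monE)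
lemma LamG_one [simp]: "1 \<in> LamG G" using LamG_monE[of "{}"] by simp
lemma LamG_e: "s \<in> G \<Longrightarrow> e s \<in> LamG G" by (rule LamG_monE) simp
lemma LamG_add: "a \<in> LamG G \<Longrightarrow> b \<in> LamG G \<Longrightarrow> a + b \<in> LamG G"
  unfolding LamG_def by (simp, metis add.right_neutral add_0)
lemma LamG_smul: "a \<in> LamG G \<Longrightarrow> smul c a \<in> LamG G" by (auto simp: LamG_def)
lemma LamG_minus: "a \<in> LamG G \<Longrightarrow> - a \<in> LamG G" by (auto simp: LamG_def)
lemma LamG_diff: "a \<in> LamG G \<Longrightarrow> b \<in> LamG G \<Longrightarrow> a - b \<in> LamG G"
  using LamG_add[of a G "- b"] LamG_minus by simp
lemma LamG_mult: "a \<in> LamG G \<Longrightarrow> b \<in> LamG G \<Longrightarrow> a * b \<in> LamG G"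
  unfolding LamG_def mem_Collect_eq by (auto elim!: cf_mult_nonzeroD)
text \<open>Left multiplication by generators reaches everything, because a sorted monomial is its
  least generator times the rest. The set \<open>G\<close> keeps side conditions on generators
  available during the induction.\<close>

lemma ext_induct_on [consumes 1, case_names one add smul gen]:
  assumes a: "a \<in> LamG G"
    and one: "P 1"
    and add: "\<And>a b. P a \<Longrightarrow> P b \<Longrightarrow> P (a + b)"
    and smul: "\<And>c a. P a \<Longrightarrow> P (smul c a)"
    and gen: "\<And>s a. s \<in> G \<Longrightarrow> a \<in> LamG G \<Longrightarrow> P a \<Longrightarrow> P (e s * a)"
  shows "P a"
proof -
  have mono: "P (monE S)" if "finite S" "S \<subseteq> G" for S
    using that
  proof (induction S rule: finite_linorder_min_induct)
    case empty
    then show ?case using one by simp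
  next
    case (insert m S)
    then have "P (e m * monE S)" by (intro gen LamG_monE) auto
    then show ?case using insert e_mult_monE_min[of S m] by simp
  qed
  have zero: "P 0" using smul[of 1 0] one by simp
  have "P (\<Sum>S\<in>A. smul (cf a S) (monE S))" if "A \<subseteq> {S. cf a S \<noteq> 0}" for A
    using that
  proof (induction A rule: infinite_finite_induct)
    case (insert S A)
    then have "finite S" "S \<subseteq> G" using a by (auto simp: LamG_def support_finite)
    then show ?case using insert by (auto intro!: add smul mono)
  qed (use zero in auto)
  then show ?thesis using ext_as_sum[of a] by (metis subset_refl)
qed

lemmas ext_induct [case_names one add smul gen] = ext_induct_on[OF LamG_UNIV]

section \<open>Linear maps, algebra homomorphisms and skew derivations\<close>

locale lin_map =
  fixes f :: "ext \<Rightarrow> ext"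
  assumes add: "f (a + b) = f a + f b"
    and smul: "f (smul c a) = smul c (f a)"
begin

lemma zero: "f 0 = 0" using add[of 0 0] by simp
lemma minus: "f (- a) = - f a" using add[of a "- a"] zero by (simp add: eq_neg_iff_add_eq_0 add.commute)
lemma diff: "f (a - b) = f a - f b" using add[of a "- b"] minus by simp
lemma sum: "f (\<Sum>i\<in>A. g i) = (\<Sum>i\<in>A. f (g i))"
  by (induction A rule: infinite_finite_induct) (simp_all add: zero add)

end

lemma lin_map_compose: "lin_map f \<Longrightarrow> lin_map g \<Longrightarrow> lin_map (\<lambda>a. f (g a))"
  by (simp add: lin_map_def)

lemma lin_map_eqI:
  assumes "lin_map f" "lin_map g" "\<And>S. finite S \<Longrightarrow> S \<subseteq> G \<Longrightarrow> f (monE S) = g (monE S)" "a \<in> LamG G"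
  shows "f a = g a"
proof -
  interpret f: lin_map f by fact
  interpret g: lin_map g by fact
  have "f (\<Sum>S\<in>{S. cf a S \<noteq> 0}. smul (cf a S) (monE S)) = g (\<Sum>S\<in>{S. cf a S \<noteq> 0}. smul (cf a S) (monE S))"
    using assms(3,4) unfolding f.sum g.sum f.smul g.smul
    by (intro sum.cong) (auto simp: LamG_def support_finite)
  then show ?thesis by (simp flip: ext_as_sum)
qed

definition linE :: "(nat set \<Rightarrow> ext) \<Rightarrow> ext \<Rightarrow> ext" where
  "linE g a = (\<Sum>S\<in>{S. cf a S \<noteq> 0}. smul (cf a S) (g S))"

lemma linE_superset:
  assumes "finite A" "{S. cf a S \<noteq> 0} \<subseteq> A"
  shows "linE g a = (\<Sum>S\<in>A. smul (cf a S) (g S))"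
  unfolding linE_def by (rule sum.mono_neutral_left) (use assms in auto)

lemma lin_map_linE: "lin_map (linE g)"
proof
  fix a b :: ext and c
  let ?A = "{S. cf a S \<noteq> 0} \<union> {S. cf b S \<noteq> 0}"
  have "linE g (a + b) = (\<Sum>S\<in>?A. smul (cf (a + b) S) (g S))"
    by (rule linE_superset) auto
  also have "\<dots> = (\<Sum>S\<in>?A. smul (cf a S) (g S)) + (\<Sum>S\<in>?A. smul (cf b S) (g S))"
    by (simp add: add_smul sum.distrib)
  also have "\<dots> = linE g a + linE g b"
    by (simp add: linE_superset[of ?A])
  finally show "linE g (a + b) = linE g a + linE g b" .
  have "linE g (smul c a) = (\<Sum>S\<in>{S. cf a S \<noteq> 0}. smul (cf (smul c a) S) (g S))"
    by (rule linE_superset) auto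
  then show "linE g (smul c a) = smul c (linE g a)"
    by (simp add: linE_def smul.scale_sum_right)
qed

lemma linE_monE: "finite S \<Longrightarrow> linE g (monE S) = g S"
  by (subst linE_superset[of "{S}"]) (auto simp: cf_monE)

lemma sorted_list_of_set_insert_min:
  assumes "finite S" "\<And>s. s \<in> S \<Longrightarrow> (m::nat) < s"
  shows "sorted_list_of_set (insert m S) = m # sorted_list_of_set S"
proof -
  have "m \<notin> S" using assms(2) by blast
  moreover have "insort m (sorted_list_of_set S) = m # sorted_list_of_set S"
    by (rule insort_is_Cons) (use assms in \<open>auto simp: less_imp_le\<close>)
  ultimately show ?thesis using assms(1) by simp
qed

locale alg_hom = lin_map h for h +
  assumes one: "h 1 = 1" and mult: "h (a * b) = h a * h b"

text \<open>The Leibniz rule is demanded for a generator as left factor. All generators are odd, so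
  the sign is fixed and no parity has to be defined.\<close>

locale skew_der = lin_map D for D +
  fixes \<delta> :: "nat \<Rightarrow> ext"
  assumes one: "D 1 = 0" and gen: "D (e s * a) = \<delta> s * a - e s * D a"
begin

lemma e: "D (e s) = \<delta> s"
  using gen[of s 1] one by simp

lemma LamG_zero:
  assumes "a \<in> LamG G" "\<And>s. s \<in> G \<Longrightarrow> \<delta> s = 0"
  shows "D a = 0"
  using assms(1)
  by (induction rule: ext_induct_on) (simp_all add: one add smul gen assms(2))

end

lemma alg_homI:
  assumes "lin_map h" "h 1 = 1" and gen: "\<And>s a. h (e s * a) = h (e s) * h a"
  shows "alg_hom h"
proof -
  interpret lin_map h by fact
  have "h (a * b) = h a * h b" for a b
    by (induction a rule: ext_induct)
       (simp_all add: assms(2) gen mult.assoc distrib_right add smul)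
  then show ?thesis using assms(2) by unfold_locales
qed

lemma alg_hom_compose: "alg_hom f \<Longrightarrow> alg_hom g \<Longrightarrow> alg_hom (\<lambda>a. f (g a))"
  by (simp add: alg_hom_def alg_hom_axioms_def lin_map_compose)

lemma alg_hom_id: "alg_hom (\<lambda>a. a)"
  by unfold_locales auto

lemma alg_hom_eqI:
  assumes "alg_hom f" "alg_hom g" "a \<in> LamG G" "\<And>s. s \<in> G \<Longrightarrow> f (e s) = g (e s)"
  shows "f a = g a"
proof -
  interpret f: alg_hom f by fact
  interpret g: alg_hom g by fact
  show ?thesis using assms(3)
    by (induction rule: ext_induct_on)
       (simp_all add: f.one g.one f.add g.add f.smul g.smul f.mult g.mult assms(4))
qed

section \<open>The universal property of the exterior algebra\<close>

definition prodL :: "(nat \<Rightarrow> ext) \<Rightarrow> nat list \<Rightarrow> ext" where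
  "prodL \<phi> L = foldr (\<lambda>s a. \<phi> s * a) L 1"

lemma prodL_simps [simp]: "prodL \<phi> [] = 1" "prodL \<phi> (s # L) = \<phi> s * prodL \<phi> L"
  by (simp_all add: prodL_def)

lemma prodL_e: "finite S \<Longrightarrow> prodL e (sorted_list_of_set S) = monE S"
  by (induction S rule: finite_linorder_min_induct)
     (simp_all add: sorted_list_of_set_insert_min e_mult_monE_min del: sorted_list_of_set_insert_remove)

definition homE :: "(nat \<Rightarrow> ext) \<Rightarrow> ext \<Rightarrow> ext" where
  "homE \<phi> = linE (\<lambda>S. prodL \<phi> (sorted_list_of_set S))"

lemma monE_LamG_above: "(\<And>s. s \<in> S \<Longrightarrow> (m::nat) < s) \<Longrightarrow> monE S \<in> LamG {m<..}"
  by (rule LamG_monE) auto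

lemma e_square: "e s * e s = 0"
  using e_anticomm[of s s] self_neg_zero by blast

lemma e_left_anticomm: "e s * (e t * a) = - (e t * (e s * a))"
proof -
  have "e s * (e t * a) = (e s * e t) * a" by (simp add: mult.assoc)
  also have "\<dots> = - (e t * e s) * a" by (simp add: e_anticomm[of s t])
  also have "\<dots> = - (e t * (e s * a))" by (simp add: mult.assoc)
  finally show ?thesis .
qed

text \<open>The core of the universal property: pairwise anticommuting images suffice. A generator
  is moved into a sorted monomial past the least factor \<open>m\<close>; if it equals
  \<open>m\<close>, both sides vanish, and if it is larger, it is exchanged with \<open>m\<close> on
  both sides at the cost of the same sign.\<close>

lemma homE_gen:
  assumes anti: "\<And>s t. \<phi> s * \<phi> t = - (\<phi> t * \<phi> s)"
  shows "homE \<phi> (e s * a) = \<phi> s * homE \<phi> a"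
proof -
  interpret lin_map "homE \<phi>" unfolding homE_def by (rule lin_map_linE)
  have lmul: "lin_map (\<lambda>a. c * f a)" if "lin_map f" for f and c :: ext
    using that by (auto simp: lin_map_def algebra_simps)
  have lmul': "lin_map (\<lambda>a. f (c * a))" if "lin_map f" for f and c :: ext
    using that by (auto simp: lin_map_def algebra_simps)
  have mon: "homE \<phi> (e m * monE S) = \<phi> m * homE \<phi> (monE S)"
    if "finite S" "\<And>s. s \<in> S \<Longrightarrow> m < s" for m S
    using that
    by (simp add: homE_def e_mult_monE_min linE_monE sorted_list_of_set_insert_min del: sorted_list_of_set_insert_remove)
  \<comment> \<open>A product such as \<open>e s * monE S\<close> is not a sorted monomial, so the
    rule for a small left factor is needed for all combinations of monomials above
    \<open>m\<close>.\<close>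
  have above: "homE \<phi> (e m * w) = \<phi> m * homE \<phi> w" if "w \<in> LamG {m<..}" for m w
    by (rule lin_map_eqI[OF lmul'[OF lin_map_axioms, of "e m"] lmul[OF lin_map_axioms, of "\<phi> m"] _ that])
       (auto intro!: mon)
  have sq: "\<phi> m * \<phi> m = 0" for m using anti[of m m] self_neg_zero by blast
  have "homE \<phi> (e s * monE S) = \<phi> s * homE \<phi> (monE S)" if "finite S" for S
    using that
  proof (induction S rule: finite_linorder_min_induct)
    case empty
    show ?case by (rule mon) auto
  next
    case (insert m S)
    have M: "monE (insert m S) = e m * monE S" "monE S \<in> LamG {m<..}"
      using insert by (auto simp: e_mult_monE_min intro: monE_LamG_above)
    consider "s < m" | "s = m" | "m < s" by linarith
    then show ?case
    proof cases
      case 1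
      then show ?thesis using insert by (intro mon) auto
    next
      case 2
      have "e s * (e s * monE S) = 0" by (simp add: mult.assoc[symmetric] e_square)
      moreover have "\<phi> s * (\<phi> s * homE \<phi> (monE S)) = 0" by (simp add: mult.assoc[symmetric] sq)
      ultimately show ?thesis using 2 M above by (simp add: zero)
    next
      case 3
      have "e s * monE S \<in> LamG {m<..}" using 3 M(2) by (intro LamG_mult LamG_e) auto
      then have "homE \<phi> (e s * (e m * monE S)) = - (\<phi> m * (\<phi> s * homE \<phi> (monE S)))"
        by (simp add: e_left_anticomm[of s m] minus above insert.IH)
      also have "\<dots> = \<phi> s * (\<phi> m * homE \<phi> (monE S))"
        using anti[of s m] by (simp add: mult.assoc[symmetric])
      finally show ?thesis using M above by simp
    qed
  qed
  note main = this
  show ?thesis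
    by (rule lin_map_eqI[OF lmul'[OF lin_map_axioms, of "e s"] lmul[OF lin_map_axioms, of "\<phi> s"] _ LamG_UNIV])
       (rule main)
qed

lemma homE_one [simp]: "homE \<phi> 1 = 1"
  using linE_monE[of "{}"] by (simp add: homE_def)

lemma alg_hom_homE:
  assumes anti: "\<And>s t. \<phi> s * \<phi> t = - (\<phi> t * \<phi> s)"
  shows "alg_hom (homE \<phi>)"
proof (rule alg_homI)
  have gen: "homE \<phi> (e s * a) = \<phi> s * homE \<phi> a" for s a
    by (rule homE_gen) (rule anti)
  show "homE \<phi> (e s * a) = homE \<phi> (e s) * homE \<phi> a" for s a
    using gen[of s 1] gen[of s a] by simp
qed (simp_all add: lin_map_linE homE_def[abs_def] homE_one[unfolded homE_def])

lemma homE_e: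
  assumes anti: "\<And>s t. \<phi> s * \<phi> t = - (\<phi> t * \<phi> s)"
  shows "homE \<phi> (e s) = \<phi> s"
proof -
  have "homE \<phi> (e s * 1) = \<phi> s * homE \<phi> 1"
    by (rule homE_gen) (rule anti)
  then show ?thesis by simp
qed

section \<open>Skew derivations with prescribed values on the generators\<close>

definition central :: "ext \<Rightarrow> bool" where "central a \<longleftrightarrow> (\<forall>b. a * b = b * a)"

fun derL :: "(nat \<Rightarrow> ext) \<Rightarrow> nat list \<Rightarrow> ext" where
  "derL \<delta> [] = 0"
| "derL \<delta> (s # L) = \<delta> s * prodL e L - e s * derL \<delta> L"

definition derE :: "(nat \<Rightarrow> ext) \<Rightarrow> ext \<Rightarrow> ext" where
  "derE \<delta> = linE (\<lambda>S. derL \<delta> (sorted_list_of_set S))"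

text \<open>Reordering two generators moves a value \<open>\<delta> s\<close> past a generator,
  which is where centrality enters. Both uses provide it: the differential takes products of two odd
  elements or zero as values, a contraction takes 0 and 1.\<close>

lemma skew_der_derE:
  assumes cen: "\<And>s. central (\<delta> s)"
  shows "skew_der (derE \<delta>) \<delta>"
proof -
  let ?D = "derE \<delta>"
  interpret lin_map ?D unfolding derE_def by (rule lin_map_linE)
  have l1: "lin_map (\<lambda>a. ?D (c * a))" for c :: ext
    by unfold_locales (simp_all add: distrib_left add smul)
  have l2: "lin_map (\<lambda>a. d * a - c * ?D a)" for c d :: ext
    by unfold_locales (simp_all add: algebra_simps add smul smul.scale_right_diff_distrib)
  have one: "?D 1 = 0" using linE_monE[of "{}"] by (simp add: derE_def)
  have mon: "?D (e m * monE S) = \<delta> m * monE S - e m * ?D (monE S)"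
    if "finite S" "\<And>s. s \<in> S \<Longrightarrow> m < s" for m S
    using that
    by (simp add: derE_def e_mult_monE_min linE_monE sorted_list_of_set_insert_min prodL_e
             del: sorted_list_of_set_insert_remove)
  have above: "?D (e m * w) = \<delta> m * w - e m * ?D w" if "w \<in> LamG {m<..}" for m w
    by (rule lin_map_eqI[OF l1[of "e m"] l2[of "\<delta> m" "e m"] _ that]) (auto intro!: mon)
  have c: "\<delta> s * b = b * \<delta> s" for s b using cen by (auto simp: central_def)
  have "?D (e s * monE S) = \<delta> s * monE S - e s * ?D (monE S)" if "finite S" for s S
    using that
  proof (induction S rule: finite_linorder_min_induct)
    case empty
    show ?case by (rule mon) auto
  next
    case (insert m S)
    have M: "monE (insert m S) = e m * monE S" "monE S \<in> LamG {m<..}"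
      using insert by (auto simp: e_mult_monE_min intro: monE_LamG_above)
    have DM: "?D (e m * monE S) = \<delta> m * monE S - e m * ?D (monE S)" by (rule above[OF M(2)])
    consider "s < m" | "s = m" | "m < s" by linarith
    then show ?case
    proof cases
      case 1
      then show ?thesis using insert by (intro mon) auto
    next
      case 2
      have sq: "e m * (e m * b) = 0" for b by (simp add: mult.assoc[symmetric] e_square)
      have "\<delta> m * (e m * monE S) = e m * (\<delta> m * monE S)"
        using c[of m "e m"] by (metis mult.assoc)
      then show ?thesis using 2 sq by (simp add: M(1) DM zero right_diff_distrib)
    next
      case 3
      have "e s * monE S \<in> LamG {m<..}" using 3 M(2) by (intro LamG_mult LamG_e) auto
      then have "?D (e s * (e m * monE S)) =
          - (\<delta> m * (e s * monE S) - e m * (\<delta> s * monE S - e s * ?D (monE S)))"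
        by (simp add: e_left_anticomm[of s m] minus above insert.IH)
      also have "\<dots> = \<delta> s * (e m * monE S) - e s * (\<delta> m * monE S - e m * ?D (monE S))"
        using c[of s "e m"] c[of m "e s"] e_left_anticomm[of m s]
        by (simp add: right_diff_distrib) (metis mult.assoc)
      finally show ?thesis by (simp add: M(1) DM)
    qed
  qed
  note main = this
  have "?D (e s * a) = \<delta> s * a - e s * ?D a" for s a
    by (rule lin_map_eqI[OF l1[of "e s"] l2[of "\<delta> s" "e s"] _ LamG_UNIV]) (rule main)
  with one show ?thesis by unfold_locales
qed

text \<open>The linear span of the generators. Its elements anticommute pairwise, so any assignment
  of generators to elements of this span extends to a homomorphism; all homomorphisms below arise in
  this way.\<close>

inductive_set odd1 :: "ext set" where
  gen: "e s \<in> odd1"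
| add: "a \<in> odd1 \<Longrightarrow> b \<in> odd1 \<Longrightarrow> a + b \<in> odd1"
| smul: "a \<in> odd1 \<Longrightarrow> smul c a \<in> odd1"

lemma odd1_zero: "0 \<in> odd1" using odd1.smul[OF odd1.gen, of 0] by simp
lemma odd1_minus: "a \<in> odd1 \<Longrightarrow> - a \<in> odd1" using odd1.smul[of a "-1"] by (simp add: smul_minus_one)
lemma odd1_diff: "a \<in> odd1 \<Longrightarrow> b \<in> odd1 \<Longrightarrow> a - b \<in> odd1"
  using odd1.add[OF _ odd1_minus, of a b] by simp

lemmas odd1_intros = odd1.gen odd1.add odd1.smul odd1_zero odd1_minus odd1_diff

lemma odd1_anticomm:
  assumes "a \<in> odd1" "b \<in> odd1" shows "a * b = - (b * a)"
  using assms
proof (induction a rule: odd1.induct)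
  case (gen s)
  then show ?case
  proof (induction b rule: odd1.induct)
    case (gen t)
    show ?case by (rule e_anticomm)
  qed (simp_all add: distrib_left distrib_right)
qed (auto simp: distrib_left distrib_right)

lemma odd1_square: "a \<in> odd1 \<Longrightarrow> a * a = 0"
  using odd1_anticomm self_neg_zero by blast

lemma odd1_left_anticomm:
  assumes "a \<in> odd1" "b \<in> odd1" shows "a * (b * c) = - (b * (a * c))"
  using odd1_anticomm[OF assms] by (metis mult.assoc mult_minus_left)

lemma odd1_left_square: "a \<in> odd1 \<Longrightarrow> a * (a * c) = 0"
  by (simp add: mult.assoc[symmetric] odd1_square)

lemma centralI:
  assumes "\<And>s. a * e s = e s * a" shows "central a"
proof -
  have "a * b = b * a" for b
  proof (induction b rule: ext_induct)
    case (gen s b)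
    then show ?case using assms[of s] by (metis mult.assoc)
  qed (auto simp: distrib_left distrib_right)
  then show ?thesis by (simp add: central_def)
qed

lemma central_odd1_mult:
  assumes "a \<in> odd1" "b \<in> odd1" shows "central (a * b)"
proof (rule centralI)
  fix s
  have "a * b * e s = a * - (e s * b)"
    using odd1_anticomm[OF assms(2) odd1.gen[of s]] by (simp add: mult.assoc)
  also have "\<dots> = e s * a * b"
    using odd1_left_anticomm[OF assms(1) odd1.gen[of s]] by (simp add: mult.assoc)
  finally show "a * b * e s = e s * (a * b)" by (simp add: mult.assoc)
qed

lemma central_zero: "central 0" by (simp add: central_def)
lemma central_one: "central 1" by (simp add: central_def)

lemma (in skew_der) odd:
  "u \<in> odd1 \<Longrightarrow> D (u * a) = D u * a - u * D a"
  by (induction rule: odd1.induct)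
     (simp_all add: gen e distrib_right add smul smul.scale_right_diff_distrib)

text \<open>The equation propagates along left multiplication by a generator, so it has to be
  checked on generators alone. Their images must be odd for the Leibniz rule of \<open>D'\<close> to
  produce the same sign.\<close>

lemma skew_der_hom_commute:
  assumes "alg_hom h" "skew_der D \<delta>" "skew_der D' \<delta>'"
    and "a \<in> LamG G"
    and "\<And>s. s \<in> G \<Longrightarrow> h (e s) \<in> odd1" "\<And>s. s \<in> G \<Longrightarrow> D' (h (e s)) = h (\<delta> s)"
  shows "D' (h a) = h (D a)"
proof -
  interpret h: alg_hom h by fact
  interpret D: skew_der D \<delta> by fact
  interpret D': skew_der D' \<delta>' by fact
  show ?thesis using assms(4)
    by (induction rule: ext_induct_on)
       (simp_all add: h.one D.one D'.one h.zero h.add D.add D'.add h.smul D.smul D'.smul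
         h.mult D.gen h.diff D'.odd assms(5,6))
qed

section \<open>Generators, relations and the differential\<close>

abbreviation ex :: "nat \<Rightarrow> ext" where "ex i \<equiv> e (gx i)"
abbreviation ey :: "nat \<Rightarrow> ext" where "ey i \<equiv> e (gy i)"
abbreviation ew :: "nat \<Rightarrow> nat \<Rightarrow> ext" where "ew i j \<equiv> e (gw i j)"
definition xd :: "nat \<Rightarrow> nat \<Rightarrow> ext" where "xd i j = ex i - ex j"
definition yd :: "nat \<Rightarrow> nat \<Rightarrow> ext" where "yd i j = ey i - ey j"

lemma xd_odd [simp]: "xd i j \<in> odd1" and yd_odd [simp]: "yd i j \<in> odd1"
  by (auto simp: xd_def yd_def intro: odd1_intros)
lemma e_odd [simp]: "e s \<in> odd1" by (rule odd1.gen)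
lemma xd_self [simp]: "xd i i = 0" and yd_self [simp]: "yd i i = 0"
  by (simp_all add: xd_def yd_def)
lemma xd_swap: "xd j i = - xd i j" and yd_swap: "yd j i = - yd i j"
  by (simp_all add: xd_def yd_def)

lemma gw_commute: "gw i j = gw j i"
  by (simp add: gw_def min.commute max.commute)

lemma gx_mod [simp]: "gx i mod 3 = 0" "gx i div 3 = i" by (auto simp: gx_def)
lemma gy_mod [simp]: "gy i mod 3 = 1" "gy i div 3 = i" by (auto simp: gy_def)
lemma gw_mod [simp]: "gw i j mod 3 = 2" "gw i j div 3 = prod_encode (min i j, max i j)"
  unfolding gw_def by presburger+

lemma gx_eq [simp]: "gx i = gx j \<longleftrightarrow> i = j" and gy_eq [simp]: "gy i = gy j \<longleftrightarrow> i = j"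
  by (auto simp: gx_def gy_def)
lemma gw_eq: "gw i j = gw k l \<longleftrightarrow> (i = k \<and> j = l) \<or> (i = l \<and> j = k)"
  by (auto simp: gw_def prod_encode_eq min_def max_def)
lemma gen_neq [simp]:
  "gx i \<noteq> gy j" "gy j \<noteq> gx i" "gx i \<noteq> gw k l" "gw k l \<noteq> gx i" "gy i \<noteq> gw k l" "gw k l \<noteq> gy i"
proof -
  have "gx i mod 3 \<noteq> gy j mod 3" "gx i mod 3 \<noteq> gw k l mod 3" "gy i mod 3 \<noteq> gw k l mod 3"
    by (simp_all only: gx_mod gy_mod gw_mod)
  then show "gx i \<noteq> gy j" "gy j \<noteq> gx i" "gx i \<noteq> gw k l" "gw k l \<noteq> gx i" "gy i \<noteq> gw k l" "gw k l \<noteq> gy i"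
    by metis+
qed

lemma gen_cases:
  obtains (x) i where "s = gx i" | (y) i where "s = gy i"
    | (w) i j where "s mod 3 = 2" "prod_decode (s div 3) = (i, j)"
proof -
  consider "s mod 3 = 0" | "s mod 3 = 1" | "s mod 3 = 2" by linarith
  then show thesis
  proof cases
    case 1
    then have "s = gx (s div 3)" unfolding gx_def by presburger
    then show ?thesis by (rule x)
  next
    case 2
    then have "s = gy (s div 3)" unfolding gy_def by presburger
    then show ?thesis by (rule y)
  next
    case 3
    then show ?thesis using w by (cases "prod_decode (s div 3)") auto
  qed
qed

definition gensE :: "nat set \<Rightarrow> nat set" where
  "gensE J = gx ` J \<union> gy ` J \<union> {gw i j | i j. i \<in> J \<and> j \<in> J \<and> i \<noteq> j}"

lemma gensE_cases [consumes 1, case_names x y w]: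
  assumes "s \<in> gensE J"
  obtains i where "s = gx i" "i \<in> J" | i where "s = gy i" "i \<in> J"
    | i j where "s = gw i j" "i \<in> J" "j \<in> J" "i \<noteq> j"
  using assms by (auto simp: gensE_def)

lemma gx_in_gensE [simp]: "gx i \<in> gensE J \<longleftrightarrow> i \<in> J"
  and gy_in_gensE [simp]: "gy i \<in> gensE J \<longleftrightarrow> i \<in> J"
  and gw_in_gensE [simp]: "gw i j \<in> gensE J \<longleftrightarrow> i \<in> J \<and> j \<in> J \<and> i \<noteq> j"
  by (auto simp: gensE_def gw_eq)

lemma LamG_gens [intro]:
  "i \<in> J \<Longrightarrow> ex i \<in> LamG (gensE J)" "i \<in> J \<Longrightarrow> ey i \<in> LamG (gensE J)"
  "i \<in> J \<Longrightarrow> j \<in> J \<Longrightarrow> i \<noteq> j \<Longrightarrow> ew i j \<in> LamG (gensE J)"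
  "i \<in> J \<Longrightarrow> j \<in> J \<Longrightarrow> xd i j \<in> LamG (gensE J)"
  "i \<in> J \<Longrightarrow> j \<in> J \<Longrightarrow> yd i j \<in> LamG (gensE J)"
  by (auto simp: xd_def yd_def intro!: LamG_diff LamG_e)

definition Rel :: "nat set \<Rightarrow> ext set" where
  "Rel J = {xd i j * ew i j | i j. i \<in> J \<and> j \<in> J \<and> i \<noteq> j}
         \<union> {yd i j * ew i j | i j. i \<in> J \<and> j \<in> J \<and> i \<noteq> j}
         \<union> {ew i j * ew j k + ew j k * ew k i + ew k i * ew i j | i j k.
              i \<in> J \<and> j \<in> J \<and> k \<in> J \<and> i \<noteq> j \<and> j \<noteq> k \<and> k \<noteq> i}"

lemma Rel_cases [consumes 1, case_names x y arnold]:
  assumes "r \<in> Rel J"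
  obtains i j where "r = xd i j * ew i j" "i \<in> J" "j \<in> J" "i \<noteq> j"
    | i j where "r = yd i j * ew i j" "i \<in> J" "j \<in> J" "i \<noteq> j"
    | i j k where "r = ew i j * ew j k + ew j k * ew k i + ew k i * ew i j"
        "i \<in> J" "j \<in> J" "k \<in> J" "i \<noteq> j" "j \<noteq> k" "k \<noteq> i"
  using assms unfolding Rel_def by auto

text \<open>The ideal is taken in the whole exterior algebra, which avoids side conditions on multipliers;
  lemma \<open>Id_cf_iff\<close> recovers \<open>Id n\<close> from it by intersecting with \<open>Lam n\<close>. A left ideal suffices
  since the relations are central.\<close>

inductive_set I :: "nat set \<Rightarrow> ext set" for J where
  rel: "r \<in> Rel J \<Longrightarrow> r \<in> I J"
| zero: "0 \<in> I J"
| add: "a \<in> I J \<Longrightarrow> b \<in> I J \<Longrightarrow> a + b \<in> I J"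
| smul: "a \<in> I J \<Longrightarrow> smul c a \<in> I J"
| gen: "a \<in> I J \<Longrightarrow> e s * a \<in> I J"

lemma I_minus: "a \<in> I J \<Longrightarrow> - a \<in> I J" using I.smul[of a J "-1"] by (simp add: smul_minus_one)
lemma I_minus_iff [simp]: "- a \<in> I J \<longleftrightarrow> a \<in> I J" using I_minus[of a] I_minus[of "- a"] by auto
lemma I_diff: "a \<in> I J \<Longrightarrow> b \<in> I J \<Longrightarrow> a - b \<in> I J" using I.add[OF _ I_minus, of a J b] by simp
lemma I_sum: "(\<And>i. i \<in> A \<Longrightarrow> f i \<in> I J) \<Longrightarrow> (\<Sum>i\<in>A. f i) \<in> I J"
  by (induction A rule: infinite_finite_induct) (auto intro: I.intros)
lemma I_lmult: "a \<in> I J \<Longrightarrow> u * a \<in> I J"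
  by (induction u rule: ext_induct) (auto simp: distrib_right mult.assoc intro: I.intros)

lemma I_congD: "a - b \<in> I J \<Longrightarrow> b \<in> I J \<Longrightarrow> a \<in> I J"
  using I.add[of "a - b" J b] by simp

lemma central_add: "central a \<Longrightarrow> central b \<Longrightarrow> central (a + b)"
  by (simp add: central_def algebra_simps)

lemma I_rmult: "a \<in> I J \<Longrightarrow> a * u \<in> I J"
proof (induction rule: I.induct)
  case (rel r)
  then have "central r"
    by (cases rule: Rel_cases) (auto intro!: central_add central_odd1_mult)
  then have "r * u = u * r" by (simp add: central_def)
  then show ?case using rel by (simp add: I_lmult I.rel)
qed (auto simp: distrib_right mult.assoc intro: I.intros)

lemma I_relx: "i \<in> J \<Longrightarrow> j \<in> J \<Longrightarrow> i \<noteq> j \<Longrightarrow> xd i j * ew i j \<in> I J"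
  and I_rely: "i \<in> J \<Longrightarrow> j \<in> J \<Longrightarrow> i \<noteq> j \<Longrightarrow> yd i j * ew i j \<in> I J"
  and I_arnold: "i \<in> J \<Longrightarrow> j \<in> J \<Longrightarrow> k \<in> J \<Longrightarrow> i \<noteq> j \<Longrightarrow> j \<noteq> k \<Longrightarrow> k \<noteq> i \<Longrightarrow>
     ew i j * ew j k + ew j k * ew k i + ew k i * ew i j \<in> I J"
  by (rule I.rel, unfold Rel_def, rule UnI1, rule UnI1, blast)
     (rule I.rel, unfold Rel_def, rule UnI1, rule UnI2, blast,
      rule I.rel, unfold Rel_def, rule UnI2, blast)

lemma I_mono: assumes "J \<subseteq> K" "a \<in> I J" shows "a \<in> I K"
  using assms(2)
proof induction
  case (rel r)
  then show ?case using assms(1) by (cases rule: Rel_cases) (auto intro: I_relx I_rely I_arnold)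
qed (auto intro: I.intros)

lemma I_hom:
  assumes "alg_hom h" "\<And>r. r \<in> Rel J \<Longrightarrow> h r \<in> I K" "a \<in> I J"
  shows "h a \<in> I K"
proof -
  interpret alg_hom h by fact
  show ?thesis using assms(3)
    by induction (auto simp: add smul zero mult intro: assms(2) I_lmult I.intros)
qed

lemma I_der:
  assumes "skew_der D \<delta>" "\<And>r. r \<in> Rel J \<Longrightarrow> D r \<in> I J" "a \<in> I J"
  shows "D a \<in> I J"
proof -
  interpret skew_der D \<delta> by fact
  show ?thesis using assms(3)
    by induction (auto simp: add smul zero gen intro!: I_diff intro: assms(2) I_lmult I.intros)
qed

section \<open>The differential and its descent to the quotient\<close>

definition dg :: "nat \<Rightarrow> ext" where
  "dg s = (if s mod 3 = 2 then (case prod_decode (s div 3) of (i, j) \<Rightarrow> xd i j * yd i j) else 0)"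

definition dE :: "ext \<Rightarrow> ext" where "dE = derE dg"

lemma dg_gens [simp]: "dg (gx i) = 0" "dg (gy i) = 0" "dg (gw i j) = xd i j * yd i j"
  by (simp_all add: dg_def min_def max_def xd_swap[of j i] yd_swap[of j i])

lemma central_dg: "central (dg s)"
  by (cases s rule: gen_cases) (auto simp: dg_def intro: central_odd1_mult central_zero)

interpretation dE: skew_der dE dg
  unfolding dE_def by (rule skew_der_derE) (rule central_dg)

lemma dE_gens [simp]: "dE (ex i) = 0" "dE (ey i) = 0" "dE (xd i j) = 0" "dE (yd i j) = 0"
  "dE (ew i j) = xd i j * yd i j"
  by (simp_all add: dE.e xd_def yd_def dE.diff)

lemma dE_xd [simp]: "dE (xd i j * a) = - (xd i j * dE a)"
  and dE_yd [simp]: "dE (yd i j * a) = - (yd i j * dE a)"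
  by (simp_all add: dE.odd)

lemma dE_ew [simp]: "dE (ew i j * a) = xd i j * (yd i j * a) - ew i j * dE a"
  by (simp add: dE.gen mult.assoc)

lemma dE_dg [simp]: "dE (dg s * a) = dg s * dE a"
  by (cases s rule: gen_cases) (simp_all add: dg_def dE.zero mult.assoc)

lemma dE_dE [simp]: "dE (dE a) = 0"
  by (induction a rule: ext_induct) (simp_all add: dE.one dE.zero dE.add dE.smul dE.gen dE.diff)

lemma dE_I: assumes "a \<in> I J" shows "dE a \<in> I J"
proof (rule I_der[OF dE.skew_der_axioms _ assms])
  fix r assume "r \<in> Rel J"
  then show "dE r \<in> I J"
  proof (cases rule: Rel_cases)
    case (x i j)
    have "xd i j * (xd i j * yd i j) = 0" by (simp add: odd1_left_square)
    then show ?thesis using x by (simp add: I.zero)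
  next
    case (y i j)
    have "yd i j * (xd i j * yd i j) = 0"
      using odd1_left_anticomm[of "yd i j" "xd i j" "yd i j"] by (simp add: odd1_square)
    then show ?thesis using y by (simp add: I.zero)
  next
    case (arnold i j k)
    have "dE r = dg (gw i j) * (ew j k - ew k i) + dg (gw j k) * (ew k i - ew i j)
        + dg (gw k i) * (ew i j - ew j k)"
      using central_dg unfolding arnold central_def
      by (simp only: dE.add dE.gen dE.e) (simp add: algebra_simps)
    moreover have "dg (gw i j) * (ew j k - ew k i) + dg (gw j k) * (ew k i - ew i j)
        + dg (gw k i) * (ew i j - ew j k) \<in> I J"
    proof -
      \<comment> \<open>On the diagonal where the points j and k coincide, the two products agree.
        The identity writes their difference as a combination of \<open>xd k j\<close> and
        \<open>yd k j\<close>, both of which \<open>ew j k\<close> annihilates modulo the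
        relations.\<close>
      have yx: "xd i j * yd i j - xd k i * yd k i = - (xd k j * yd k i) + xd i j * yd k j" for i j k
        by (simp add: xd_def yd_def algebra_simps)
      have w: "(xd i j * yd i j - xd k i * yd k i) * ew j k \<in> I J"
        if ijk: "i \<in> J" "j \<in> J" "k \<in> J" "i \<noteq> j" "j \<noteq> k" "k \<noteq> i" for i j k
      proof -
        have "(xd i j * yd i j - xd k i * yd k i) * ew j k
            = yd k i * (xd k j * ew k j) + xd i j * (yd k j * ew k j)"
          using odd1_left_anticomm[of "xd k j" "yd k i" "ew k j"]
          unfolding yx by (simp add: distrib_right left_diff_distrib mult.assoc gw_commute[of j k])
        also have "\<dots> \<in> I J" using ijk by (intro I.add I_lmult I_relx I_rely) auto
        finally show ?thesis .
      qed
      have "dg (gw i j) * (ew j k - ew k i) + dg (gw j k) * (ew k i - ew i j)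
          + dg (gw k i) * (ew i j - ew j k) =
          (xd i j * yd i j - xd k i * yd k i) * ew j k +
          (xd j k * yd j k - xd i j * yd i j) * ew k i +
          (xd k i * yd k i - xd j k * yd j k) * ew i j"
        by (simp add: algebra_simps)
      also have "\<dots> \<in> I J"
        using w[of i j k] w[of j k i] w[of k i j] arnold by (intro I.add) auto
      finally show ?thesis .
    qed
    ultimately show ?thesis by simp
  qed
qed

lemma LamG_dE: "a \<in> LamG (gensE J) \<Longrightarrow> dE a \<in> LamG (gensE J)"
proof (induction rule: ext_induct_on)
  case (gen s a)
  then have "dg s \<in> LamG (gensE J)"
    by (cases s rule: gensE_cases) (auto intro!: LamG_mult LamG_gens)
  then show ?case using gen by (auto simp: dE.gen intro!: LamG_diff LamG_mult LamG_e)
qed (auto simp: dE.one dE.add dE.smul intro: LamG_add LamG_smul)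

text \<open>Contraction with the dual vector of the generator \<open>t\<close>. It extracts the
  coefficient of \<open>t\<close>, up to sign, and is again a skew derivation.\<close>

definition pd :: "nat \<Rightarrow> ext \<Rightarrow> ext" where "pd t = derE (\<lambda>s. if s = t then 1 else 0)"

interpretation pd: skew_der "pd t" "\<lambda>s. if s = t then 1 else 0" for t
  unfolding pd_def by (rule skew_der_derE) (simp add: central_one central_zero)

lemma pd_e_mult [simp]: "pd t (e s * a) = (if s = t then a - e s * pd t a else - (e s * pd t a))"
  by (simp add: pd.gen)

lemma pd_e [simp]: "pd t (e s) = (if s = t then 1 else 0)"
  by (simp add: pd.e)

lemma pd_xd_mult: "pd t (xd i j * a) = pd t (xd i j) * a - xd i j * pd t a"
  and pd_yd_mult: "pd t (yd i j * a) = pd t (yd i j) * a - yd i j * pd t a"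
  by (simp_all add: pd.odd)

lemma pd_xd_yd [simp]:
  "pd (gw l m) (xd i j) = 0" "pd (gw l m) (yd i j) = 0"
  "pd (gx l) (yd i j) = 0" "pd (gy l) (xd i j) = 0"
  "pd (gx l) (xd i j) = (if i = l then 1 else 0) - (if j = l then 1 else 0)"
  "pd (gy l) (yd i j) = (if i = l then 1 else 0) - (if j = l then 1 else 0)"
  by (simp_all add: xd_def yd_def pd.diff)

lemma pd_dg: "pd (gw l j) (dg s * a) = dg s * pd (gw l j) a"
  by (cases s rule: gen_cases) (simp_all add: dg_def pd.zero mult.assoc pd_xd_mult pd_yd_mult)

text \<open>No value of \<open>dg\<close> involves an omega, so contraction along an edge
  anticommutes with the differential. Contraction along an x or a y would meet the values of
  \<open>dg\<close>.\<close>

lemma pd_dE: "pd (gw l j) (dE a) = - dE (pd (gw l j) a)"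
proof (induction a rule: ext_induct)
  case (gen s a)
  then show ?case
    by (simp add: dE.gen pd.diff pd_dg dE.diff dE.minus)
qed (simp_all add: pd.one dE.one pd.zero dE.zero dE.add pd.add dE.smul pd.smul)

lemma pd_zero: "a \<in> LamG G \<Longrightarrow> t \<notin> G \<Longrightarrow> pd t a = 0"
  by (erule pd.LamG_zero) auto

lemma LamG_Rel: "r \<in> Rel J \<Longrightarrow> r \<in> LamG (gensE J)"
  by (cases rule: Rel_cases) (auto intro!: LamG_add LamG_mult LamG_gens)

lemma pd_I: "a \<in> I J \<Longrightarrow> t \<notin> gensE J \<Longrightarrow> pd t a \<in> I J"
  by (rule I_der[OF pd.skew_der_axioms]) (auto simp: pd_zero[OF LamG_Rel] I.zero)

section \<open>Substitution of points, and residues along edges\<close>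

lemma homE_odd:
  assumes "\<And>s. \<phi> s \<in> odd1"
  shows "alg_hom (homE \<phi>)" "homE \<phi> (e s) = \<phi> s"
  using assms odd1_anticomm by (auto intro!: alg_hom_homE homE_e)

text \<open>An edge collapsed by \<open>f\<close> is sent to 0. This agrees with the differential,
  since both differences of its endpoints collapse as well.\<close>

definition sg :: "(nat \<Rightarrow> nat) \<Rightarrow> nat \<Rightarrow> ext" where
  "sg f s = (if s mod 3 = 0 then ex (f (s div 3)) else if s mod 3 = 1 then ey (f (s div 3))
     else (case prod_decode (s div 3) of (i, j) \<Rightarrow> if f i = f j then 0 else ew (f i) (f j)))"

definition subst :: "(nat \<Rightarrow> nat) \<Rightarrow> ext \<Rightarrow> ext" where "subst f = homE (sg f)"

lemma sg_odd: "sg f s \<in> odd1"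
  by (cases s rule: gen_cases) (auto simp: sg_def odd1_zero)

interpretation subst: alg_hom "subst f" for f
  unfolding subst_def by (rule homE_odd(1)) (rule sg_odd)

lemma subst_e: "subst f (e s) = sg f s"
  unfolding subst_def by (rule homE_odd(2)) (rule sg_odd)

lemma subst_gens [simp]: "subst f (ex i) = ex (f i)" "subst f (ey i) = ey (f i)"
  "subst f (ew i j) = (if f i = f j then 0 else ew (f i) (f j))"
  "subst f (xd i j) = xd (f i) (f j)" "subst f (yd i j) = yd (f i) (f j)"
  by (auto simp: subst_e sg_def min_def max_def xd_def yd_def subst.diff gw_commute)

lemma subst_dE: "dE (subst f a) = subst f (dE a)"
proof (rule skew_der_hom_commute[OF subst.alg_hom_axioms dE.skew_der_axioms dE.skew_der_axioms LamG_UNIV])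
  fix s
  show "subst f (e s) \<in> odd1" by (simp add: subst_e sg_odd)
  show "dE (subst f (e s)) = subst f (dg s)"
    by (cases s rule: gen_cases) (auto simp: subst_e sg_def dg_def subst.mult subst.zero dE.zero)
qed

text \<open>If two of the three points of an Arnold relation are identified, the collapsed edge
  vanishes and the remaining product is that of an edge with itself.\<close>

lemma subst_I:
  assumes "f ` J \<subseteq> K" "a \<in> I J" shows "subst f a \<in> I K"
proof (rule I_hom[OF subst.alg_hom_axioms _ assms(2)])
  fix r assume "r \<in> Rel J"
  then show "subst f r \<in> I K"
  proof (cases rule: Rel_cases)
    case (arnold i j k)
    have sq: "ew a b * ew b a = 0" "ew a b * ew a b = 0" for a b
      by (simp_all add: gw_commute[of b a] e_square)
    consider "f i = f j" | "f j = f k" | "f k = f i" | "f i \<noteq> f j" "f j \<noteq> f k" "f k \<noteq> f i" by blast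
    then show ?thesis
      by cases (use arnold assms(1) in \<open>auto simp: subst.add subst.mult I.zero sq intro!: I_arnold\<close>)
  qed (use assms(1) in \<open>auto simp: subst.mult I.zero intro!: I_relx I_rely\<close>)
qed

lemma subst_fix: "a \<in> LamG (gensE J) \<Longrightarrow> (\<And>i. i \<in> J \<Longrightarrow> f i = i) \<Longrightarrow> subst f a = a"
proof (erule alg_hom_eqI[OF subst.alg_hom_axioms alg_hom_id])
  fix s assume "s \<in> gensE J" "\<And>i. i \<in> J \<Longrightarrow> f i = i"
  then show "subst f (e s) = e s" by (cases rule: gensE_cases) auto
qed

text \<open>The residue along \<open>omega_lj\<close>: in the normal form above it extracts the coefficient \<open>b_l\<close>.
  Identifying \<open>j\<close> with \<open>l\<close> afterwards makes it compatible with the relations.\<close>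

definition res :: "nat \<Rightarrow> nat \<Rightarrow> ext \<Rightarrow> ext" where
  "res l j a = subst (id(j := l)) (pd (gw l j) a)"

lemma lin_map_res: "lin_map (res l j)"
  unfolding res_def
  by (rule lin_map_compose) (rule subst.lin_map_axioms pd.lin_map_axioms)+

interpretation res: lin_map "res l j" for l j by (rule lin_map_res)

lemma res_dE: "res l j (dE a) = - dE (res l j a)"
  by (simp add: res_def pd_dE subst.minus subst_dE)

lemma res_ew:
  assumes "a \<in> LamG (gensE (J - {j}))" "l \<noteq> j" "m \<noteq> j"
  shows "res l j (ew m j * a) = (if m = l then a else 0)"
proof -
  have "pd (gw l j) a = 0" using pd_zero[OF assms(1), of "gw l j"] by simp
  then show ?thesis using assms subst_fix[OF assms(1), of "id(j := l)"]
    by (auto simp: res_def gw_eq subst.zero)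
qed

lemma res_xd:
  assumes "a \<in> LamG (gensE (J - {j}))"
  shows "res l j (xd i k * a) = 0"
proof -
  have "pd (gw l j) a = 0" using pd_zero[OF assms(1), of "gw l j"] by simp
  then show ?thesis by (simp add: res_def pd_xd_mult subst.zero)
qed

text \<open>Removing \<open>omega_lj\<close> from a relation leaves x_l - x_j, y_l - y_j or, in the
  Arnold case, a difference of two edges to the third point. Identifying j with l turns each of
  these into 0, so every relation has residue 0.\<close>

lemma res_I:
  assumes "l \<in> J" "l \<noteq> j" "a \<in> I J"
  shows "res l j a \<in> I (J - {j})"
  using assms(3)
proof (induction rule: I.induct)
  case (rel r)
  let ?f = "id(j := l)"
  have same: "?f a = ?f b" if "gw a b = gw l j" for a b
    using that by (auto simp: gw_eq)
  from rel show ?case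
  proof (cases rule: Rel_cases)
    case (x i k)
    then show ?thesis using same[of i k]
      by (auto simp: res_def pd_xd_mult subst.zero subst.minus I.zero simp del: fun_upd_apply)
  next
    case (y i k)
    then show ?thesis using same[of i k]
      by (auto simp: res_def pd_yd_mult subst.zero subst.minus I.zero simp del: fun_upd_apply)
  next
    case (arnold a b c)
    have "pd (gw l j) r = pd (gw l j) (ew a b) * (ew b c - ew c a) + pd (gw l j) (ew b c) * (ew c a - ew a b)
       + pd (gw l j) (ew c a) * (ew a b - ew b c)"
      unfolding arnold(1) by (simp add: pd.add)
    moreover have "subst ?f (pd (gw l j) (ew x y) * (ew y z - ew z x)) = 0" for x y z
    proof (cases "gw x y = gw l j")
      case True
      show ?thesis using same[OF True]
        by (simp add: subst.diff subst.mult gw_commute[of "?f z" "?f y"] del: fun_upd_apply)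
    qed (simp add: subst.zero)
    ultimately have "res l j r = 0"
      by (simp only: res_def subst.add) simp
    then show ?thesis by (simp add: I.zero)
  qed
next
  case (gen a s)
  \<comment> \<open>If \<open>s\<close> is the edge lj, contraction releases the factor
    \<open>a\<close> itself, not just its contraction. Hence \<open>a\<close> has to be carried into
    the ideal on \<open>J - {j}\<close> by the substitution alone.\<close>
  have "subst (id(j := l)) a \<in> I (J - {j})"
    by (rule subst_I[OF _ gen.hyps]) (use assms in auto)
  then show ?case using gen.IH
    by (auto simp: res_def subst.diff subst.minus subst.mult intro!: I_diff I_lmult)
qed (simp_all add: res.zero res.add res.smul I.intros)

section \<open>Setting generators to zero\<close>

definition kill :: "nat set \<Rightarrow> ext \<Rightarrow> ext" where
  "kill A = homE (\<lambda>s. if s \<in> A then 0 else e s)"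

interpretation kill: alg_hom "kill A" for A
  unfolding kill_def by (rule homE_odd(1)) (simp add: odd1_zero)

lemma kill_e [simp]: "kill A (e s) = (if s \<in> A then 0 else e s)"
  unfolding kill_def by (rule homE_odd(2)) (simp add: odd1_zero)

lemma kill_fix: "a \<in> LamG G \<Longrightarrow> A \<inter> G = {} \<Longrightarrow> kill A a = a"
  by (erule alg_hom_eqI[OF kill.alg_hom_axioms alg_hom_id]) auto

definition edges_at :: "nat \<Rightarrow> nat set" where "edges_at j = range (\<lambda>i. gw i j)"

lemma edges_at [simp]: "gx i \<notin> edges_at j" "gy i \<notin> edges_at j"
  "gw i k \<in> edges_at j \<longleftrightarrow> i = j \<or> k = j"
  by (auto simp: edges_at_def gw_eq)

lemma kill_edges_xd [simp]: "kill (edges_at j) (xd i k) = xd i k" "kill (edges_at j) (yd i k) = yd i k"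
  by (simp_all add: xd_def yd_def kill.diff)

text \<open>Every product in an Arnold relation through j uses an edge at j, so such a relation
  disappears entirely, and only relations among the other points survive.\<close>

lemma kill_edges_I:
  assumes "a \<in> I J" shows "kill (edges_at j) a \<in> I (J - {j})"
proof (rule I_hom[OF kill.alg_hom_axioms _ assms])
  fix r assume "r \<in> Rel J"
  then show "kill (edges_at j) r \<in> I (J - {j})"
    by (cases rule: Rel_cases)
       (auto simp: kill.add kill.mult I.zero intro!: I_relx I_rely I_arnold)
qed

section \<open>The subalgebra without \<open>y\<close>-generators\<close>

text \<open>Degrees are integers so that inductions may lower them without case distinctions; in negative
  degrees only \<open>0\<close> occurs.\<close>

inductive xs :: "nat set \<Rightarrow> int \<Rightarrow> int \<Rightarrow> ext \<Rightarrow> bool" for J where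
  one: "xs J 0 0 1"
| zero: "xs J p q 0"
| add: "xs J p q a \<Longrightarrow> xs J p q b \<Longrightarrow> xs J p q (a + b)"
| smul: "xs J p q a \<Longrightarrow> xs J p q (smul c a)"
| x: "i \<in> J \<Longrightarrow> j \<in> J \<Longrightarrow> xs J p q a \<Longrightarrow> xs J (p + 1) q (xd i j * a)"
| w: "i \<in> J \<Longrightarrow> j \<in> J \<Longrightarrow> i \<noteq> j \<Longrightarrow> xs J p q a \<Longrightarrow> xs J p (q + 1) (ew i j * a)"

lemma xs_x: "i \<in> J \<Longrightarrow> j \<in> J \<Longrightarrow> xs J (p - 1) q a \<Longrightarrow> xs J p q (xd i j * a)"
  using xs.x[of i J j "p - 1" q a] by simp
lemma xs_w: "i \<in> J \<Longrightarrow> j \<in> J \<Longrightarrow> i \<noteq> j \<Longrightarrow> xs J p (q - 1) a \<Longrightarrow> xs J p q (ew i j * a)"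
  using xs.w[of i J j p "q - 1" a] by simp
lemma xs_minus: "xs J p q a \<Longrightarrow> xs J p q (- a)"
  using xs.smul[of J p q a "-1"] by (simp add: smul_minus_one)
lemma xs_diff: "xs J p q a \<Longrightarrow> xs J p q b \<Longrightarrow> xs J p q (a - b)"
  using xs.add[OF _ xs_minus, of J p q a b] by simp
lemma xs_sum: "(\<And>i. i \<in> A \<Longrightarrow> xs J p q (f i)) \<Longrightarrow> xs J p q (\<Sum>i\<in>A. f i)"
  by (induction A rule: infinite_finite_induct) (auto intro: xs.add xs.zero)

lemma xs_mono: "xs J p q a \<Longrightarrow> J \<subseteq> K \<Longrightarrow> xs K p q a"
  by (induction rule: xs.induct) (auto intro: xs.intros)

lemma xs_neg: "xs J p q a \<Longrightarrow> p < 0 \<or> q < 0 \<Longrightarrow> a = 0"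
  by (induction rule: xs.induct) auto

lemma xs_LamG: "xs J p q a \<Longrightarrow> a \<in> LamG (gensE J)"
  by (induction rule: xs.induct) (auto intro: LamG_add LamG_smul LamG_mult LamG_gens)

lemma xs_subst: "xs J p q a \<Longrightarrow> f ` J \<subseteq> K \<Longrightarrow> xs K p q (subst f a)"
  by (induction rule: xs.induct)
     (auto simp: subst.one subst.zero subst.add subst.smul subst.mult intro: xs.intros)

lemma xs_pd_gw: "xs J p q a \<Longrightarrow> xs J p (q - 1) (pd (gw l j) a)"
proof (induction rule: xs.induct)
  case (x i j p q a)
  then show ?case by (auto simp: pd_xd_mult intro!: xs_minus xs.x)
next
  case (w i k p q a)
  then have "xs J p q (ew i k * pd (gw l j) a)" by (intro xs_w)
  then show ?case using w by (auto intro!: xs_minus xs_diff)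
qed (auto simp: pd.one pd.zero pd.add pd.smul intro: xs.intros)

lemma xs_res: "xs J p q a \<Longrightarrow> l \<in> J \<Longrightarrow> l \<noteq> j \<Longrightarrow> xs (J - {j}) p (q - 1) (res l j a)"
  unfolding res_def by (rule xs_subst[OF xs_pd_gw]) auto

text \<open>Modulo the relations, a monomial contains at most one factor involving the point \<open>j\<close>.\<close>

definition nf :: "nat set \<Rightarrow> nat \<Rightarrow> nat \<Rightarrow> int \<Rightarrow> int \<Rightarrow> ext \<Rightarrow> bool" where
  "nf J j k p q a \<longleftrightarrow> (\<exists>c c0 b. xs (J - {j}) (p - 1) q c \<and> xs (J - {j}) p q c0 \<and>
     (\<forall>l\<in>J - {j}. xs (J - {j}) p (q - 1) (b l)) \<and>
     a - (xd j k * c + c0 + (\<Sum>l\<in>J - {j}. ew l j * b l)) \<in> I J)"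

lemma nfI:
  assumes "xs (J - {j}) (p - 1) q c" "xs (J - {j}) p q c0"
    "\<And>l. l \<in> J - {j} \<Longrightarrow> xs (J - {j}) p (q - 1) (b l)"
    "a - (xd j k * c + c0 + (\<Sum>l\<in>J - {j}. ew l j * b l)) \<in> I J"
  shows "nf J j k p q a"
  using assms unfolding nf_def by blast

lemma nf_cong:
  assumes "nf J j k p q a" "b - a \<in> I J" shows "nf J j k p q b"
proof -
  have "b - v \<in> I J" if "a - v \<in> I J" for v
    using I.add[OF assms(2) that] by simp
  then show ?thesis using assms(1) unfolding nf_def by blast
qed

lemma nf_add:
  assumes "nf J j k p q a" "nf J j k p q a'" shows "nf J j k p q (a + a')"
proof -
  from assms obtain c c0 b c' c0' b' where
    *: "xs (J - {j}) (p - 1) q c" "xs (J - {j}) p q c0" "\<forall>l\<in>J - {j}. xs (J - {j}) p (q - 1) (b l)"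
      "a - (xd j k * c + c0 + (\<Sum>l\<in>J - {j}. ew l j * b l)) \<in> I J"
      "xs (J - {j}) (p - 1) q c'" "xs (J - {j}) p q c0'" "\<forall>l\<in>J - {j}. xs (J - {j}) p (q - 1) (b' l)"
      "a' - (xd j k * c' + c0' + (\<Sum>l\<in>J - {j}. ew l j * b' l)) \<in> I J"
    unfolding nf_def by blast
  have "a + a' - (xd j k * (c + c') + (c0 + c0') + (\<Sum>l\<in>J - {j}. ew l j * (b l + b' l))) \<in> I J"
    using I.add[OF *(4) *(8)] by (simp add: algebra_simps sum.distrib)
  then show ?thesis using * by (intro nfI[of J j p q "c + c'" "c0 + c0'" "\<lambda>l. b l + b' l"]) (auto intro: xs.add)
qed

lemma nf_smul:
  assumes "nf J j k p q a" shows "nf J j k p q (smul r a)"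
proof -
  from assms obtain c c0 b where
    *: "xs (J - {j}) (p - 1) q c" "xs (J - {j}) p q c0" "\<forall>l\<in>J - {j}. xs (J - {j}) p (q - 1) (b l)"
      "a - (xd j k * c + c0 + (\<Sum>l\<in>J - {j}. ew l j * b l)) \<in> I J"
    unfolding nf_def by blast
  have "smul r a - (xd j k * smul r c + smul r c0 + (\<Sum>l\<in>J - {j}. ew l j * smul r (b l))) \<in> I J"
    using I.smul[OF *(4), of r]
    by (simp add: smul.scale_right_diff_distrib smul.scale_right_distrib smul.scale_sum_right)
  then show ?thesis using * by (intro nfI[of J j p q "smul r c" "smul r c0" "\<lambda>l. smul r (b l)"]) (auto intro: xs.smul)
qed

lemma nf_minus: "nf J j k p q a \<Longrightarrow> nf J j k p q (- a)"
  using nf_smul[of J j k p q a "-1"] by (simp add: smul_minus_one)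

lemma nf_base: "xs (J - {j}) p q a \<Longrightarrow> nf J j k p q a"
  by (rule nfI[of J j p q 0 a "\<lambda>_. 0"]) (auto intro: xs.zero I.zero)

lemma nf_zero: "nf J j k p q 0"
  by (rule nf_base) (rule xs.zero)

lemma nf_diff: "nf J j k p q a \<Longrightarrow> nf J j k p q a' \<Longrightarrow> nf J j k p q (a - a')"
  using nf_add[OF _ nf_minus, of J j k p q a a'] by simp

lemma nf_sum: "(\<And>i. i \<in> A \<Longrightarrow> nf J j k p q (f i)) \<Longrightarrow> nf J j k p q (\<Sum>i\<in>A. f i)"
  by (induction A rule: infinite_finite_induct) (auto intro: nf_add nf_zero)

lemma nf_xd: "xs (J - {j}) (p - 1) q c \<Longrightarrow> nf J j k p q (xd j k * c)"
  by (rule nfI[of J j p q c 0 "\<lambda>_. 0"]) (auto intro: xs.zero I.zero)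

lemma nf_ew:
  assumes "finite J" "l \<in> J - {j}" "xs (J - {j}) p (q - 1) b" shows "nf J j k p q (ew l j * b)"
proof -
  have "(\<Sum>m\<in>J - {j}. ew m j * (if m = l then b else 0)) = (\<Sum>m\<in>J - {j}. if m = l then ew l j * b else 0)"
    by (rule sum.cong) auto
  also have "\<dots> = ew l j * b" using assms by (simp add: sum.delta)
  finally show ?thesis using assms(3)
    by (intro nfI[of J j p q 0 0 "\<lambda>m. if m = l then b else 0"]) (auto intro: xs.zero I.zero)
qed

lemma nf_lmult:
  assumes "finite J" "nf J j k p q a"
    and "\<And>c. xs (J - {j}) (p - 1) q c \<Longrightarrow> nf J j k p' q' (u * (xd j k * c))"
    and "\<And>c. xs (J - {j}) p q c \<Longrightarrow> nf J j k p' q' (u * c)"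
    and "\<And>l b. l \<in> J - {j} \<Longrightarrow> xs (J - {j}) p (q - 1) b \<Longrightarrow> nf J j k p' q' (u * (ew l j * b))"
  shows "nf J j k p' q' (u * a)"
proof -
  from assms(2) obtain c c0 b where
    *: "xs (J - {j}) (p - 1) q c" "xs (J - {j}) p q c0" "\<forall>l\<in>J - {j}. xs (J - {j}) p (q - 1) (b l)"
      "a - (xd j k * c + c0 + (\<Sum>l\<in>J - {j}. ew l j * b l)) \<in> I J"
    unfolding nf_def by blast
  show ?thesis
  proof (rule nf_cong)
    show "nf J j k p' q' (u * (xd j k * c) + u * c0 + (\<Sum>l\<in>J - {j}. u * (ew l j * b l)))"
      using * assms(3-5) by (intro nf_add nf_sum) auto
    show "u * a - (u * (xd j k * c) + u * c0 + (\<Sum>l\<in>J - {j}. u * (ew l j * b l))) \<in> I J"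
      using I_lmult[OF *(4), of u] by (simp add: algebra_simps sum_distrib_left)
  qed
qed

text \<open>The critical case is x_j - x_k against an edge lj: on that edge x_j may be replaced by
  x_l, which moves the new factor to the remaining points. Against x_j - x_k the product is
  zero.\<close>

lemma nf_mult_xd:
  assumes fin: "finite J" and jk: "j \<in> J" "k \<in> J" "k \<noteq> j" and i: "i \<in> J" and a: "nf J j k p q a"
  shows "nf J j k (p + 1) q (xd i k * a)"
proof (cases "i = j")
  case False
  show ?thesis
  proof (rule nf_lmult[OF fin a])
    fix c assume "xs (J - {j}) (p - 1) q c"
    then have "xs (J - {j}) p q (xd i k * c)" using False i jk by (intro xs_x) auto
    then have "nf J j k (p + 1) q (- (xd j k * (xd i k * c)))" by (intro nf_minus nf_xd) simp
    then show "nf J j k (p + 1) q (xd i k * (xd j k * c))"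
      using odd1_left_anticomm[of "xd i k" "xd j k" c] by simp
  next
    fix c assume "xs (J - {j}) p q c"
    then show "nf J j k (p + 1) q (xd i k * c)" using False i jk by (intro nf_base xs_x) auto
  next
    fix l b assume l: "l \<in> J - {j}" and "xs (J - {j}) p (q - 1) b"
    then have "xs (J - {j}) (p + 1) (q - 1) (xd i k * b)" using False i jk by (intro xs_x) auto
    then have "nf J j k (p + 1) q (- (ew l j * (xd i k * b)))" by (intro nf_minus nf_ew fin l)
    then show "nf J j k (p + 1) q (xd i k * (ew l j * b))"
      using odd1_left_anticomm[of "xd i k" "ew l j" b] by simp
  qed
next
  case True
  show ?thesis unfolding True
  proof (rule nf_lmult[OF fin a])
    fix c show "nf J j k (p + 1) q (xd j k * (xd j k * c))"
      by (simp add: odd1_left_square nf_zero)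
  next
    fix c assume "xs (J - {j}) p q c"
    then show "nf J j k (p + 1) q (xd j k * c)" by (intro nf_xd) simp
  next
    fix l b assume l: "l \<in> J - {j}" and b: "xs (J - {j}) p (q - 1) b"
    have "nf J j k (p + 1) q (- (ew l j * (xd l k * b)))"
      using l b jk by (intro nf_minus nf_ew fin l xs_x) auto
    moreover have "xd j k * (ew l j * b) - - (ew l j * (xd l k * b)) = - ((xd l j * ew l j) * b)"
    proof -
      have "xd j k * (ew l j * b) = - (xd l j * (ew l j * b)) + xd l k * (ew l j * b)"
        by (simp add: xd_def algebra_simps)
      then show ?thesis
        using odd1_left_anticomm[of "xd l k" "ew l j" b] by (simp add: mult.assoc)
    qed
    moreover have "- ((xd l j * ew l j) * b) \<in> I J"
      using l jk by (intro I_minus I_rmult I_relx) auto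
    ultimately show "nf J j k (p + 1) q (xd j k * (ew l j * b))"
      by (metis nf_cong)
  qed
qed

text \<open>Two distinct edges mj and lj are traded by the Arnold relation for one of them times lm,
  an edge away from j. An edge mj against x_j - x_k turns the latter into x_m - x_k.\<close>

lemma nf_mult_ew:
  assumes fin: "finite J" and jk: "j \<in> J" "k \<in> J" "k \<noteq> j"
    and i: "i \<in> J" "m \<in> J" "i \<noteq> m" and a: "nf J j k p q a"
  shows "nf J j k p (q + 1) (ew i m * a)"
proof -
  have away: "nf J j k p (q + 1) (ew i m * a)" if "i \<noteq> j" "m \<noteq> j" "i \<in> J" "m \<in> J" "i \<noteq> m" for i m
  proof (rule nf_lmult[OF fin a])
    fix c assume "xs (J - {j}) (p - 1) q c"
    then have "nf J j k p (q + 1) (- (xd j k * (ew i m * c)))"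
      using that by (intro nf_minus nf_xd xs.w) auto
    then show "nf J j k p (q + 1) (ew i m * (xd j k * c))"
      using odd1_left_anticomm[of "ew i m" "xd j k" c] by simp
  next
    fix c assume "xs (J - {j}) p q c"
    then show "nf J j k p (q + 1) (ew i m * c)" using that by (intro nf_base xs.w) auto
  next
    fix l b assume l: "l \<in> J - {j}" and "xs (J - {j}) p (q - 1) b"
    then have "nf J j k p (q + 1) (- (ew l j * (ew i m * b)))"
      using that by (intro nf_minus nf_ew fin l xs_w) auto
    then show "nf J j k p (q + 1) (ew i m * (ew l j * b))"
      using odd1_left_anticomm[of "ew i m" "ew l j" b] by simp
  qed
  have at: "nf J j k p (q + 1) (ew m j * a)" if m: "m \<in> J - {j}" for m
  proof (rule nf_lmult[OF fin a])
    fix c assume c: "xs (J - {j}) (p - 1) q c"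
    have "nf J j k p (q + 1) (ew m j * (xd m k * c))"
      using m jk c by (intro nf_ew fin m xs_x) auto
    moreover have "ew m j * (xd j k * c) - ew m j * (xd m k * c) = xd m j * ew m j * c"
    proof -
      have "ew m j * (xd j k * c) - ew m j * (xd m k * c) = - (ew m j * (xd m j * c))"
        by (simp add: xd_def algebra_simps)
      then show ?thesis
        using odd1_left_anticomm[of "ew m j" "xd m j" c] by (simp add: mult.assoc)
    qed
    moreover have "xd m j * ew m j * c \<in> I J" using m jk by (intro I_rmult I_relx) auto
    ultimately show "nf J j k p (q + 1) (ew m j * (xd j k * c))" by (metis nf_cong)
  next
    fix c assume "xs (J - {j}) p q c"
    then show "nf J j k p (q + 1) (ew m j * c)" by (intro nf_ew fin m) simp
  next
    fix l b assume l: "l \<in> J - {j}" and b: "xs (J - {j}) p (q - 1) b"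
    show "nf J j k p (q + 1) (ew m j * (ew l j * b))"
    proof (cases "l = m")
      case True
      then show ?thesis by (simp add: odd1_left_square nf_zero)
    next
      case False
      have "nf J j k p (q + 1) (- (ew l j * (ew l m * b)) + ew m j * (ew l m * b))"
        using l m b False by (intro nf_add nf_minus nf_ew fin l m xs_w) auto
      moreover have "ew m j * (ew l j * b) - (- (ew l j * (ew l m * b)) + ew m j * (ew l m * b))
          = (ew m j * ew j l + ew j l * ew l m + ew l m * ew m j) * b"
        using odd1_left_anticomm[of "ew m j" "ew l m" b]
        by (simp add: distrib_right mult.assoc gw_commute[of j l])
      moreover have "(ew m j * ew j l + ew j l * ew l m + ew l m * ew m j) * b \<in> I J"
        using l m jk False by (intro I_rmult I_arnold) auto
      ultimately show ?thesis by (metis nf_cong)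
    qed
  qed
  consider "i = j" | "m = j" | "i \<noteq> j" "m \<noteq> j" by blast
  then show ?thesis
    using at[of m] at[of i] away[of i m] i by cases (auto simp: gw_commute)
qed

lemma nf_xs:
  assumes "xs J p q a" "finite J" "j \<in> J" "k \<in> J" "k \<noteq> j"
  shows "nf J j k p q a"
  using assms(1)
proof (induction rule: xs.induct)
  case one
  then show ?case by (intro nf_base xs.one)
next
  case (x i m p q a)
  have "xd i m * a = xd i k * a - xd m k * a" by (simp add: xd_def algebra_simps)
  then show ?case using x assms by (auto intro!: nf_diff nf_mult_xd)
next
  case (w i m p q a)
  then show ?case using assms by (intro nf_mult_ew)
qed (auto intro: nf_zero nf_add nf_smul)

section \<open>Vanishing in large total degree\<close>

lemma xs_singleton: "xs {k} p q a \<Longrightarrow> p + q \<ge> 1 \<Longrightarrow> a = 0"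
  by (induction rule: xs.induct) auto

text \<open>Passing from J to J - {j} lowers the bound by one, while each coefficient of the normal
  form loses at most one degree. The induction ends at a single point, where there are no nonzero
  differences and no edges.\<close>

lemma xs_top_vanishes:
  assumes "finite J" "J \<noteq> {}" "xs J p q a" "p + q \<ge> int (card J)"
  shows "a \<in> I J"
  using assms
proof (induction "card J" arbitrary: J p q a)
  case 0
  then show ?case by simp
next
  case (Suc n)
  show ?case
  proof (cases "n = 0")
    case True
    with Suc obtain k where "J = {k}" by (metis One_nat_def card_1_singletonE)
    then show ?thesis using Suc.prems xs_singleton[of k p q a] by (simp add: I.zero)
  next
    case False
    obtain k where k: "k \<in> J" using Suc.prems by blast
    obtain j where j: "j \<in> J" "j \<noteq> k"
      using False Suc.hyps(2) k
      by (metis card_1_singleton_iff is_singletonI' is_singleton_def One_nat_def old.nat.inject empty_iff)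
    obtain c c0 b where
      *: "xs (J - {j}) (p - 1) q c" "xs (J - {j}) p q c0" "\<forall>l\<in>J - {j}. xs (J - {j}) p (q - 1) (b l)"
        "a - (xd j k * c + c0 + (\<Sum>l\<in>J - {j}. ew l j * b l)) \<in> I J"
      using nf_xs[OF Suc.prems(3,1) j(1) k] j(2) unfolding nf_def by blast
    have card: "n = card (J - {j})" using Suc.hyps(2) j Suc.prems(1) by simp
    have ne: "J - {j} \<noteq> {}" "finite (J - {j})" using k j Suc.prems by auto
    have IH: "a \<in> I J" if "xs (J - {j}) p q a" "p + q \<ge> int n" for p q a
      using Suc.hyps(1)[OF card ne(2,1) that(1)] that(2) card I_mono[of "J - {j}" J a] by auto
    have le: "p + q \<ge> int n + 1" using Suc by simp
    have "xd j k * c + c0 + (\<Sum>l\<in>J - {j}. ew l j * b l) \<in> I J"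
      using IH[OF *(1)] IH[OF *(2)] IH[OF *(3)[rule_format]] le
      by (intro I.add I_lmult I_sum) auto
    then show ?thesis using *(4) I_congD by blast
  qed
qed

lemma xs_top_xd:
  assumes "finite J" "xs J p q a" "p + q + 1 = int (card J)" "i \<in> J" "m \<in> J"
  shows "xd i m * a \<in> I J"
  by (rule xs_top_vanishes[of J "p + 1" q]) (use assms in \<open>auto intro: xs.x\<close>)

text \<open>The coefficient \<open>c0\<close> has no factor at j, so it has total degree
  \<open>card (J - {j})\<close> on \<open>J - {j}\<close>, one more than survives there.\<close>

lemma nf_top:
  assumes "xs J p q a" "finite J" "j \<in> J" "k \<in> J" "k \<noteq> j" "p + q + 1 = int (card J)"
  obtains c b where "xs (J - {j}) (p - 1) q c" "\<And>l. l \<in> J - {j} \<Longrightarrow> xs (J - {j}) p (q - 1) (b l)"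
    "a - (xd j k * c + (\<Sum>l\<in>J - {j}. ew l j * b l)) \<in> I J"
proof -
  obtain c c0 b where
    *: "xs (J - {j}) (p - 1) q c" "xs (J - {j}) p q c0" "\<forall>l\<in>J - {j}. xs (J - {j}) p (q - 1) (b l)"
      "a - (xd j k * c + c0 + (\<Sum>l\<in>J - {j}. ew l j * b l)) \<in> I J"
    using nf_xs[OF assms(1-5)] unfolding nf_def by blast
  have "c0 \<in> I (J - {j})"
  proof (rule xs_top_vanishes[OF _ _ *(2)])
    have "card J = Suc (card (J - {j}))" using assms by (metis card.remove)
    then show "int (card (J - {j})) \<le> p + q" using assms by simp
  qed (use assms in auto)
  then have "c0 \<in> I J" using I_mono[of "J - {j}" J c0] by blast
  with *(4) have "a - (xd j k * c + c0 + (\<Sum>l\<in>J - {j}. ew l j * b l)) + c0 \<in> I J" by (intro I.add)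
  then have "a - (xd j k * c + (\<Sum>l\<in>J - {j}. ew l j * b l)) \<in> I J" by (simp add: algebra_simps)
  with * that show thesis by blast
qed

section \<open>Reading off the coefficients of a normal form\<close>

lemma pd_gx_above: "a \<in> LamG (gensE (J - {j})) \<Longrightarrow> pd (gx j) a = 0"
  and pd_gy_above: "a \<in> LamG (gensE (J - {j})) \<Longrightarrow> pd (gy j) a = 0"
  by (rule pd_zero, assumption, simp)+

lemma kill_above: "a \<in> LamG (gensE (J - {j})) \<Longrightarrow> kill (edges_at j) a = a"
  by (rule kill_fix) (auto simp: edges_at_def)

text \<open>Killing the edges at j reduces to relations on \<open>J - {j}\<close>. These do not
  contain x_j, so contraction along x_j respects them and recovers \<open>c\<close>.\<close>

lemma xd_mult_I_cancel:
  assumes "c \<in> LamG (gensE (J - {j}))" "k \<noteq> j" "xd j k * c \<in> I J"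
  shows "c \<in> I (J - {j})"
proof -
  have "kill (edges_at j) (xd j k * c) \<in> I (J - {j})" by (rule kill_edges_I) fact
  then have "xd j k * c \<in> I (J - {j})" by (simp add: kill.mult kill_above[OF assms(1)])
  then have "pd (gx j) (xd j k * c) \<in> I (J - {j})" by (rule pd_I) simp
  then show ?thesis using assms(2) by (simp add: pd_xd_mult pd_gx_above[OF assms(1)])
qed

lemma res_nf:
  assumes fin: "finite J" and l: "l \<in> J - {j}" and c: "c \<in> LamG (gensE (J - {j}))"
    and b: "\<And>m. m \<in> J - {j} \<Longrightarrow> b m \<in> LamG (gensE (J - {j}))"
  shows "res l j (xd j k * c + (\<Sum>m\<in>J - {j}. ew m j * b m)) = b l"
proof -
  have "(\<Sum>m\<in>J - {j}. res l j (ew m j * b m)) = (\<Sum>m\<in>J - {j}. if m = l then b l else 0)"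
    using l by (intro sum.cong) (auto simp: res_ew[OF b])
  also have "\<dots> = b l" using fin l by (simp add: sum.delta)
  finally show ?thesis by (simp add: res.add res.sum res_xd[OF c])
qed

text \<open>The residues of the differential give closedness of each \<open>b l\<close>. Killing the
  edges at j leaves -(x_j - x_k) d c plus the terms (x_m - x_j) (y_m - y_j) b_m, with relations on
  \<open>J - {j}\<close> only; contraction along x_j and a further one along y_j extract the other
  two conditions.\<close>

lemma closed_nf:
  assumes fin: "finite J" and jk: "j \<in> J" "k \<in> J" "k \<noteq> j"
    and c: "c \<in> LamG (gensE (J - {j}))"
    and b: "\<And>m. m \<in> J - {j} \<Longrightarrow> b m \<in> LamG (gensE (J - {j}))"
    and d: "dE (xd j k * c + (\<Sum>m\<in>J - {j}. ew m j * b m)) \<in> I J"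
  shows "\<And>l. l \<in> J - {j} \<Longrightarrow> dE (b l) \<in> I (J - {j})"
    and "(\<Sum>m\<in>J - {j}. b m) \<in> I (J - {j})"
    and "dE c + (\<Sum>m\<in>J - {j}. ey m * b m) \<in> I (J - {j})"
proof -
  let ?K = "J - {j}" and ?z = "xd j k * c + (\<Sum>m\<in>J - {j}. ew m j * b m)"
  show "dE (b l) \<in> I ?K" if l: "l \<in> ?K" for l
  proof -
    have "res l j (dE ?z) \<in> I ?K" using l d by (intro res_I) auto
    moreover have "res l j ?z = b l" by (rule res_nf[OF fin l c]) (rule b)
    ultimately show ?thesis by (simp add: res_dE)
  qed
  have dc: "dE c \<in> LamG (gensE ?K)" by (rule LamG_dE[OF c])
  have "dE ?z = - (xd j k * dE c) + (\<Sum>m\<in>?K. xd m j * (yd m j * b m) - ew m j * dE (b m))"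
    by (simp add: dE.add dE.sum)
  moreover have "kill (edges_at j) \<dots> = - (xd j k * dE c) + (\<Sum>m\<in>?K. xd m j * (yd m j * b m))"
    using b by (simp add: kill.add kill.minus kill.mult kill.sum kill.diff kill_above[OF dc] kill_above[OF b])
  ultimately have 1: "- (xd j k * dE c) + (\<Sum>m\<in>?K. xd m j * (yd m j * b m)) \<in> I ?K"
    using kill_edges_I[OF d, of j] by (simp only:)
  have "pd (gx j) (- (xd j k * dE c) + (\<Sum>m\<in>?K. xd m j * (yd m j * b m)))
      = - (dE c + (\<Sum>m\<in>?K. yd m j * b m))"
  proof -
    have "pd (gx j) (xd m j * (yd m j * b m)) = - (yd m j * b m)" if "m \<in> ?K" for m
      using that by (simp add: pd_xd_mult pd_yd_mult pd_gx_above[OF b[OF that]])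
    then have "(\<Sum>m\<in>?K. pd (gx j) (xd m j * (yd m j * b m))) = (\<Sum>m\<in>?K. - (yd m j * b m))"
      by (rule sum.cong[OF refl])
    then show ?thesis
      using jk by (simp add: pd.add pd.diff pd.minus pd.sum pd_xd_mult pd_gx_above[OF dc] sum_negf)
  qed
  then have 2: "dE c + (\<Sum>m\<in>?K. yd m j * b m) \<in> I ?K"
    using pd_I[OF 1, of "gx j"] by (simp only: I_minus_iff) simp
  have "pd (gy j) (dE c + (\<Sum>m\<in>?K. yd m j * b m)) = - (\<Sum>m\<in>?K. b m)"
  proof -
    have "pd (gy j) (yd m j * b m) = - b m" if "m \<in> ?K" for m
      using that by (simp add: pd_yd_mult pd_gy_above[OF b[OF that]])
    then have "(\<Sum>m\<in>?K. pd (gy j) (yd m j * b m)) = (\<Sum>m\<in>?K. - b m)"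
      by (rule sum.cong[OF refl])
    then show ?thesis by (simp add: pd.add pd.sum pd_gy_above[OF dc] sum_negf)
  qed
  then show s: "(\<Sum>m\<in>?K. b m) \<in> I ?K"
    using pd_I[OF 2, of "gy j"] by (simp only: I_minus_iff) simp
  have "dE c + (\<Sum>m\<in>?K. ey m * b m) = dE c + (\<Sum>m\<in>?K. yd m j * b m) + ey j * (\<Sum>m\<in>?K. b m)"
    by (simp add: yd_def algebra_simps sum_distrib_left sum.distrib sum_subtractf)
  also have "\<dots> \<in> I ?K" by (intro I.add I_lmult 2 s)
  finally show "dE c + (\<Sum>m\<in>?K. ey m * b m) \<in> I ?K" .
qed

section \<open>Cocycles of top degree\<close>

lemma ew_yd: "ew i j * (yd a b * c) = - (yd a b * (ew i j * c))"
  and yd_xd: "yd a b * (xd i j * c) = - (xd i j * (yd a b * c))"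
  by (rule odd1_left_anticomm; simp)+

definition K :: "nat set \<Rightarrow> int \<Rightarrow> int \<Rightarrow> ext set" where
  "K J p q = {z. xs J p q z \<and> dE z \<in> I J}"

lemma K_nf:
  assumes "z \<in> K J p q" "finite J" "j \<in> J" "k \<in> J" "k \<noteq> j" "p + q + 1 = int (card J)"
  obtains c b where "xs (J - {j}) (p - 1) q c" "\<And>l. l \<in> J - {j} \<Longrightarrow> b l \<in> K (J - {j}) p (q - 1)"
    "z - (xd j k * c + (\<Sum>l\<in>J - {j}. ew l j * b l)) \<in> I J"
    "(\<Sum>l\<in>J - {j}. b l) \<in> I (J - {j})" "dE c + (\<Sum>l\<in>J - {j}. ey l * b l) \<in> I (J - {j})"
proof -
  have z: "xs J p q z" "dE z \<in> I J" using assms(1) by (auto simp: K_def)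
  obtain c b where *: "xs (J - {j}) (p - 1) q c" "\<And>l. l \<in> J - {j} \<Longrightarrow> xs (J - {j}) p (q - 1) (b l)"
    "z - (xd j k * c + (\<Sum>l\<in>J - {j}. ew l j * b l)) \<in> I J"
    using nf_top[OF z(1) assms(2-6)] by blast
  let ?v = "xd j k * c + (\<Sum>l\<in>J - {j}. ew l j * b l)"
  have "dE (z - ?v) \<in> I J" by (rule dE_I) (rule *)
  then have "dE z - dE (z - ?v) \<in> I J" using z by (intro I_diff)
  then have d: "dE ?v \<in> I J" by (simp only: dE.diff) simp
  note cl = closed_nf[OF assms(2-5) xs_LamG[OF *(1)] xs_LamG[OF *(2)] d]
  show thesis
    by (rule that[OF *(1) _ *(3)]) (use *(2) cl in \<open>auto simp: K_def\<close>)
qed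

text \<open>Each \<open>(y_j - y_k) b\<close> with \<open>b\<close> a top-degree cocycle is a coboundary. The additional relation
  \<open>(y_j - y_k) W = 0\<close> for the primitive is what makes the induction work.\<close>

lemma primitive_exists:
  assumes "finite J" "k \<in> J" "j \<in> J" "j \<noteq> k" "z \<in> K J p q" "p + q + 1 = int (card J)"
  shows "\<exists>W. xs J (p - 1) (q + 1) W \<and> dE W - yd j k * z \<in> I J \<and> yd j k * W \<in> I J"
  using assms
proof (induction "card J" arbitrary: J j z q)
  case 0
  then show ?case by simp
next
  case (Suc n)
  let ?B = "J - {j}"
  have kj: "k \<noteq> j" and kB: "k \<in> ?B" and finB: "finite ?B" using Suc.prems by auto
  have cardB: "n = card ?B" using Suc.hyps(2) Suc.prems by simp
  have mono: "a \<in> I J" if "a \<in> I ?B" for a using I_mono[OF _ that, of J] by blast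
  obtain c b where *: "xs ?B (p - 1) q c" "\<And>l. l \<in> ?B \<Longrightarrow> b l \<in> K ?B p (q - 1)"
    "z - (xd j k * c + (\<Sum>l\<in>?B. ew l j * b l)) \<in> I J"
    "(\<Sum>l\<in>?B. b l) \<in> I ?B" "dE c + (\<Sum>l\<in>?B. ey l * b l) \<in> I ?B"
    using K_nf[OF Suc.prems(5,1,3,2) kj Suc.prems(6)] by blast
  have "\<exists>W. xs ?B (p - 1) q W \<and> dE W - yd l k * b l \<in> I ?B \<and> yd l k * W \<in> I ?B" if l: "l \<in> ?B" for l
  proof (cases "l = k")
    case True
    then show ?thesis by (intro exI[of _ 0]) (auto intro: xs.zero I.zero simp: dE.zero)
  next
    case False
    then show ?thesis
      using Suc.hyps(1)[OF cardB finB kB l False *(2)[OF l]] Suc.prems(6) Suc.hyps(2) cardB by auto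
  qed
  then obtain W where W: "\<And>l. l \<in> ?B \<Longrightarrow> xs ?B (p - 1) q (W l)"
    "\<And>l. l \<in> ?B \<Longrightarrow> dE (W l) - yd l k * b l \<in> I ?B" "\<And>l. l \<in> ?B \<Longrightarrow> yd l k * W l \<in> I ?B"
    by metis
  \<comment> \<open>On the edge lj, (y_j - y_k) omega_lj b_l becomes - omega_lj (y_l - y_k) b_l,
    which suggests omega_lj W_l. The term - omega_jk c accounts for (x_j - x_k) c; its by-product
    omega_jk d c is cancelled through - omega_kj W_l, because d c + (\<Sum>l. (y_l - y_k) b_l) is in
    the ideal.\<close>
  define Wt where "Wt = - (ew j k * c) - (\<Sum>l\<in>?B. (ew k j - ew l j) * W l)"
  have xsJ: "xs J p' q' a" if "xs ?B p' q' a" for p' q' a using xs_mono[OF that, of J] by blast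
  have xsWt: "xs J (p - 1) (q + 1) Wt"
    unfolding Wt_def left_diff_distrib
    by (intro xs_diff xs_minus xs_sum xs.w xsJ *(1) W(1)) (use Suc.prems in auto)
  have yWt: "yd j k * Wt \<in> I J"
  proof -
    have 1: "yd j k * (ew j k * c) \<in> I J"
      using I_rmult[OF I_rely[of j J k], of c] Suc.prems by (simp add: mult.assoc)
    have 2: "yd j k * ((ew k j - ew l j) * W l) \<in> I J" if l: "l \<in> ?B" for l
    proof -
      have "yd j k * ((ew k j - ew l j) * W l) = - ((yd k j * ew k j) * W l)
          + (yd l j * ew l j) * W l + ew l j * (yd l k * W l)"
        using ew_yd[of l j l k "W l"]
        by (simp add: mult.assoc left_diff_distrib right_diff_distrib yd_def)
      also have "\<dots> \<in> I J"
      proof (intro I.add)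
        show "- ((yd k j * ew k j) * W l) \<in> I J"
          by (rule I_minus, rule I_rmult, rule I_rely) (use Suc.prems in auto)
        show "(yd l j * ew l j) * W l \<in> I J"
          by (rule I_rmult, rule I_rely) (use l Suc.prems in auto)
        show "ew l j * (yd l k * W l) \<in> I J"
          by (rule I_lmult, rule mono, rule W(3)[OF l])
      qed
      finally show ?thesis .
    qed
    have "yd j k * Wt = - (yd j k * (ew j k * c)) - (\<Sum>l\<in>?B. yd j k * ((ew k j - ew l j) * W l))"
      unfolding Wt_def by (simp only: right_diff_distrib sum_distrib_left) simp
    also have "\<dots> \<in> I J" by (intro I_diff I_minus I_sum 1 2)
    finally show ?thesis .
  qed
  have dWt: "dE Wt - yd j k * z \<in> I J"
  proof -
    let ?v = "xd j k * c + (\<Sum>l\<in>?B. ew l j * b l)"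
    \<comment> \<open>These terms arise from differentiating the two edges in front of
      \<open>W l\<close>. They vanish modulo the relations because y_l - y_k annihilates
      \<open>W l\<close> by the strengthened induction hypothesis and x_l - x_k does so for reasons
      of degree.\<close>
    define A where "A l = xd k j * (yd k j * W l) - xd l j * (yd l j * W l)" for l
    have A: "A l \<in> I J" if l: "l \<in> ?B" for l
    proof -
      have xW: "xd l k * W l \<in> I J"
        by (rule mono, rule xs_top_xd[OF finB W(1)[OF l] _ l kB]) (use Suc.prems(6) Suc.hyps(2) cardB in auto)
      have "A l = - (xd l j * (yd l k * W l)) + yd k j * (xd l k * W l)"
        unfolding A_def yd_xd by (simp add: left_diff_distrib right_diff_distrib yd_def xd_def)
      also have "\<dots> \<in> I J"
        using I_lmult[OF mono[OF W(3)[OF l]], of "xd l j"] I_lmult[OF xW, of "yd k j"]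
        by (metis I.add I_minus)
      finally show ?thesis .
    qed
    have "dE Wt = - (xd j k * (yd j k * c)) + ew j k * dE c
        + (\<Sum>l\<in>?B. - A l + (ew k j - ew l j) * dE (W l))"
    proof -
      have "dE ((ew k j - ew l j) * W l) = - (- A l + (ew k j - ew l j) * dE (W l))" for l
        by (simp add: A_def dE.diff left_diff_distrib)
      then have "dE Wt = - (dE (ew j k * c)) - (\<Sum>l\<in>?B. - (- A l + (ew k j - ew l j) * dE (W l)))"
        by (simp only: Wt_def dE.diff dE.minus dE.sum)
      then show ?thesis by (simp only: sum_negf) simp
    qed
    moreover have "yd j k * ?v = - (xd j k * (yd j k * c)) + (\<Sum>l\<in>?B. yd j k * (ew l j * b l))"
      using yd_xd[of j k j k "c"] by (simp add: distrib_left sum_distrib_left)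
    ultimately have "dE Wt - yd j k * ?v = ew j k * dE c
        + (\<Sum>l\<in>?B. - A l + (ew k j - ew l j) * dE (W l) - yd j k * (ew l j * b l))"
      by (simp add: sum_subtractf)
    also have "\<dots> = ew j k * dE c + (\<Sum>l\<in>?B. ew j k * (yd l k * b l) +
        (- A l + (ew k j - ew l j) * (dE (W l) - yd l k * b l) - (yd j l * ew l j) * b l))"
    proof -
      have "- A l + (ew k j - ew l j) * dE (W l) - yd j k * (ew l j * b l) = ew j k * (yd l k * b l) +
        (- A l + (ew k j - ew l j) * (dE (W l) - yd l k * b l) - (yd j l * ew l j) * b l)" for l
      proof -
        have "yd j k * (ew l j * b l) = yd j l * (ew l j * b l) - ew l j * (yd l k * b l)"
          using ew_yd[of l j l k "b l"] by (simp add: left_diff_distrib yd_def)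
        then show ?thesis
          by (simp add: left_diff_distrib right_diff_distrib mult.assoc gw_commute[of j k])
      qed
      then show ?thesis by (simp only:)
    qed
    also have "\<dots> = ew j k * (dE c + (\<Sum>l\<in>?B. yd l k * b l)) +
        (\<Sum>l\<in>?B. - A l + (ew k j - ew l j) * (dE (W l) - yd l k * b l) - (yd j l * ew l j) * b l)"
      by (simp only: sum.distrib distrib_left sum_distrib_left add.assoc)
    also have "\<dots> \<in> I J"
    proof (rule I.add[OF I_lmult I_sum[OF I_diff[OF I.add[OF _ I_lmult] I_rmult]]])
      have "dE c + (\<Sum>l\<in>?B. yd l k * b l) = dE c + (\<Sum>l\<in>?B. ey l * b l) - ey k * (\<Sum>l\<in>?B. b l)"
        by (simp add: yd_def left_diff_distrib sum_subtractf sum_distrib_left)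
      also have "\<dots> \<in> I ?B" by (rule I_diff[OF *(5) I_lmult[OF *(4)]])
      finally show "dE c + (\<Sum>l\<in>?B. yd l k * b l) \<in> I J" by (rule mono)
      fix l assume l: "l \<in> ?B"
      show "- A l \<in> I J" by (rule I_minus[OF A[OF l]])
      show "dE (W l) - yd l k * b l \<in> I J" by (rule mono[OF W(2)[OF l]])
      show "yd j l * ew l j \<in> I J"
        using l Suc.prems I_rely[of j J l] by (auto simp: gw_commute)
    qed
    finally have "dE Wt - yd j k * ?v \<in> I J" .
    moreover have "yd j k * (z - ?v) \<in> I J" by (rule I_lmult[OF *(3)])
    ultimately have "dE Wt - yd j k * ?v - yd j k * (z - ?v) \<in> I J" by (rule I_diff)
    then show ?thesis by (simp only: right_diff_distrib) simp
  qed
  show ?case using xsWt yWt dWt by blast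
qed

section \<open>Bases modulo a subspace\<close>

text \<open>The family \<open>b\<close> represents a basis of V / (V \<inter> V0). The intersection
  matters: the main use is \<open>V0 = I J\<close>, which is not contained in the homogeneous space
  \<open>K J p q\<close>.\<close>

definition quot_basis :: "(rat \<Rightarrow> 'a \<Rightarrow> 'a :: ab_group_add) \<Rightarrow> 'a set \<Rightarrow> 'a set \<Rightarrow> nat \<Rightarrow> bool" where
  "quot_basis s V V0 N \<longleftrightarrow> (\<exists>b. (\<forall>i<N. b i \<in> V) \<and> (\<forall>v\<in>V. \<exists>c. v - (\<Sum>i<N. s (c i) (b i)) \<in> V0) \<and>
     (\<forall>c. (\<Sum>i<N. s (c i) (b i)) \<in> V0 \<longrightarrow> (\<forall>i<N. c i = 0)))"

lemma quot_basis_transfer: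
  assumes g: "module_hom s1 s2 g" and V: "module.subspace s1 V" and W0: "module.subspace s2 W0"
    and Q: "quot_basis s1 V V0 N"
    and into: "\<And>v. v \<in> V \<Longrightarrow> g v \<in> W"
    and onto: "\<And>w. w \<in> W \<Longrightarrow> \<exists>v\<in>V. w - g v \<in> W0"
    and inj: "\<And>v. v \<in> V \<Longrightarrow> g v \<in> W0 \<longleftrightarrow> v \<in> V0"
  shows "quot_basis s2 W W0 N"
proof -
  interpret module_hom s1 s2 g by fact
  from Q obtain b where b: "\<And>i. i < N \<Longrightarrow> b i \<in> V"
    and span: "\<And>v. v \<in> V \<Longrightarrow> \<exists>c. v - (\<Sum>i<N. s1 (c i) (b i)) \<in> V0"
    and ind: "\<And>c i. (\<Sum>i<N. s1 (c i) (b i)) \<in> V0 \<Longrightarrow> i < N \<Longrightarrow> c i = 0"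
    unfolding quot_basis_def by blast
  have inV: "(\<Sum>i<N. s1 (c i) (b i)) \<in> V" for c
    by (rule m1.subspace_sum[OF V]) (auto intro: m1.subspace_scale[OF V] b)
  have gsum: "g (\<Sum>i<N. s1 (c i) (b i)) = (\<Sum>i<N. s2 (c i) (g (b i)))" for c
    by (simp add: sum scale)
  show ?thesis
    unfolding quot_basis_def
  proof (intro exI[of _ "\<lambda>i. g (b i)"] conjI allI impI ballI)
    fix w assume "w \<in> W"
    then obtain v where v: "v \<in> V" "w - g v \<in> W0" using onto by blast
    obtain c where c: "v - (\<Sum>i<N. s1 (c i) (b i)) \<in> V0" using span[OF v(1)] by blast
    then have "g (v - (\<Sum>i<N. s1 (c i) (b i))) \<in> W0"
      using inj[of "v - (\<Sum>i<N. s1 (c i) (b i))"] m1.subspace_diff[OF V v(1) inV] by blast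
    then have "w - g v + g (v - (\<Sum>i<N. s1 (c i) (b i))) \<in> W0"
      by (intro m2.subspace_add[OF W0] v)
    then show "\<exists>c. w - (\<Sum>i<N. s2 (c i) (g (b i))) \<in> W0"
      by (intro exI[of _ c]) (simp add: diff gsum)
  next
    fix c i assume "(\<Sum>i<N. s2 (c i) (g (b i))) \<in> W0" and i: "i < N"
    then have "(\<Sum>i<N. s1 (c i) (b i)) \<in> V0" using inj[OF inV] by (simp add: gsum)
    then show "c i = 0" using ind i by blast
  qed (use into b in auto)
qed

lemma sum_lessThan_add: "(\<Sum>i<N + M. h i) = (\<Sum>i<N. h i) + (\<Sum>i<M. h (N + i :: nat) :: 'a :: comm_monoid_add)"
  by (induction M) (simp_all add: add.assoc)

text \<open>Additivity of dimension along a short exact sequence: \<open>f\<close> induces a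
  surjection onto W modulo W0, and a basis of its kernel is completed by lifts of a basis of the
  target.\<close>

lemma quot_basis_extension:
  assumes f: "module_hom s1 s2 f" and V: "module.subspace s1 V" and W0: "module.subspace s2 W0"
    and QU: "quot_basis s1 {v \<in> V. f v \<in> W0} V0 M" and QW: "quot_basis s2 W W0 N"
    and into: "\<And>v. v \<in> V \<Longrightarrow> f v \<in> W"
    and onto: "\<And>w. w \<in> W \<Longrightarrow> \<exists>v\<in>V. f v - w \<in> W0"
    and V0: "\<And>v. v \<in> V \<Longrightarrow> v \<in> V0 \<Longrightarrow> f v \<in> W0"
  shows "quot_basis s1 V V0 (N + M)"
proof -
  interpret module_hom s1 s2 f by fact
  from QU obtain u where U: "\<forall>i<M. u i \<in> {v \<in> V. f v \<in> W0}"
    "\<forall>v\<in>{v \<in> V. f v \<in> W0}. \<exists>c. v - (\<Sum>i<M. s1 (c i) (u i)) \<in> V0"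
    "\<forall>c. (\<Sum>i<M. s1 (c i) (u i)) \<in> V0 \<longrightarrow> (\<forall>i<M. c i = 0)"
    unfolding quot_basis_def by (elim exE conjE)
  then have u: "\<And>i. i < M \<Longrightarrow> u i \<in> V" "\<And>i. i < M \<Longrightarrow> f (u i) \<in> W0"
    and uspan: "\<And>v. v \<in> V \<Longrightarrow> f v \<in> W0 \<Longrightarrow> \<exists>c. v - (\<Sum>i<M. s1 (c i) (u i)) \<in> V0"
    and uind: "\<And>c i. (\<Sum>i<M. s1 (c i) (u i)) \<in> V0 \<Longrightarrow> i < M \<Longrightarrow> c i = 0"
    by auto
  from QW obtain b where b: "\<And>i. i < N \<Longrightarrow> b i \<in> W"
    and bspan: "\<And>v. v \<in> W \<Longrightarrow> \<exists>c. v - (\<Sum>i<N. s2 (c i) (b i)) \<in> W0"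
    and bind: "\<And>c i. (\<Sum>i<N. s2 (c i) (b i)) \<in> W0 \<Longrightarrow> i < N \<Longrightarrow> c i = 0"
    unfolding quot_basis_def by blast
  have "\<forall>i. \<exists>v. i < N \<longrightarrow> v \<in> V \<and> f v - b i \<in> W0" using onto b by blast
  then obtain t where t: "\<And>i. i < N \<Longrightarrow> t i \<in> V" "\<And>i. i < N \<Longrightarrow> f (t i) - b i \<in> W0" by metis
  define B where "B i = (if i < N then t i else u (i - N))" for i
  have split: "(\<Sum>i<N + M. s1 (c i) (B i)) = (\<Sum>i<N. s1 (c i) (t i)) + (\<Sum>i<M. s1 (c (N + i)) (u i))" for c
    by (simp add: sum_lessThan_add B_def)
  have tV: "(\<Sum>i<N. s1 (c i) (t i)) \<in> V" for c
    by (rule m1.subspace_sum[OF V]) (auto intro: m1.subspace_scale[OF V] t)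
  have uV: "(\<Sum>i<M. s1 (c i) (u i)) \<in> V" for c
    by (rule m1.subspace_sum[OF V]) (auto intro: m1.subspace_scale[OF V] u)
  have fu: "f (\<Sum>i<M. s1 (c i) (u i)) \<in> W0" for c
    unfolding sum scale by (rule m2.subspace_sum[OF W0]) (auto intro: m2.subspace_scale[OF W0] u)
  have ft: "f (\<Sum>i<N. s1 (c i) (t i)) - (\<Sum>i<N. s2 (c i) (b i)) \<in> W0" for c
  proof -
    have "f (\<Sum>i<N. s1 (c i) (t i)) - (\<Sum>i<N. s2 (c i) (b i)) = (\<Sum>i<N. s2 (c i) (f (t i) - b i))"
      by (simp add: sum scale m2.scale_right_diff_distrib sum_subtractf)
    also have "\<dots> \<in> W0" by (rule m2.subspace_sum[OF W0]) (auto intro: m2.subspace_scale[OF W0] t)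
    finally show ?thesis .
  qed
  show ?thesis
    unfolding quot_basis_def
  proof (intro exI[of _ B] conjI allI impI ballI)
    fix i assume "i < N + M" then show "B i \<in> V" using t u by (auto simp: B_def)
  next
    fix v assume v: "v \<in> V"
    obtain c where c: "f v - (\<Sum>i<N. s2 (c i) (b i)) \<in> W0" using bspan[OF into[OF v]] by blast
    let ?v = "v - (\<Sum>i<N. s1 (c i) (t i))"
    have "f v - (\<Sum>i<N. s2 (c i) (b i)) - (f (\<Sum>i<N. s1 (c i) (t i)) - (\<Sum>i<N. s2 (c i) (b i))) \<in> W0"
      by (rule m2.subspace_diff[OF W0 c ft])
    then have "f ?v \<in> W0" by (simp add: diff)
    then obtain c' where c': "?v - (\<Sum>i<M. s1 (c' i) (u i)) \<in> V0"
      using uspan m1.subspace_diff[OF V v tV] by blast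
    let ?c = "\<lambda>i. if i < N then c i else c' (i - N)"
    have "(\<Sum>i<N + M. s1 (?c i) (B i)) = (\<Sum>i<N. s1 (c i) (t i)) + (\<Sum>i<M. s1 (c' i) (u i))"
      unfolding split by simp
    with c' show "\<exists>c. v - (\<Sum>i<N + M. s1 (c i) (B i)) \<in> V0"
      by (intro exI[of _ ?c]) (simp only: diff_diff_eq)
  next
    fix c i assume z: "(\<Sum>i<N + M. s1 (c i) (B i)) \<in> V0" and i: "i < N + M"
    have "f (\<Sum>i<N + M. s1 (c i) (B i)) \<in> W0"
      by (rule V0[OF _ z]) (auto simp: split intro: m1.subspace_add[OF V] tV uV)
    then have "f (\<Sum>i<N. s1 (c i) (t i)) \<in> W0"
      using m2.subspace_diff[OF W0 _ fu[of "\<lambda>i. c (N + i)"]] unfolding split add by fastforce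
    then have "(\<Sum>i<N. s2 (c i) (b i)) \<in> W0"
      using m2.subspace_diff[OF W0 _ ft[of c]] by fastforce
    then have cN: "c i = 0" if "i < N" for i using bind that by blast
    then have "(\<Sum>i<M. s1 (c (N + i)) (u i)) \<in> V0"
      using z unfolding split by simp
    then have "c (N + i) = 0" if "i < M" for i using uind[of "\<lambda>i. c (N + i)"] that by blast
    from this[of "i - N"] cN[of i] i show "c i = 0" by (cases "i < N") auto
  qed
qed

lemma quot_basis_0: "0 \<in> V0 \<Longrightarrow> V \<subseteq> V0 \<Longrightarrow> quot_basis s V V0 0"
  unfolding quot_basis_def by auto

section \<open>The dimension of the space of cocycles\<close>

lemma subspace_I: "smul.subspace (I J)"
  by (auto simp: smul.subspace_def intro: I.intros)

lemma subspace_K: "smul.subspace (K J p q)"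
  by (auto simp: smul.subspace_def K_def dE.zero dE.add dE.smul intro: xs.intros I.intros)

lemma lin_map_module_hom: "lin_map f \<Longrightarrow> module_hom smul smul f"
  by (simp add: module_hom_def module_hom_axioms_def lin_map_def smul.module_axioms)

text \<open>Extension by zero to negative indices matches the integer degrees and makes the
  recurrence valid for every p.\<close>

definition stirling_int :: "nat \<Rightarrow> int \<Rightarrow> nat" where
  "stirling_int m p = (if p < 0 then 0 else stirling m (nat p))"

lemma stirling_int_Suc: "stirling_int (Suc m) p = m * stirling_int m p + stirling_int m (p - 1)"
proof (cases "p \<ge> 1")
  case True
  then obtain r where "p = int (Suc r)" by (metis int_ops(4) nat_int zero_le_imp_eq_int diff_add_cancel diff_ge_0_iff_ge of_nat_Suc)
  then show ?thesis by (simp add: stirling_int_def nat_add_distrib)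
next
  case False
  then show ?thesis by (cases m) (auto simp: stirling_int_def)
qed

lemma I_singleton: "a \<in> I {k} \<Longrightarrow> a = 0"
proof (induction rule: I.induct)
  case (rel r)
  then show ?case by (cases rule: Rel_cases) auto
qed auto

lemma xs_singleton_scalar: "xs {k} p q a \<Longrightarrow> \<exists>c. a = smul c 1"
proof (induction rule: xs.induct)
  case one
  show ?case by (intro exI[of _ 1]) simp
next
  case (add p q a b)
  then show ?case by (metis add_smul)
next
  case (smul p q a c)
  then show ?case by (metis smul_smul)
qed (auto intro: exI[of _ 0])

text \<open>One point leaves only scalars, in bidegree (0, 0). If p is not 0, one of p and q is
  negative.\<close>

lemma K_basis_singleton:
  assumes "p + q = 0"
  shows "quot_basis smul (K {k} p q) (I {k}) (stirling_int 0 p)"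
proof (cases "p = 0")
  case True
  have "quot_basis smul (K {k} 0 0) (I {k}) 1"
    unfolding quot_basis_def
  proof (intro exI[of _ "\<lambda>_. 1 :: ext"] conjI allI impI ballI)
    fix v assume "v \<in> K {k} 0 0"
    then obtain c where "v = smul c 1" using xs_singleton_scalar[of k 0 0 v] by (auto simp: K_def)
    then show "\<exists>c. v - (\<Sum>i<1::nat. smul (c i) 1) \<in> I {k}"
      by (intro exI[of _ "\<lambda>_. c"]) (simp add: I.zero)
  next
    fix c :: "nat \<Rightarrow> rat" and i :: nat
    assume "(\<Sum>i<1::nat. smul (c i) 1) \<in> I {k}" and i: "i < 1"
    then have "smul (c 0) 1 = 0" using I_singleton by auto
    then have "cf (smul (c 0) (monE {})) {} = cf 0 {}" by simp
    then show "c i = 0" using i unfolding cf_smul cf_monE by simp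
  qed (auto simp: K_def dE.one intro: xs.one I.zero)
  with True assms show ?thesis by (simp add: stirling_int_def)
next
  case False
  with assms have neg: "p < 0 \<or> q < 0" by auto
  have "K {k} p q \<subseteq> I {k}" using xs_neg[of "{k}" p q, OF _ neg] I.zero unfolding K_def by blast
  moreover have "stirling_int 0 p = 0"
    using False by (cases "nat p") (auto simp: stirling_int_def)
  ultimately show ?thesis by (simp add: quot_basis_0 I.zero)
qed

lemma K_res: "z \<in> K J p q \<Longrightarrow> l \<in> J \<Longrightarrow> l \<noteq> j \<Longrightarrow> res l j z \<in> K (J - {j}) p (q - 1)"
  using res_I[of l J j "dE z"] by (auto simp: K_def res_dE intro: xs_res)

lemma K_xd_mult: "c \<in> K (J - {j}) (p - 1) q \<Longrightarrow> j \<in> J \<Longrightarrow> k \<in> J \<Longrightarrow> xd j k * c \<in> K J p q"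
  using xs_mono[of "J - {j}" "p - 1" q c J] I_mono[of "J - {j}" J "dE c"]
  by (auto simp: K_def intro!: xs_x I_lmult)

text \<open>The family with \<open>b\<close> at l, \<open>- b\<close> at k and 0 elsewhere has sum
  zero, so it should come from a cocycle. The residue at k is left free to compensate for the one
  prescribed at l.\<close>

lemma res_surj:
  assumes fin: "finite J" and J: "j \<in> J" "k \<in> J" "k \<noteq> j" "l \<in> J" "l \<noteq> j" "l \<noteq> k"
    and card: "p + q + 1 = int (card J)" and b: "b \<in> K (J - {j}) p (q - 1)"
  shows "\<exists>z\<in>K J p q. res l j z = b \<and> (\<forall>m. m \<noteq> l \<longrightarrow> m \<noteq> k \<longrightarrow> m \<noteq> j \<longrightarrow> res m j z = 0)"
proof -
  let ?B = "J - {j}"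
  have B: "finite ?B" "k \<in> ?B" "l \<in> ?B" using assms by auto
  have "card J = Suc (card ?B)" using assms by (metis card.remove)
  then have cardB: "p + (q - 1) + 1 = int (card ?B)" using card by simp
  have mono: "a \<in> I J" if "a \<in> I ?B" for a using I_mono[OF _ that, of J] by blast
  have xsJ: "xs J p' q' a" if "xs ?B p' q' a" for p' q' a using xs_mono[OF that, of J] by blast
  have bx: "xs ?B p (q - 1) b" "dE b \<in> I ?B" using b by (auto simp: K_def)
  obtain W where W: "xs ?B (p - 1) q W" "dE W - yd l k * b \<in> I ?B"
    using primitive_exists[OF B \<open>l \<noteq> k\<close> b cardB] by auto
  \<comment> \<open>For this family the condition on the remaining coefficient reads d c = - (y_l -
    y_k) b, so c is minus the primitive \<open>W\<close>.\<close>
  let ?z = "ew l j * b - ew k j * b - xd j k * W"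
  have "xd l j * (yd l j * b) - xd k j * (yd k j * b) = xd l k * (yd l j * b) - xd j k * (yd l k * b)"
    by (simp add: xd_def yd_def left_diff_distrib right_diff_distrib)
  then have "dE ?z = - (yd l j * (xd l k * b)) + xd j k * (dE W - yd l k * b)
      - (ew l j - ew k j) * dE b"
    by (simp add: dE.diff yd_xd left_diff_distrib right_diff_distrib)
  also have "\<dots> \<in> I J"
  proof (rule I_diff[OF I.add[OF I_minus[OF I_lmult] I_lmult] I_lmult])
    show "xd l k * b \<in> I J" by (rule mono, rule xs_top_xd[OF B(1) bx(1) cardB B(3,2)])
  qed (rule mono W bx)+
  finally have "?z \<in> K J p q"
    using J xs_w[OF _ _ _ xsJ[OF bx(1)]] xs_x[OF _ _ xsJ[OF W(1)]]
    by (auto simp: K_def intro!: xs_diff)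
  moreover have "res m j ?z = (if m = l then b else 0) - (if m = k then b else 0)" if "m \<noteq> j" for m
    using res_ew[OF xs_LamG[OF bx(1)], of m l] res_ew[OF xs_LamG[OF bx(1)], of m k] that J
      res_xd[OF xs_LamG[OF W(1)]]
    by (auto simp: res.diff)
  ultimately show ?thesis using J by (intro bexI[of _ ?z]) auto
qed

lemma K_basis:
  assumes "finite J" "k \<in> J" "p + q + 1 = int (card J)"
  shows "quot_basis smul (K J p q) (I J) (stirling_int (card J - 1) p)"
  using assms
proof (induction "card J" arbitrary: J p q)
  case 0
  then show ?case by simp
next
  case (Suc n)
  show ?case
  proof (cases "n = 0")
    case True
    with Suc obtain k' where "J = {k'}" by (metis One_nat_def card_1_singletonE)
    then show ?thesis using K_basis_singleton[of p q k'] Suc.prems by simp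
  next
    case False
    have "J \<noteq> {k}" using False Suc.hyps(2) by auto
    then obtain j where j: "j \<in> J" "j \<noteq> k" using Suc.prems by blast
    let ?B = "J - {j}"
    have cardB: "n = card ?B" using Suc.hyps(2) j Suc.prems(1) by simp
    have B: "finite ?B" "k \<in> ?B" using j Suc.prems by auto
    have IH: "quot_basis smul (K ?B p' q') (I ?B) (stirling_int (n - 1) p')"
      if "p' + q' + 1 = int n" for p' q'
      using Suc.hyps(1)[OF cardB B] that cardB by simp
    \<comment> \<open>\<open>T\<close> collects the points at which a residue is allowed. The point
      k is never constrained, since its residue is determined by the others.\<close>
    define V where "V T = {z \<in> K J p q. \<forall>l\<in>J - {j, k} - T. res l j z \<in> I ?B}" for T
    have subV: "smul.subspace (V T)" for T
      using subspace_K[of J p q] subspace_I[of ?B]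
      by (auto simp: smul.subspace_def V_def res.zero res.add res.smul)
    have "quot_basis smul (V T) (I J) (stirling_int (n - 1) (p - 1) + card T * stirling_int (n - 1) p)"
      if "finite T" "T \<subseteq> J - {j, k}" for T
      using that
    proof (induction T rule: finite_induct)
      case empty
      have "quot_basis smul (V {}) (I J) (stirling_int (n - 1) (p - 1))"
      proof (rule quot_basis_transfer[of smul smul "\<lambda>c. xd j k * c" "K ?B (p - 1) q" "I J" "I ?B"])
        show "module_hom smul smul (\<lambda>c. xd j k * c)"
          by (rule lin_map_module_hom) (simp add: lin_map_def distrib_left)
        show "quot_basis smul (K ?B (p - 1) q) (I ?B) (stirling_int (n - 1) (p - 1))"
          by (rule IH) (use Suc.prems(3) Suc.hyps(2) in auto)
        fix c assume c: "c \<in> K ?B (p - 1) q"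
        then have cL: "c \<in> LamG (gensE ?B)" by (auto simp: K_def intro: xs_LamG)
        show "xd j k * c \<in> V {}"
          using K_xd_mult[OF c j(1) Suc.prems(2)] by (auto simp: V_def res_xd[OF cL] I.zero)
        show "xd j k * c \<in> I J \<longleftrightarrow> c \<in> I ?B"
          using xd_mult_I_cancel[OF cL j(2)[symmetric]] I_mono[of ?B J c] by (auto intro: I_lmult)
      next
        fix z assume z: "z \<in> V {}"
        then have zK: "z \<in> K J p q" by (simp add: V_def)
        obtain c b where *: "xs ?B (p - 1) q c" "\<And>l. l \<in> ?B \<Longrightarrow> b l \<in> K ?B p (q - 1)"
          "z - (xd j k * c + (\<Sum>l\<in>?B. ew l j * b l)) \<in> I J"
          "(\<Sum>l\<in>?B. b l) \<in> I ?B" "dE c + (\<Sum>l\<in>?B. ey l * b l) \<in> I ?B"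
          using K_nf[OF zK Suc.prems(1) j(1) Suc.prems(2) j(2)[symmetric] Suc.prems(3)] by blast
        have bL: "b l \<in> LamG (gensE ?B)" if "l \<in> ?B" for l
          using *(2)[OF that] by (auto simp: K_def intro: xs_LamG)
        have bl: "b l \<in> I ?B" if l: "l \<in> ?B" "l \<noteq> k" for l
        proof -
          have "res l j (z - (xd j k * c + (\<Sum>l\<in>?B. ew l j * b l))) \<in> I ?B"
            using l by (intro res_I *) auto
          moreover have "res l j (xd j k * c + (\<Sum>l\<in>?B. ew l j * b l)) = b l"
            by (rule res_nf[OF Suc.prems(1) l(1) xs_LamG[OF *(1)]]) (rule bL)
          moreover have "res l j z \<in> I ?B" using z l by (auto simp: V_def)
          ultimately have "res l j z - (res l j z - b l) \<in> I ?B"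
            by (intro I_diff[of "res l j z" _ "res l j z - b l"]) (simp_all add: res.diff)
          then show ?thesis by simp
        qed
        \<comment> \<open>The only residue not known to vanish is recovered from the vanishing of
          the sum.\<close>
        have "b k = (\<Sum>l\<in>?B. b l) - (\<Sum>l\<in>?B - {k}. b l)"
          using sum.remove[OF B, of b] by simp
        also have "\<dots> \<in> I ?B" using bl by (intro I_diff * I_sum) auto
        finally have bI: "b l \<in> I ?B" if "l \<in> ?B" for l using bl that by blast
        have "dE c + (\<Sum>l\<in>?B. ey l * b l) - (\<Sum>l\<in>?B. ey l * b l) \<in> I ?B"
          by (intro I_diff *(5) I_sum I_lmult bI)
        then have "c \<in> K ?B (p - 1) q" using *(1) by (simp add: K_def)
        moreover have "z - (xd j k * c + (\<Sum>l\<in>?B. ew l j * b l)) + (\<Sum>l\<in>?B. ew l j * b l) \<in> I J"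
          using I_mono[of ?B J] bI by (intro I.add *(3) I_sum I_lmult) auto
        ultimately show "\<exists>c\<in>K ?B (p - 1) q. z - xd j k * c \<in> I J"
          by (intro bexI[of _ c]) (simp_all add: algebra_simps)
      qed (rule subspace_K subspace_I)+
      then show ?case by simp
    next
      case (insert l T)
      then have l: "l \<in> J" "l \<noteq> j" "l \<noteq> k" by auto
      have VT: "V T = {z \<in> V (insert l T). res l j z \<in> I ?B}"
        using insert l by (auto simp: V_def)
      have "quot_basis smul (V (insert l T)) (I J)
          (stirling_int (n - 1) p + (stirling_int (n - 1) (p - 1) + card T * stirling_int (n - 1) p))"
      proof (rule quot_basis_extension[of smul smul "res l j" _ "I ?B" _ _ "K ?B p (q - 1)"])
        show "quot_basis smul {v \<in> V (insert l T). res l j v \<in> I ?B} (I J)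
            (stirling_int (n - 1) (p - 1) + card T * stirling_int (n - 1) p)"
          using insert by (simp add: VT)
        show "quot_basis smul (K ?B p (q - 1)) (I ?B) (stirling_int (n - 1) p)"
          by (rule IH) (use Suc.prems(3) Suc.hyps(2) in auto)
        show "res l j v \<in> K ?B p (q - 1)" if "v \<in> V (insert l T)" for v
          using that l by (auto simp: V_def intro: K_res)
        show "\<exists>v\<in>V (insert l T). res l j v - w \<in> I ?B" if w: "w \<in> K ?B p (q - 1)" for w
        proof -
          obtain z where "z \<in> K J p q" "res l j z = w"
            "\<And>m. m \<noteq> l \<Longrightarrow> m \<noteq> k \<Longrightarrow> m \<noteq> j \<Longrightarrow> res m j z = 0"
            using res_surj[OF Suc.prems(1) j(1) Suc.prems(2) j(2)[symmetric] l Suc.prems(3) w] by blast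
          then show ?thesis by (intro bexI[of _ z]) (auto simp: V_def I.zero)
        qed
        show "res l j v \<in> I ?B" if "v \<in> I J" for v using that l by (intro res_I)
      qed (rule lin_map_module_hom lin_map_res subV subspace_I)+
      then show ?case using insert by (simp add: add_ac)
    qed
    from this[of "J - {j, k}"] Suc.prems(1)
    have "quot_basis smul (V (J - {j, k})) (I J)
        (stirling_int (n - 1) (p - 1) + card (J - {j, k}) * stirling_int (n - 1) p)" by simp
    moreover have "V (J - {j, k}) = K J p q" by (simp add: V_def)
    moreover have "card (J - {j, k}) = n - 1"
      using Suc.hyps(2) j Suc.prems by (simp add: card_Diff_subset)
    moreover have "stirling_int n p = stirling_int (n - 1) (p - 1) + (n - 1) * stirling_int (n - 1) p"
      using stirling_int_Suc[of "n - 1" p] False by simp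
    ultimately show ?thesis unfolding Suc.hyps(2)[symmetric] by simp
  qed
qed

section \<open>Bidegree and the action of \<open>SL_2\<close>\<close>

text \<open>The bigraded pieces in a form suited to induction over multiplication by generators;
  \<open>gr_iff\<close> identifies them with the description by coefficients used for
  \<open>Lampq\<close>.\<close>

inductive gr :: "nat set \<Rightarrow> int \<Rightarrow> int \<Rightarrow> ext \<Rightarrow> bool" for G where
  one: "gr G 0 0 1"
| zero: "gr G p q 0"
| add: "gr G p q a \<Longrightarrow> gr G p q b \<Longrightarrow> gr G p q (a + b)"
| smul: "gr G p q a \<Longrightarrow> gr G p q (smul c a)"
| xy: "s \<in> G \<Longrightarrow> s mod 3 \<noteq> 2 \<Longrightarrow> gr G p q a \<Longrightarrow> gr G (p + 1) q (e s * a)"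
| w: "s \<in> G \<Longrightarrow> s mod 3 = 2 \<Longrightarrow> gr G p q a \<Longrightarrow> gr G p (q + 1) (e s * a)"

lemma gr_minus: "gr G p q a \<Longrightarrow> gr G p q (- a)"
  using gr.smul[of G p q a "-1"] by (simp add: smul_minus_one)
lemma gr_diff: "gr G p q a \<Longrightarrow> gr G p q b \<Longrightarrow> gr G p q (a - b)"
  using gr.add[OF _ gr_minus, of G p q a b] by simp
lemma gr_sum: "(\<And>i. i \<in> A \<Longrightarrow> gr G p q (f i)) \<Longrightarrow> gr G p q (\<Sum>i\<in>A. f i)"
  by (induction A rule: infinite_finite_induct) (auto intro: gr.add gr.zero)

lemma card_filter_insert:
  assumes "finite S" "m \<notin> S"
  shows "card {s \<in> insert m S. P s} = (if P m then 1 else 0) + card {s \<in> S. P s}"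
proof -
  have "{s \<in> insert m S. P s} = (if P m then insert m {s \<in> S. P s} else {s \<in> S. P s})" by auto
  then show ?thesis using assms by simp
qed

lemma gr_monE:
  assumes "finite S" "S \<subseteq> G"
  shows "gr G (int (card {s \<in> S. s mod 3 \<noteq> 2})) (int (card {s \<in> S. s mod 3 = 2})) (monE S)"
  using assms
proof (induction S rule: finite_linorder_min_induct)
  case empty
  then show ?case by (simp add: gr.one)
next
  case (insert m S)
  have "m \<notin> S" using insert by blast
  note c = card_filter_insert[OF insert.hyps(1) this]
  have IH: "gr G (int (card {s \<in> S. s mod 3 \<noteq> 2})) (int (card {s \<in> S. s mod 3 = 2})) (monE S)"
    and m: "m \<in> G" using insert by auto
  have M: "monE (insert m S) = e m * monE S" using insert by (simp add: e_mult_monE_min)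
  show ?case
  proof (cases "m mod 3 = 2")
    case True
    show ?thesis using gr.w[OF m True IH] True unfolding M c by (simp add: add.commute)
  next
    case False
    show ?thesis using gr.xy[OF m False IH] False unfolding M c by (simp add: add.commute)
  qed
qed

lemma gr_iff: "gr G p q a \<longleftrightarrow> a \<in> LamG G \<and>
  (\<forall>S. cf a S \<noteq> 0 \<longrightarrow> int (card {s \<in> S. s mod 3 \<noteq> 2}) = p \<and> int (card {s \<in> S. s mod 3 = 2}) = q)"
proof
  have e_mult: "\<exists>T. cf a T \<noteq> 0 \<and> S = insert s T \<and> s \<notin> T \<and> finite T" if nz: "cf (e s * a) S \<noteq> 0" for s a S
  proof -
    obtain A T where "cf (e s) A \<noteq> 0" "cf a T \<noteq> 0" "A \<inter> T = {}" "S = A \<union> T"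
      using cf_mult_nonzeroD[OF nz] by blast
    then show ?thesis by (auto simp: cf_monE support_finite split: if_splits intro!: exI[of _ T])
  qed
  show "gr G p q a \<Longrightarrow> a \<in> LamG G \<and>
    (\<forall>S. cf a S \<noteq> 0 \<longrightarrow> int (card {s \<in> S. s mod 3 \<noteq> 2}) = p \<and> int (card {s \<in> S. s mod 3 = 2}) = q)"
  proof (induction rule: gr.induct)
    case one
    have "cf 1 S = (if S = {} then 1 else 0)" for S using cf_monE[of "{}" S] by auto
    then show ?case by auto
  next
    case (add p q a b)
    have "cf a S \<noteq> 0 \<or> cf b S \<noteq> 0" if "cf (a + b) S \<noteq> 0" for S using that by auto
    then show ?case using add by (blast intro: LamG_add)
  next
    case (xy s p q a)
    then show ?case
      by (auto dest!: e_mult intro!: LamG_mult LamG_e simp: card_filter_insert simp del: insert_iff)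
  next
    case (w s p q a)
    then show ?case
      by (auto dest!: e_mult intro!: LamG_mult LamG_e simp: card_filter_insert simp del: insert_iff)
  qed (auto intro: LamG_smul)
next
  assume a: "a \<in> LamG G \<and>
    (\<forall>S. cf a S \<noteq> 0 \<longrightarrow> int (card {s \<in> S. s mod 3 \<noteq> 2}) = p \<and> int (card {s \<in> S. s mod 3 = 2}) = q)"
  have "gr G p q (\<Sum>S\<in>{S. cf a S \<noteq> 0}. smul (cf a S) (monE S))"
  proof (intro gr_sum gr.smul)
    fix S assume "S \<in> {S. cf a S \<noteq> 0}"
    then show "gr G p q (monE S)"
      using a gr_monE[of S G] by (auto simp: LamG_def support_finite)
  qed
  then show "gr G p q a" by (simp flip: ext_as_sum)
qed

lemma gr_LamG: "gr G p q a \<Longrightarrow> a \<in> LamG G"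
  by (simp add: gr_iff)

section \<open>Degree in y, and rescaling of x and y\<close>

definition num_y :: "nat set \<Rightarrow> nat" where "num_y S = card {s \<in> S. s mod 3 = 1}"
definition num_x :: "nat set \<Rightarrow> nat" where "num_x S = card {s \<in> S. s mod 3 = 0}"

lemma num_xy: "finite S \<Longrightarrow> card {s \<in> S. s mod 3 \<noteq> 2} = num_x S + num_y S"
proof -
  assume S: "finite S"
  have "{s \<in> S. s mod 3 \<noteq> 2} = {s \<in> S. s mod 3 = 0} \<union> {s \<in> S. s mod 3 = 1}" by auto
  then show ?thesis using S by (simp add: num_x_def num_y_def card_Un_disjoint disjoint_iff)
qed

text \<open>Projection to y-degree \<open>m\<close>; in a fixed bidegree these are the weight spaces
  of the diagonal torus.\<close>

lift_definition ypart :: "nat \<Rightarrow> ext \<Rightarrow> ext" is "\<lambda>m f S. if num_y S = m then f S else 0"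
  by (auto elim: rev_finite_subset)

lemma cf_ypart [simp]: "cf (ypart m a) S = (if num_y S = m then cf a S else 0)"
  by transfer simp

lemma gr_ypart: "gr G p q a \<Longrightarrow> gr G p q (ypart m a)"
  by (auto simp: gr_iff LamG_def)

lemma lin_map_ypart: "lin_map (ypart m)"
  by unfold_locales (auto intro!: ext_eqI)

definition scg :: "rat \<Rightarrow> rat \<Rightarrow> nat \<Rightarrow> ext" where
  "scg \<alpha> \<beta> s = smul (if s mod 3 = 0 then \<alpha> else if s mod 3 = 1 then \<beta> else 1) (e s)"

text \<open>For \<open>\<alpha> * \<beta> = 1\<close> this is the action of a diagonal matrix.
  Degenerate values are allowed on purpose: \<open>scl 1 0\<close> sets every y to zero.\<close>

definition scl :: "rat \<Rightarrow> rat \<Rightarrow> ext \<Rightarrow> ext" where "scl \<alpha> \<beta> = homE (scg \<alpha> \<beta>)"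

interpretation scl: alg_hom "scl \<alpha> \<beta>" for \<alpha> \<beta>
  unfolding scl_def by (rule homE_odd(1)) (simp add: scg_def odd1.intros)

lemma scl_e: "scl \<alpha> \<beta> (e s) = scg \<alpha> \<beta> s"
  unfolding scl_def by (rule homE_odd(2)) (simp add: scg_def odd1.intros)

lemma scl_monE:
  assumes "finite S" shows "scl \<alpha> \<beta> (monE S) = smul (\<alpha> ^ num_x S * \<beta> ^ num_y S) (monE S)"
  using assms
proof (induction S rule: finite_linorder_min_induct)
  case empty
  then show ?case by (simp add: scl.one num_x_def num_y_def)
next
  case (insert m S)
  have "m \<notin> S" using insert by blast
  then show ?case
    using insert e_mult_monE_min[of S m, symmetric]
    by (simp add: scl.mult scl_e scg_def num_x_def num_y_def card_filter_insert mult_ac del: insert_iff)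
qed

lemma cf_scl: "cf (scl \<alpha> \<beta> a) U = \<alpha> ^ num_x U * \<beta> ^ num_y U * cf a U"
proof -
  have "scl \<alpha> \<beta> (\<Sum>S\<in>{S. cf a S \<noteq> 0}. smul (cf a S) (monE S))
    = (\<Sum>S\<in>{S. cf a S \<noteq> 0}. smul (cf a S) (smul (\<alpha> ^ num_x S * \<beta> ^ num_y S) (monE S)))"
    unfolding scl.sum scl.smul by (intro sum.cong refl) (simp add: scl_monE support_finite)
  then have "cf (scl \<alpha> \<beta> a) U
      = (\<Sum>S\<in>{S. cf a S \<noteq> 0}. cf a S * (\<alpha> ^ num_x S * \<beta> ^ num_y S) * cf (monE S) U)"
    by (simp flip: ext_as_sum)
  also have "\<dots> = (\<Sum>S\<in>{S. cf a S \<noteq> 0}. if S = U then \<alpha> ^ num_x U * \<beta> ^ num_y U * cf a U else 0)"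
    by (intro sum.cong refl) (auto simp: cf_monE support_finite)
  also have "\<dots> = \<alpha> ^ num_x U * \<beta> ^ num_y U * cf a U" by (simp add: sum.delta)
  finally show ?thesis .
qed

lemma scl_ypart:
  assumes "gr G (int p) q a"
  shows "scl \<alpha> \<beta> a = (\<Sum>m\<le>p. smul (\<alpha> ^ (p - m) * \<beta> ^ m) (ypart m a))"
proof (rule ext_eqI)
  fix S
  show "cf (scl \<alpha> \<beta> a) S = cf (\<Sum>m\<le>p. smul (\<alpha> ^ (p - m) * \<beta> ^ m) (ypart m a)) S"
  proof (cases "cf a S = 0")
    case False
    then have p: "p = num_x S + num_y S"
      using assms num_xy[OF support_finite[OF False]] by (auto simp: gr_iff)
    have "cf (\<Sum>m\<le>p. smul (\<alpha> ^ (p - m) * \<beta> ^ m) (ypart m a)) S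
        = (\<Sum>m\<le>p. if m = num_y S then \<alpha> ^ num_x S * \<beta> ^ num_y S * cf a S else 0)"
      unfolding cf_sum by (intro sum.cong refl) (auto simp: p)
    also have "\<dots> = \<alpha> ^ num_x S * \<beta> ^ num_y S * cf a S" by (simp add: p)
    finally show ?thesis by (simp add: cf_scl)
  qed (simp add: cf_scl cong: if_cong)
qed

section \<open>The action on the exterior algebra\<close>

definition ga :: "mat2 \<Rightarrow> nat \<Rightarrow> ext" where
  "ga g s = (case g of (a, b, c, d) \<Rightarrow>
     (if s mod 3 = 0 then smul a (ex (s div 3)) + smul c (ey (s div 3))
      else if s mod 3 = 1 then smul b (ex (s div 3)) + smul d (ey (s div 3))
      else e s))"

definition actE :: "mat2 \<Rightarrow> ext \<Rightarrow> ext" where "actE g = homE (ga g)"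

lemma ga_odd: "ga g s \<in> odd1"
  by (cases g) (auto simp: ga_def intro!: odd1_intros)

interpretation actE: alg_hom "actE g" for g
  unfolding actE_def by (rule homE_odd(1)) (rule ga_odd)

lemma actE_e: "actE g (e s) = ga g s"
  unfolding actE_def by (rule homE_odd(2)) (rule ga_odd)

lemma actE_gens [simp]:
  "actE (a, b, c, d) (ex i) = smul a (ex i) + smul c (ey i)"
  "actE (a, b, c, d) (ey i) = smul b (ex i) + smul d (ey i)"
  "actE g (ew i j) = ew i j"
  "actE (a, b, c, d) (xd i j) = smul a (xd i j) + smul c (yd i j)"
  "actE (a, b, c, d) (yd i j) = smul b (xd i j) + smul d (yd i j)"
  by (cases g; simp add: actE_e ga_def xd_def yd_def actE.diff smul.scale_right_diff_distrib)+

text \<open>The matrix multiplies (x_i - x_j) (y_i - y_j) by its determinant, so determinant 1 makes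
  the differential equivariant.\<close>

lemma actE_dE:
  assumes "g \<in> SL2" shows "dE (actE g a) = actE g (dE a)"
proof (rule skew_der_hom_commute[OF actE.alg_hom_axioms dE.skew_der_axioms dE.skew_der_axioms LamG_UNIV])
  fix s
  obtain a b c d where g: "g = (a, b, c, d)" "a * d - b * c = 1"
    using assms by (auto simp: SL2_def)
  show "actE g (e s) \<in> odd1" by (simp add: actE_e ga_odd)
  show "dE (actE g (e s)) = actE g (dg s)"
  proof (cases s rule: gen_cases)
    case (w i j)
    have "actE g (xd i j * yd i j) = smul (a * d) (xd i j * yd i j) + smul (c * b) (yd i j * xd i j)"
      unfolding g(1) actE.mult by (simp add: distrib_left distrib_right odd1_square add.commute mult.commute)
    also have "\<dots> = smul (a * d - b * c) (xd i j * yd i j)"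
      using odd1_anticomm[of "yd i j" "xd i j"]
      by (simp add: smul.scale_left_diff_distrib mult.commute)
    finally have "actE g (xd i j * yd i j) = xd i j * yd i j" using g by simp
    then show ?thesis using w g by (simp add: actE_e ga_def dg_def dE.e)
  qed (use g in \<open>auto simp: actE.zero dE.add dE.smul\<close>)
qed

lemma actE_I: assumes "a \<in> I J" shows "actE g a \<in> I J"
proof (rule I_hom[OF actE.alg_hom_axioms _ assms])
  obtain x y z t where g: "g = (x, y, z, t)" by (cases g)
  fix r assume "r \<in> Rel J"
  then show "actE g r \<in> I J"
  proof (cases rule: Rel_cases)
    case (arnold i j k)
    then show ?thesis by (simp add: actE.add actE.mult I_arnold)
  qed (auto simp: g actE.add actE.mult distrib_right intro!: I.add I.smul I_relx I_rely)
qed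

lemma gr_actE:
  assumes "gr (gensE J) p q a" shows "gr (gensE J) p q (actE g a)"
  using assms
proof (induction rule: gr.induct)
  case (xy s p q a)
  obtain x y z t where g: "g = (x, y, z, t)" by (cases g)
  have "gr (gensE J) (p + 1) q (ex i * actE g a)" "gr (gensE J) (p + 1) q (ey i * actE g a)" if "i \<in> J" for i
    using that xy.IH by (auto intro!: gr.xy)
  with xy.hyps show ?case
    by (cases s rule: gensE_cases)
       (auto simp: g actE.mult distrib_right intro!: gr.add gr.smul)
next
  case (w s p q a)
  then have "gr (gensE J) p (q + 1) (e s * actE g a)" by (intro gr.w)
  then show ?case using w by (cases g) (auto simp: actE.mult actE_e ga_def)
qed (auto simp: actE.one actE.zero actE.add actE.smul intro: gr.intros)

section \<open>The subalgebra generated by differences and edges\<close>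

inductive_set SubE :: "nat set \<Rightarrow> ext set" for J where
  one: "1 \<in> SubE J"
| add: "a \<in> SubE J \<Longrightarrow> b \<in> SubE J \<Longrightarrow> a + b \<in> SubE J"
| smul: "a \<in> SubE J \<Longrightarrow> smul c a \<in> SubE J"
| x: "i \<in> J \<Longrightarrow> j \<in> J \<Longrightarrow> a \<in> SubE J \<Longrightarrow> xd i j * a \<in> SubE J"
| y: "i \<in> J \<Longrightarrow> j \<in> J \<Longrightarrow> a \<in> SubE J \<Longrightarrow> yd i j * a \<in> SubE J"
| w: "i \<in> J \<Longrightarrow> j \<in> J \<Longrightarrow> i \<noteq> j \<Longrightarrow> a \<in> SubE J \<Longrightarrow> ew i j * a \<in> SubE J"

lemma SubE_zero: "0 \<in> SubE J" using SubE.smul[OF SubE.one, of 0] by simp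
lemma SubE_minus: "a \<in> SubE J \<Longrightarrow> - a \<in> SubE J"
  using SubE.smul[of a J "-1"] by (simp add: smul_minus_one)
lemma SubE_diff: "a \<in> SubE J \<Longrightarrow> b \<in> SubE J \<Longrightarrow> a - b \<in> SubE J"
  using SubE.add[OF _ SubE_minus, of a J b] by simp

lemma SubE_mult: "a \<in> SubE J \<Longrightarrow> b \<in> SubE J \<Longrightarrow> a * b \<in> SubE J"
  by (induction rule: SubE.induct) (auto simp: distrib_right mult.assoc intro: SubE.intros)

lemma SubE_LamG: "a \<in> SubE J \<Longrightarrow> a \<in> LamG (gensE J)"
  by (induction rule: SubE.induct) (auto intro: LamG_add LamG_smul LamG_mult LamG_gens)

lemma SubE_dE: "a \<in> SubE J \<Longrightarrow> dE a \<in> SubE J"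
  by (induction rule: SubE.induct)
     (auto simp: dE.one dE.add dE.smul intro: SubE_zero SubE_minus SubE_diff SubE.intros)

lemma SubE_actE: assumes "a \<in> SubE J" shows "actE g a \<in> SubE J"
proof -
  obtain x y z t where g: "g = (x, y, z, t)" by (cases g)
  show ?thesis using assms
    by (induction rule: SubE.induct)
       (auto simp: g actE.one actE.add actE.smul actE.mult distrib_right intro: SubE.intros)
qed

lemma scl_gens [simp]: "scl \<alpha> \<beta> (xd i j) = smul \<alpha> (xd i j)" "scl \<alpha> \<beta> (yd i j) = smul \<beta> (yd i j)"
  "scl \<alpha> \<beta> (ew i j) = ew i j" "scl \<alpha> \<beta> (ex i) = smul \<alpha> (ex i)" "scl \<alpha> \<beta> (ey i) = smul \<beta> (ey i)"
  by (simp_all add: xd_def yd_def scl.diff scl_e scg_def smul.scale_right_diff_distrib)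

lemma SubE_scl: "a \<in> SubE J \<Longrightarrow> scl \<alpha> \<beta> a \<in> SubE J"
  by (induction rule: SubE.induct) (auto simp: scl.one scl.add scl.smul scl.mult intro: SubE.intros)

lemma scl_I: assumes "a \<in> I J" shows "scl \<alpha> \<beta> a \<in> I J"
proof (rule I_hom[OF scl.alg_hom_axioms _ assms])
  fix r assume "r \<in> Rel J"
  then show "scl \<alpha> \<beta> r \<in> I J"
    by (cases rule: Rel_cases) (auto simp: scl.add scl.mult intro!: I.smul I_relx I_rely I_arnold)
qed

text \<open>Every nonzero value of \<open>dg\<close> contains a difference of two y's, so each term
  of a differential has a y. This is why no coboundary has a y-free component.\<close>

lemma scl_dE_zero: "scl \<alpha> 0 (dE a) = 0"
proof (induction a rule: ext_induct)
  case (gen s a)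
  then show ?case
    by (cases s rule: gen_cases) (simp_all add: dE.gen scl.diff scl.minus scl.mult scl.zero dg_def)
qed (simp_all add: dE.one dE.add dE.smul scl.zero scl.add scl.smul)

text \<open>\<open>tau k\<close> translates the point \<open>k\<close> to the origin: it is a retraction onto the subalgebra generated
  by the differences.\<close>

definition tg :: "nat \<Rightarrow> nat \<Rightarrow> ext" where
  "tg k s = (if s mod 3 = 0 then xd (s div 3) k else if s mod 3 = 1 then yd (s div 3) k else e s)"

definition tau :: "nat \<Rightarrow> ext \<Rightarrow> ext" where "tau k = homE (tg k)"

interpretation tau: alg_hom "tau k" for k
  unfolding tau_def by (rule homE_odd(1)) (simp add: tg_def)

lemma tau_e: "tau k (e s) = tg k s"
  unfolding tau_def by (rule homE_odd(2)) (simp add: tg_def)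

lemma tau_gens [simp]: "tau k (ex i) = xd i k" "tau k (ey i) = yd i k" "tau k (ew i j) = ew i j"
  "tau k (xd i j) = xd i j" "tau k (yd i j) = yd i j"
  by (simp_all add: xd_def yd_def tau.diff tau_e tg_def)

lemma tau_SubE: "a \<in> SubE J \<Longrightarrow> tau k a = a"
  by (induction rule: SubE.induct) (simp_all add: tau.one tau.add tau.smul tau.mult)

lemma tau_I: assumes "a \<in> I J" shows "tau k a \<in> I J"
proof (rule I_hom[OF tau.alg_hom_axioms _ assms])
  fix r assume "r \<in> Rel J"
  then show "tau k r \<in> I J"
    by (cases rule: Rel_cases) (auto simp: tau.add tau.mult intro!: I_relx I_rely I_arnold)
qed

lemma tau_xs:
  assumes "gr (gensE J - range gy) p q a" "k \<in> J" shows "xs J p q (tau k a)"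
  using assms(1)
proof (induction rule: gr.induct)
  case (xy s p q a)
  then obtain i where "s = gx i" "i \<in> J"
    by (auto simp: gensE_def)
  with xy assms(2) show ?case by (auto simp: tau.mult intro: xs.x)
next
  case (w s p q a)
  then obtain i j where "s = gw i j" "i \<in> J" "j \<in> J" "i \<noteq> j"
    by (auto simp: gensE_def)
  with w show ?case by (auto simp: tau.mult intro: xs.w)
qed (auto simp: tau.one tau.zero tau.add tau.smul intro: xs.intros)

lemma xs_gr: "xs J p q a \<Longrightarrow> gr (gensE J - range gy) p q a"
proof (induction rule: xs.induct)
  case (x i j p q a)
  then show ?case by (auto simp: xd_def left_diff_distrib intro!: gr_diff gr.xy)
qed (auto intro: gr.intros)

lemma gr_mono: "gr G p q a \<Longrightarrow> G \<subseteq> H \<Longrightarrow> gr H p q a"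
  by (auto simp: gr_iff LamG_def)

lemma xs_SubE: "xs J p q a \<Longrightarrow> a \<in> SubE J"
  by (induction rule: xs.induct) (auto intro: SubE.intros SubE_zero)

section \<open>Cocycles, coboundaries and equivariant lifts\<close>

definition ZE :: "nat set \<Rightarrow> int \<Rightarrow> int \<Rightarrow> ext set" where
  "ZE J p q = {a. gr (gensE J) p q a \<and> (\<exists>s\<in>SubE J. a - s \<in> I J) \<and> dE a \<in> I J}"

definition BE :: "nat set \<Rightarrow> int \<Rightarrow> int \<Rightarrow> ext set" where
  "BE J p q = {a. gr (gensE J) p q a \<and> (\<exists>s\<in>SubE J. a - dE s \<in> I J)}"

lemma subspace_ZE: "smul.subspace (ZE J p q)"
proof -
  have "\<exists>u\<in>SubE J. a + b - u \<in> I J" if "s \<in> SubE J" "a - s \<in> I J" "t \<in> SubE J" "b - t \<in> I J" for a b s t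
    using I.add[OF that(2,4)] that by (intro bexI[of _ "s + t"]) (auto simp: algebra_simps intro: SubE.add)
  moreover have "\<exists>u\<in>SubE J. smul c a - u \<in> I J" if "s \<in> SubE J" "a - s \<in> I J" for a s c
    using I.smul[OF that(2), of c] that
    by (intro bexI[of _ "smul c s"]) (auto simp: smul.scale_right_diff_distrib intro: SubE.smul)
  moreover have "\<exists>u\<in>SubE J. 0 - u \<in> I J" by (rule bexI[of _ 0]) (auto intro: SubE_zero I.zero)
  ultimately show ?thesis
    unfolding smul.subspace_def ZE_def mem_Collect_eq
    by (auto simp: dE.zero dE.add dE.smul intro: gr.intros I.intros)
qed

lemma subspace_BE: "smul.subspace (BE J p q)"
proof -
  have "\<exists>u\<in>SubE J. a + b - dE u \<in> I J" if "s \<in> SubE J" "a - dE s \<in> I J" "t \<in> SubE J" "b - dE t \<in> I J" for a b s t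
    using I.add[OF that(2,4)] that by (intro bexI[of _ "s + t"]) (auto simp: dE.add algebra_simps intro: SubE.add)
  moreover have "\<exists>u\<in>SubE J. smul c a - dE u \<in> I J" if "s \<in> SubE J" "a - dE s \<in> I J" for a s c
    using I.smul[OF that(2), of c] that
    by (intro bexI[of _ "smul c s"]) (auto simp: dE.smul smul.scale_right_diff_distrib intro: SubE.smul)
  moreover have "\<exists>u\<in>SubE J. 0 - dE u \<in> I J" by (rule bexI[of _ 0]) (auto simp: dE.zero intro: SubE_zero I.zero)
  ultimately show ?thesis
    unfolding smul.subspace_def BE_def mem_Collect_eq
    by (auto intro: gr.intros)
qed

lemma I_BE: "gr (gensE J) p q a \<Longrightarrow> a \<in> I J \<Longrightarrow> a \<in> BE J p q"
  by (auto simp: BE_def dE.zero intro!: bexI[of _ 0] SubE_zero)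

lemma BE_ZE: "a \<in> BE J p q \<Longrightarrow> a \<in> ZE J p q"
proof -
  assume "a \<in> BE J p q"
  then obtain s where s: "gr (gensE J) p q a" "s \<in> SubE J" "a - dE s \<in> I J" by (auto simp: BE_def)
  have "dE a \<in> I J" using dE_I[OF s(3)] by (simp add: dE.diff)
  with s show ?thesis by (auto simp: ZE_def intro: SubE_dE)
qed

lemma BE_actE:
  assumes "g \<in> SL2" "a \<in> BE J p q" shows "actE g a \<in> BE J p q"
proof -
  obtain s where s: "gr (gensE J) p q a" "s \<in> SubE J" "a - dE s \<in> I J" using assms(2) by (auto simp: BE_def)
  have "actE g a - dE (actE g s) \<in> I J"
    using actE_I[OF s(3), of g] by (simp add: actE.diff actE_dE[OF assms(1)])
  then show ?thesis using s by (auto simp: BE_def intro: gr_actE SubE_actE)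
qed

lemma ZE_actE:
  assumes "g \<in> SL2" "a \<in> ZE J p q" shows "actE g a \<in> ZE J p q"
proof -
  obtain s where s: "gr (gensE J) p q a" "s \<in> SubE J" "a - s \<in> I J" "dE a \<in> I J"
    using assms(2) by (auto simp: ZE_def)
  have "actE g a - actE g s \<in> I J"
    using actE_I[OF s(3), of g] by (simp add: actE.diff)
  then show ?thesis using s actE_I[OF s(4), of g]
    by (auto simp: ZE_def actE_dE[OF assms(1)] intro: gr_actE SubE_actE)
qed

lemma BE_scl_zero: "a \<in> BE J p q \<Longrightarrow> scl 1 0 a \<in> I J"
proof -
  assume "a \<in> BE J p q"
  then obtain s where "a - dE s \<in> I J" by (auto simp: BE_def)
  then have "scl 1 0 (a - dE s) \<in> I J" by (rule scl_I)
  then show ?thesis by (simp add: scl.diff scl_dE_zero)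
qed

text \<open>The nodes are powers of 4 because the torus element \<open>diag (2^-i, 2^i)\<close> acts on the part of
  \<open>y\<close>-degree \<open>m\<close>, relative to \<open>y\<close>-degree 0, by \<open>(4^i)^m\<close>.\<close>

lemma interpolation:
  assumes "module s" and V: "module.subspace s V"
    and "\<And>i::nat. (\<Sum>j\<le>p. s ((4 ^ i) ^ j :: rat) (P j)) \<in> V" and "j \<le> p"
  shows "P j \<in> V"
proof -
  interpret module s by fact
  show ?thesis using assms(3,4)
  proof (induction p arbitrary: P j)
    case 0
    then show ?case using 0(1)[of 0] by simp
  next
    case (Suc p)
    \<comment> \<open>The value at the next node minus \<open>4 ^ Suc p\<close> times the value at
      the present node cancels the leading coefficient. The other coefficients are multiplied by
      nonzero constants.\<close>
    have "(\<Sum>j\<le>p. s ((4 ^ i) ^ j) (s (4 ^ j - 4 ^ Suc p) (P j))) \<in> V" for i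
    proof -
      have "(\<Sum>j\<le>Suc p. s ((4 ^ Suc i) ^ j) (P j)) - s (4 ^ Suc p) (\<Sum>j\<le>Suc p. s ((4 ^ i) ^ j) (P j))
          = (\<Sum>j\<le>Suc p. s ((4 ^ i) ^ j) (s (4 ^ j - 4 ^ Suc p) (P j)))"
        unfolding scale_sum_right sum_subtractf[symmetric]
        by (intro sum.cong refl)
           (simp only: scale_scale scale_left_diff_distrib[symmetric] power_Suc power_mult_distrib right_diff_distrib mult.commute)
      also have "\<dots> = (\<Sum>j\<le>p. s ((4 ^ i) ^ j) (s (4 ^ j - 4 ^ Suc p) (P j)))"
        by simp
      finally have E: "(\<Sum>j\<le>Suc p. s ((4 ^ Suc i) ^ j) (P j)) - s (4 ^ Suc p) (\<Sum>j\<le>Suc p. s ((4 ^ i) ^ j) (P j))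
          = (\<Sum>j\<le>p. s ((4 ^ i) ^ j) (s (4 ^ j - 4 ^ Suc p) (P j)))" .
      show ?thesis unfolding E[symmetric]
        by (rule subspace_diff[OF V Suc.prems(1) subspace_scale[OF V Suc.prems(1)]])
    qed
    then have *: "s (4 ^ j - 4 ^ Suc p) (P j) \<in> V" if "j \<le> p" for j
      using Suc.IH[of "\<lambda>j. s (4 ^ j - 4 ^ Suc p) (P j)"] that by blast
    have low: "P j \<in> V" if "j \<le> p" for j
    proof -
      have "(4::rat) ^ j \<noteq> 4 ^ Suc p" using that by (subst power_inject_exp) auto
      then show ?thesis
        using subspace_scale[OF V *[OF that], of "1 / (4 ^ j - 4 ^ Suc p)"] by simp
    qed
    have "P (Suc p) = (\<Sum>j\<le>Suc p. s ((4 ^ 0) ^ j) (P j)) - (\<Sum>j\<le>p. P j)" by simp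
    also have "\<dots> \<in> V"
      by (rule subspace_diff[OF V Suc.prems(1) subspace_sum[OF V]]) (use low in auto)
    finally show ?case using low Suc.prems(2) by (cases "j = Suc p") auto
  qed
qed

section \<open>Generating functions for the matrix entries of Sym^p\<close>

lemma interpolation_rat:
  assumes "\<And>u::rat. (\<Sum>j\<le>p. u ^ j * P j) = (\<Sum>j\<le>p. u ^ j * Q j)" "j \<le> p"
  shows "P j = Q j"
proof -
  have m: "module ((*) :: rat \<Rightarrow> rat \<Rightarrow> rat)" by unfold_locales (simp_all add: algebra_simps)
  interpret module "(*) :: rat \<Rightarrow> rat \<Rightarrow> rat" by (rule m)
  have "P j - Q j \<in> {0}"
    by (rule interpolation[OF m, where P = "\<lambda>j. P j - Q j"])
       (use assms in \<open>auto simp: right_diff_distrib sum_subtractf\<close>)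
  then show ?thesis by simp
qed

text \<open>This is the image of x^(p-j) y^j under the matrix, evaluated at x = 1 and y = u.\<close>

lemma vmat_generating:
  assumes "j \<le> p"
  shows "(\<Sum>m\<le>p. u ^ m * vmat p (a, b, c, d) m j) = (a + c * u) ^ (p - j) * (b + d * u) ^ j"
proof -
  define X where "X r s = of_nat ((p - j) choose r) * a ^ (p - j - r) * c ^ r * of_nat (j choose s) * b ^ (j - s) * d ^ s" for r s
  have "(\<Sum>m\<le>p. u ^ m * vmat p (a, b, c, d) m j)
      = (\<Sum>m\<le>p. \<Sum>r\<le>p - j. \<Sum>s\<le>j. if r + s = m then u ^ (r + s) * X r s else 0)"
    by (auto simp: vmat_def X_def sum_distrib_left intro!: sum.cong)
  also have "\<dots> = (\<Sum>r\<le>p - j. \<Sum>s\<le>j. \<Sum>m\<le>p. if r + s = m then u ^ (r + s) * X r s else 0)"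
    by (subst sum.swap, rule sum.cong[OF refl], rule sum.swap)
  also have "\<dots> = (\<Sum>r\<le>p - j. \<Sum>s\<le>j. u ^ (r + s) * X r s)"
  proof (intro sum.cong refl)
    fix r s assume "r \<in> {..p - j}" "s \<in> {..j}"
    then have "r + s \<le> p" using assms by simp
    then show "(\<Sum>m\<le>p. if r + s = m then u ^ (r + s) * X r s else 0) = u ^ (r + s) * X r s" by simp
  qed
  also have "\<dots> = (\<Sum>r\<le>p - j. of_nat ((p - j) choose r) * (c * u) ^ r * a ^ (p - j - r)) *
      (\<Sum>s\<le>j. of_nat (j choose s) * (d * u) ^ s * b ^ (j - s))"
    unfolding sum_product by (intro sum.cong refl) (simp add: X_def power_mult_distrib power_add mult_ac)
  also have "\<dots> = (c * u + a) ^ (p - j) * (d * u + b) ^ j"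
    by (simp only: binomial_ring)
  finally show ?thesis by (simp add: add.commute)
qed

text \<open>The vectors v_j with weights \<open>(p choose j) * t ^ j\<close> add up to (x + t y)^p,
  which is mapped to ((a + b t) x + (c + d t) y)^p; the coefficient of x^(p-m) y^m is
  compared.\<close>

lemma vmat_binomial:
  assumes "m \<le> p"
  shows "(\<Sum>j\<le>p. of_nat (p choose j) * t ^ j * vmat p (a, b, c, d) m j)
    = of_nat (p choose m) * (a + b * t) ^ (p - m) * (c + d * t) ^ m"
proof (rule interpolation_rat[OF _ assms])
  fix u :: rat
  have "(\<Sum>m\<le>p. u ^ m * (\<Sum>j\<le>p. of_nat (p choose j) * t ^ j * vmat p (a, b, c, d) m j))
     = (\<Sum>j\<le>p. of_nat (p choose j) * t ^ j * (\<Sum>m\<le>p. u ^ m * vmat p (a, b, c, d) m j))"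
    unfolding sum_distrib_left by (subst sum.swap) (simp add: mult_ac)
  also have "\<dots> = (\<Sum>j\<le>p. of_nat (p choose j) * (t * (b + d * u)) ^ j * (a + c * u) ^ (p - j))"
    by (intro sum.cong refl) (simp add: vmat_generating power_mult_distrib mult_ac)
  also have "\<dots> = (t * (b + d * u) + (a + c * u)) ^ p" by (simp only: binomial_ring)
  also have "\<dots> = (u * (c + d * t) + (a + b * t)) ^ p" by (simp add: algebra_simps)
  also have "\<dots> = (\<Sum>m\<le>p. of_nat (p choose m) * (u * (c + d * t)) ^ m * (a + b * t) ^ (p - m))"
    by (simp only: binomial_ring)
  also have "\<dots> = (\<Sum>m\<le>p. u ^ m * (of_nat (p choose m) * (a + b * t) ^ (p - m) * (c + d * t) ^ m))"
    by (intro sum.cong refl) (simp add: power_mult_distrib mult_ac)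
  finally show "(\<Sum>m\<le>p. u ^ m * (\<Sum>j\<le>p. of_nat (p choose j) * t ^ j * vmat p (a, b, c, d) m j))
     = (\<Sum>m\<le>p. u ^ m * (of_nat (p choose m) * (a + b * t) ^ (p - m) * (c + d * t) ^ m))" .
qed

lemma vmat_zero:
  assumes "m \<le> p" shows "vmat p (a, b, c, d) m 0 = of_nat (p choose m) * a ^ (p - m) * c ^ m"
  using assms by (simp add: vmat_def cong: if_cong)

section \<open>Equivariant maps determined by a highest weight vector\<close>

definition lower :: "rat \<Rightarrow> mat2" where "lower t = (1, 0, t, 1)"

lemma lower_SL2 [simp]: "lower t \<in> SL2" by (simp add: lower_def SL2_def)

text \<open>\<open>lift p z\<close> is the equivariant map from \<open>Sym^p\<close> determined by the highest weight vector \<open>z\<close>: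
  the coefficient of \<open>t^m\<close> in \<open>lower t\<close> applied to \<open>z\<close> is \<open>p choose m\<close> times the image of
  \<open>x^(p-m) y^m\<close>.\<close>

definition lift :: "nat \<Rightarrow> ext \<Rightarrow> nat \<Rightarrow> ext" where
  "lift p z j = (if j \<le> p then smul (1 / of_nat (p choose j)) (ypart j (actE (lower 1) z)) else 0)"

context
  fixes J :: "nat set" and p :: nat and q :: int and z :: ext
  assumes z: "gr (gensE J - range gy) (int p) q z"
begin

text \<open>On a y-free element the two matrices amount to replacing x by (a + b t) x + (c + d t) y.
  The same is achieved by x to x + y followed by rescaling x and y, and rescaling acts by scalars on
  each y-degree.\<close>

lemma act_lower_act:
  "actE (a, b, c, d) (actE (lower t) z) =
   (\<Sum>m\<le>p. smul ((a + b * t) ^ (p - m) * (c + d * t) ^ m) (ypart m (actE (lower 1) z)))"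
proof -
  have "gr (gensE J) (int p) q (actE (lower 1) z)"
    by (rule gr_actE, rule gr_mono[OF z]) auto
  note scl_ypart[OF this, of "a + b * t" "c + d * t"]
  moreover have "actE (a, b, c, d) (actE (lower t) z) = scl (a + b * t) (c + d * t) (actE (lower 1) z)"
  proof (rule alg_hom_eqI[OF _ _ gr_LamG[OF z]])
    show "alg_hom (\<lambda>z. actE (a, b, c, d) (actE (lower t) z))"
      "alg_hom (\<lambda>z. scl (a + b * t) (c + d * t) (actE (lower 1) z))"
      by (rule alg_hom_compose[OF actE.alg_hom_axioms actE.alg_hom_axioms]
          alg_hom_compose[OF scl.alg_hom_axioms actE.alg_hom_axioms])+
    fix s assume s: "s \<in> gensE J - range gy"
    then have "s \<in> gensE J" by blast
    then show "actE (a, b, c, d) (actE (lower t) (e s)) = scl (a + b * t) (c + d * t) (actE (lower 1) (e s))"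
      using s by (cases rule: gensE_cases)
        (auto simp: lower_def actE.add actE.smul scl.add smul_add add_smul mult.commute)
  qed
  ultimately show ?thesis by simp
qed

lemma act_lower: "actE (lower t) z = (\<Sum>m\<le>p. smul (t ^ m) (ypart m (actE (lower 1) z)))"
proof -
  have "actE (1, 0, 0, 1) a = a" for a
  proof (rule alg_hom_eqI[OF actE.alg_hom_axioms alg_hom_id LamG_UNIV])
    fix s show "actE (1, 0, 0, 1) (e s) = e s"
      by (cases s rule: gen_cases) (auto simp: actE_e ga_def)
  qed
  with act_lower_act[of 1 0 0 1 t] show ?thesis by simp
qed

lemma lift_0: "lift p z 0 = z"
proof -
  have "actE (lower 0) z = (\<Sum>m\<le>p. if m = 0 then ypart 0 (actE (lower 1) z) else 0)"
    unfolding act_lower[of 0] by (intro sum.cong refl) (auto simp: power_0_left)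
  also have "\<dots> = lift p z 0" by (simp add: lift_def)
  also have "actE (lower 0) z = z"
  proof (rule alg_hom_eqI[OF actE.alg_hom_axioms alg_hom_id LamG_UNIV])
    fix s show "actE (lower 0) (e s) = e s"
      by (cases s rule: gen_cases) (auto simp: actE_e ga_def lower_def)
  qed
  finally show ?thesis by simp
qed

text \<open>The components of the lift are, up to scalars, the coefficients of the polynomial curve
  \<open>actE (lower t) z\<close> in t; a subspace containing the curve contains its
  coefficients.\<close>

lemma lift_mem:
  assumes "smul.subspace V" "\<And>t. actE (lower t) z \<in> V" "j \<le> p"
  shows "lift p z j \<in> V"
proof -
  have "ypart j (actE (lower 1) z) \<in> V"
    by (rule interpolation[OF smul.module_axioms assms(1) _ assms(3)])
       (use assms(2) in \<open>simp add: act_lower[symmetric]\<close>)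
  then show ?thesis using assms by (simp add: lift_def smul.subspace_scale)
qed

text \<open>Both sides, weighted by \<open>(p choose j) * t ^ j\<close> and summed over j, become
  the image of the curve \<open>actE (lower t) z\<close> under \<open>g\<close>. Interpolation in t
  separates the individual j.\<close>

lemma lift_equivariant:
  assumes "j \<le> p"
  shows "(\<Sum>m\<le>p. smul (vmat p g m j) (lift p z m)) = actE g (lift p z j)"
proof -
  obtain a b c d where g: "g = (a, b, c, d)" by (cases g)
  let ?P = "\<lambda>m. ypart m (actE (lower 1) z)"
  define R where "R j = smul (of_nat (p choose j)) (\<Sum>m\<le>p. smul (vmat p g m j) (lift p z m))" for j
  have "actE g (?P j) - R j \<in> {0}"
  proof (rule interpolation[OF smul.module_axioms smul.subspace_single_0 _ assms])
    fix i :: nat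
    let ?t = "4 ^ i :: rat"
    have "(\<Sum>j\<le>p. smul (?t ^ j) (R j)) =
      (\<Sum>m\<le>p. \<Sum>j\<le>p. smul (of_nat (p choose j) * ?t ^ j * vmat p g m j) (lift p z m))"
      unfolding R_def smul.scale_sum_right by (subst sum.swap) (simp add: mult_ac)
    also have "\<dots> = (\<Sum>m\<le>p. smul (of_nat (p choose m) * (a + b * ?t) ^ (p - m) * (c + d * ?t) ^ m) (lift p z m))"
      unfolding smul.scale_sum_left[symmetric] g by (intro sum.cong refl) (simp add: vmat_binomial)
    also have "\<dots> = (\<Sum>m\<le>p. smul ((a + b * ?t) ^ (p - m) * (c + d * ?t) ^ m) (?P m))"
      by (intro sum.cong refl) (simp add: lift_def)
    also have "\<dots> = actE g (actE (lower ?t) z)" by (simp add: g act_lower_act)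
    also have "\<dots> = (\<Sum>j\<le>p. smul (?t ^ j) (actE g (?P j)))"
      by (subst act_lower[of ?t]) (simp add: actE.sum actE.smul)
    finally show "(\<Sum>j\<le>p. smul (?t ^ j) (actE g (?P j) - R j)) \<in> {0}"
      by (simp add: smul.scale_right_diff_distrib sum_subtractf)
  qed
  then have "actE g (?P j) = R j" by simp
  then show ?thesis using assms by (simp add: lift_def actE.smul R_def)
qed

end

lemma lift_ZE:
  assumes "z \<in> K J (int p) q" "j \<le> p" shows "lift p z j \<in> ZE J (int p) q"
proof -
  have xs: "xs J (int p) q z" "dE z \<in> I J" using assms by (auto simp: K_def)
  have "z \<in> ZE J (int p) q"
    using xs gr_mono[OF xs_gr[OF xs(1)]] xs_SubE[OF xs(1)]
    by (auto simp: ZE_def I.zero intro!: bexI[of _ z])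
  then show ?thesis
    by (intro lift_mem[OF xs_gr[OF xs(1)] subspace_ZE _ assms(2)] ZE_actE) auto
qed

text \<open>The component at 0 is \<open>z\<close> itself, which is y-free and so survives setting y
  to zero, whereas coboundaries do not. Conversely the ideal is stable under the action, hence
  contains the whole orbit of \<open>z\<close>.\<close>

lemma lift_BE_iff:
  assumes "z \<in> K J (int p) q"
  shows "(\<forall>j\<le>p. lift p z j \<in> BE J (int p) q) \<longleftrightarrow> z \<in> I J"
proof
  have xs: "xs J (int p) q z" using assms by (auto simp: K_def)
  have grz: "gr (gensE J) (int p) q z" by (rule gr_mono[OF xs_gr[OF xs]]) auto
  {
    assume "\<forall>j\<le>p. lift p z j \<in> BE J (int p) q"
    then have "z \<in> BE J (int p) q" using lift_0[OF xs_gr[OF xs]] by force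
    then have "scl 1 0 z \<in> I J" by (rule BE_scl_zero)
    moreover have "scl 1 0 z = z"
      using xs by (induction rule: xs.induct) (simp_all add: scl.one scl.zero scl.add scl.smul scl.mult)
    ultimately show "z \<in> I J" by simp
  }
  assume "z \<in> I J"
  then show "\<forall>j\<le>p. lift p z j \<in> BE J (int p) q"
    by (intro allI impI lift_mem[OF xs_gr[OF xs] subspace_BE] I_BE gr_actE grz actE_I)
qed

text \<open>The diagonal matrices force \<open>G 0\<close> to be y-free up to a coboundary, which
  produces the candidate \<open>z\<close>. The lower unipotent matrices then show that an
  equivariant family vanishes as soon as its component at 0 does.\<close>

lemma highest_weight_part:
  assumes G: "\<And>j. j \<le> p \<Longrightarrow> G j \<in> ZE J (int p) q"
    and eq: "\<And>g j. g \<in> SL2 \<Longrightarrow> j \<le> p \<Longrightarrow>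
      (\<Sum>m\<le>p. smul (vmat p g m j) (G m)) - actE g (G j) \<in> BE J (int p) q"
    and k: "k \<in> J"
  shows "\<exists>z\<in>K J (int p) q. \<forall>j\<le>p. G j - lift p z j \<in> BE J (int p) q"
proof -
  note VB = subspace_BE[of J "int p" q]
  let ?B = "BE J (int p) q"
  have G0: "gr (gensE J) (int p) q (G 0)" "dE (G 0) \<in> I J" using G[of 0] by (auto simp: ZE_def)
  define z0 where "z0 = scl 1 0 (G 0)"
  have z0y: "z0 = ypart 0 (G 0)"
  proof -
    have "z0 = (\<Sum>m\<le>p. if m = 0 then ypart 0 (G 0) else 0)"
      unfolding z0_def scl_ypart[OF G0(1)] by (intro sum.cong refl) (auto simp: power_0_left)
    then show ?thesis by simp
  qed
  have diag: "G 0 - z0 \<in> ?B"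
  proof -
    \<comment> \<open>Multiplied by 2^(i p), equivariance under diag(2^-i, 2^i) says that
      \<open>G 0\<close> minus the sum of (4^i)^m times its part of y-degree m is a coboundary.
      \<open>Q\<close> lists the coefficients of this polynomial in 4^i.\<close>
    define Q where "Q m = (if m = 0 then G 0 else 0) - ypart m (G 0)" for m
    have "Q 0 \<in> ?B"
    proof (rule interpolation[OF smul.module_axioms VB _ le0])
      fix i :: nat
      let ?t = "2 ^ i :: rat" and ?g = "(1 / 2 ^ i, 0, 0, 2 ^ i) :: mat2"
      have "ga ?g s = scg (1 / ?t) ?t s" for s
        by (cases s rule: gen_cases) (auto simp: ga_def scg_def)
      then have act: "actE ?g = scl (1 / ?t) ?t"
        unfolding actE_def scl_def by (intro arg_cong[of _ _ homE] ext)
      have "(\<Sum>m\<le>p. smul (vmat p ?g m 0) (G m)) = (\<Sum>m\<le>p. if m = 0 then smul ((1 / ?t) ^ p) (G 0) else 0)"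
        by (intro sum.cong refl) (auto simp: vmat_zero power_0_left)
      also have "\<dots> = smul ((1 / ?t) ^ p) (G 0)" by simp
      finally have "smul ((1 / ?t) ^ p) (G 0) - scl (1 / ?t) ?t (G 0) \<in> ?B"
        using eq[of ?g 0] by (simp add: SL2_def act)
      then have "smul (?t ^ p) (smul ((1 / ?t) ^ p) (G 0) - scl (1 / ?t) ?t (G 0)) \<in> ?B"
        by (rule smul.subspace_scale[OF VB])
      moreover have "smul (?t ^ p) (scl (1 / ?t) ?t (G 0)) = (\<Sum>m\<le>p. smul ((4 ^ i) ^ m) (ypart m (G 0)))"
        unfolding scl_ypart[OF G0(1)] smul.scale_sum_right
      proof (intro sum.cong refl)
        fix m assume "m \<in> {..p}"
        then have "?t ^ p = ?t ^ (p - m) * ?t ^ m" by (simp flip: power_add)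
        moreover have "(4::rat) ^ i = ?t * ?t" by (simp flip: power_mult_distrib)
        ultimately show "smul (?t ^ p) (smul ((1 / ?t) ^ (p - m) * ?t ^ m) (ypart m (G 0)))
            = smul ((4 ^ i) ^ m) (ypart m (G 0))"
          by (simp add: power_mult_distrib power_divide)
      qed
      ultimately have "G 0 - (\<Sum>m\<le>p. smul ((4 ^ i) ^ m) (ypart m (G 0))) \<in> ?B"
        by (simp add: smul.scale_right_diff_distrib power_divide)
      moreover have "(\<Sum>m\<le>p. smul ((4 ^ i) ^ m) (if m = 0 then G 0 else 0)) = (\<Sum>m\<le>p. if m = 0 then G 0 else 0)"
        by (intro sum.cong refl) auto
      ultimately show "(\<Sum>m\<le>p. smul ((4 ^ i) ^ m) (Q m)) \<in> ?B"
        by (simp add: Q_def smul.scale_right_diff_distrib sum_subtractf)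
    qed
    then show ?thesis by (simp add: Q_def z0y)
  qed
  define z where "z = tau k z0"
  have grz0: "gr (gensE J - range gy) (int p) q z0"
  proof -
    have "S \<subseteq> gensE J - range gy" if "cf z0 S \<noteq> 0" for S
    proof -
      have S: "S \<subseteq> gensE J" "num_y S = 0" "finite S"
        using that G0(1) by (auto simp: z0y gr_iff LamG_def support_finite split: if_splits)
      then have "{s \<in> S. s mod 3 = 1} = {}" by (auto simp: num_y_def)
      then show ?thesis using S(1) by fastforce
    qed
    then show ?thesis using gr_ypart[OF G0(1), of 0] unfolding z0y[symmetric] gr_iff LamG_def by blast
  qed
  have xsz: "xs J (int p) q z" unfolding z_def by (rule tau_xs[OF grz0 k])
  \<comment> \<open>Modulo the relations \<open>z0\<close> lies in the subalgebra of differences and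
    edges, where \<open>tau k\<close> is the identity. Translation to the point k therefore changes
    it only by an element of the ideal.\<close>
  have zz0: "z0 - z \<in> I J"
  proof -
    obtain s where s: "s \<in> SubE J" "G 0 - s \<in> I J" using G[of 0] by (auto simp: ZE_def)
    have h: "z0 - scl 1 0 s \<in> I J" using scl_I[OF s(2), of 1 0] by (simp add: z0_def scl.diff)
    have "z0 - scl 1 0 s - tau k (z0 - scl 1 0 s) \<in> I J" by (rule I_diff[OF h tau_I[OF h]])
    then show ?thesis using tau_SubE[OF SubE_scl[OF s(1)], of k 1 0] by (simp add: z_def tau.diff)
  qed
  have "dE (G 0 - z0) \<in> I J" using BE_ZE[OF diag] by (simp add: ZE_def)
  then have "dE (G 0) - dE (G 0 - z0) - dE (z0 - z) \<in> I J"
    by (intro I_diff[OF I_diff[OF G0(2)] dE_I[OF zz0]])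
  then have zK: "z \<in> K J (int p) q" using xsz by (simp add: K_def dE.diff)
  have gr0: "gr (gensE J) (int p) q z" "gr (gensE J) (int p) q z0"
    using gr_mono[OF xs_gr[OF xsz]] gr_mono[OF grz0] by auto
  define H where "H j = G j - lift p z j" for j
  have H0: "H 0 \<in> ?B"
  proof -
    have "H 0 = (G 0 - z0) + (z0 - z)" by (simp add: H_def lift_0[OF xs_gr[OF xsz]])
    also have "\<dots> \<in> ?B" by (intro smul.subspace_add[OF VB] diag I_BE gr_diff gr0 zz0)
    finally show ?thesis .
  qed
  \<comment> \<open>The defect \<open>H\<close> is equivariant modulo coboundaries, and its
    component at 0 is a coboundary. The image of v_0 = x^p under \<open>lower t\<close> involves v_j
    with coefficient \<open>(p choose j) * t ^ j\<close>.\<close>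
  have "smul (of_nat (p choose j)) (H j) \<in> ?B" if "j \<le> p" for j
  proof (rule interpolation[OF smul.module_axioms VB _ that])
    fix i :: nat
    let ?g = "lower (4 ^ i)"
    have "(\<Sum>m\<le>p. smul (vmat p ?g m 0) (H m)) - actE ?g (H 0) =
        ((\<Sum>m\<le>p. smul (vmat p ?g m 0) (G m)) - actE ?g (G 0)) -
        ((\<Sum>m\<le>p. smul (vmat p ?g m 0) (lift p z m)) - actE ?g (lift p z 0))"
      by (simp add: H_def smul.scale_right_diff_distrib sum_subtractf actE.diff)
    also have "\<dots> \<in> ?B" using eq[of ?g 0] by (simp add: lift_equivariant[OF xs_gr[OF xsz]])
    finally have "(\<Sum>m\<le>p. smul (vmat p ?g m 0) (H m)) - actE ?g (H 0) + actE ?g (H 0) \<in> ?B"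
      by (intro smul.subspace_add[OF VB] BE_actE H0) auto
    moreover have "(\<Sum>m\<le>p. smul (vmat p ?g m 0) (H m)) =
        (\<Sum>m\<le>p. smul ((4 ^ i) ^ m) (smul (of_nat (p choose m)) (H m)))"
      by (intro sum.cong refl) (simp add: lower_def vmat_zero mult.commute)
    ultimately show "(\<Sum>m\<le>p. smul ((4 ^ i) ^ m) (smul (of_nat (p choose m)) (H m))) \<in> ?B" by simp
  qed
  then have "smul (1 / of_nat (p choose j)) (smul (of_nat (p choose j)) (H j)) \<in> ?B" if "j \<le> p" for j
    using that by (blast intro: smul.subspace_scale[OF VB])
  then have "H j \<in> ?B" if "j \<le> p" for j using that by fastforce
  with zK show ?thesis by (auto simp: H_def)
qed

section \<open>Transfer to coefficient functions\<close>

lemma cf_eq_iff: "cf a = cf b \<longleftrightarrow> a = b" by (rule cf_inject)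

lemma cf_ring:
  "cf (a + b) = cf a + cf b" "cf (a - b) = cf a - cf b" "cf (a * b) = mult (cf a) (cf b)"
  "cf 0 = 0" "cf 1 = one" "cf (smul c a) = sc c (cf a)"
  by (rule plus_ext.rep_eq minus_ext.rep_eq times_ext.rep_eq zero_ext.rep_eq one_ext.rep_eq smul.rep_eq)+

lemma sum_apply: "(\<Sum>i\<in>A. f i) x = (\<Sum>i\<in>A. f i x :: 'a :: comm_monoid_add)"
  by (induction A rule: infinite_finite_induct) simp_all

lemma cf_sum_fun: "cf (\<Sum>i\<in>A. f i) = (\<Sum>i\<in>A. cf (f i))"
  by (rule HOL.ext) (simp add: sum_apply)

lemma cf_e: "cf (e s) = gen s"
  by (simp add: monE.rep_eq gen_def)

lemma cf_gens: "cf (ex i) = xx i" "cf (ey i) = yy i" "cf (ew i j) = om i j"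
  "cf (xd i j) = xx i - xx j" "cf (yd i j) = yy i - yy j"
  by (simp_all add: cf_e xx_def yy_def om_def xd_def yd_def cf_ring)

lemma gens_gensE: "gens n = gensE {1..n}"
  by (simp add: gens_def gensE_def)

lemma finite_gens: "finite (gens n)"
proof -
  have "{gw i j |i j. i \<in> {1..n} \<and> j \<in> {1..n} \<and> i \<noteq> j} \<subseteq> (\<lambda>(i, j). gw i j) ` ({1..n} \<times> {1..n})"
    by auto
  then have "finite {gw i j |i j. i \<in> {1..n} \<and> j \<in> {1..n} \<and> i \<noteq> j}"
    by (rule finite_subset) auto
  then show ?thesis by (simp add: gens_def)
qed

lemma Lam_cf_iff: "cf a \<in> Lam n \<longleftrightarrow> a \<in> LamG (gensE {1..n})"
  by (simp add: Lam_def LamG_def gens_gensE)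

lemma Lam_cfE:
  assumes "f \<in> Lam n" obtains a where "f = cf a" "a \<in> LamG (gensE {1..n})"
proof -
  have sub: "{S. f S \<noteq> 0} \<subseteq> Pow (gens n)" using assms by (auto simp: Lam_def)
  then have "finite {S. f S \<noteq> 0}" by (rule finite_subset) (simp add: finite_gens)
  moreover have "finite S" if "f S \<noteq> 0" for S
    using sub that finite_subset[OF _ finite_gens] by auto
  ultimately have "f = cf (Ext f)" by (subst Ext_inverse) auto
  then show thesis using that[of "Ext f"] Lam_cf_iff[of "Ext f" n] assms by simp
qed

lemma prodL_prod_list: "prodL \<phi> L = prod_list (map \<phi> L)"
  by (induction L) simp_all

lemma cf_prod_list: "cf (prod_list as) = prodlist (map cf as)"
  by (induction as) (simp_all add: prodlist_def cf_ring)

lemma cf_linE: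
  assumes "\<And>S. cf (g S) = \<phi> S" shows "cf (linE g a) = lin \<phi> (cf a)"
  by (rule ext) (simp add: linE_def lin_def assms)

lemma cf_homE:
  assumes "\<And>s. cf (\<phi> s) = \<psi> s" shows "cf (homE \<phi> a) = alg_ext \<psi> (cf a)"
  unfolding homE_def alg_ext_def
  by (rule cf_linE) (simp add: prodL_prod_list cf_prod_list comp_def assms)

lemma cf_ga: "cf (ga g s) = genact g s"
  by (cases g) (simp add: ga_def genact_def cf_ring cf_e xx_def yy_def)

lemma cf_actE: "act g (cf a) = cf (actE g a)"
  unfolding act_def actE_def by (rule cf_homE[symmetric]) (rule cf_ga)

lemma cf_dg: "cf (dg s) = dgen s"
  by (auto simp: dg_def dgen_def cf_ring cf_gens split: prod.splits)

text \<open>Unrolling the recursion, the differential passes k generators before it acts on the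
  factor with index k; this gives the alternating signs of \<open>dmon\<close>.\<close>

lemma derL_sum:
  "derL \<delta> L = (\<Sum>k<length L. smul ((-1) ^ k)
     (prod_list (map e (take k L) @ [\<delta> (L ! k)] @ map e (drop (Suc k) L))))"
proof (induction L)
  case (Cons s L)
  have "(\<Sum>k<length (s # L). smul ((-1) ^ k)
      (prod_list (map e (take k (s # L)) @ [\<delta> ((s # L) ! k)] @ map e (drop (Suc k) (s # L)))))
    = \<delta> s * prod_list (map e L) + (\<Sum>k<length L. - (e s * smul ((-1) ^ k)
      (prod_list (map e (take k L) @ [\<delta> (L ! k)] @ map e (drop (Suc k) L)))))"
    by (simp add: sum.lessThan_Suc_shift mult.assoc smul.scale_minus_left del: sum.lessThan_Suc)
  also have "\<dots> = \<delta> s * prod_list (map e L) - e s * derL \<delta> L"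
    unfolding Cons.IH sum_negf sum_distrib_left by simp
  finally show ?case by (simp add: prodL_prod_list)
qed simp

lemma cf_dE: "d2 (cf a) = cf (dE a)"
  unfolding d2_def dE_def derE_def
proof (rule cf_linE[symmetric])
  fix S
  show "cf (derL dg (sorted_list_of_set S)) = dmon S"
    by (simp add: derL_sum dmon_def Let_def cf_sum_fun cf_ring cf_prod_list cf_e cf_dg comp_def
        del: prod_list.append prod_list.Cons)
qed

section \<open>The ideal, the subalgebra, cocycles and coboundaries as sets of coefficient
  functions\<close>

lemma rels_cf: "rels n = cf ` Rel {1..n}"
proof (intro set_eqI iffI)
  fix r assume "r \<in> rels n"
  then consider (x) i j where "r = cf (xd i j * ew i j)" "i \<in> {1..n}" "j \<in> {1..n}" "i \<noteq> j"
    | (y) i j where "r = cf (yd i j * ew i j)" "i \<in> {1..n}" "j \<in> {1..n}" "i \<noteq> j"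
    | (arnold) i j k where "r = cf (ew i j * ew j k + ew j k * ew k i + ew k i * ew i j)"
        "i \<in> {1..n}" "j \<in> {1..n}" "k \<in> {1..n}" "i \<noteq> j" "j \<noteq> k" "k \<noteq> i"
    unfolding rels_def cf_ring cf_gens by blast
  then show "r \<in> cf ` Rel {1..n}"
  proof cases
    case (x i j)
    then have "xd i j * ew i j \<in> Rel {1..n}" unfolding Rel_def by blast
    with x show ?thesis by blast
  next
    case (y i j)
    then have "yd i j * ew i j \<in> Rel {1..n}" unfolding Rel_def by blast
    with y show ?thesis by blast
  next
    case (arnold i j k)
    then have "ew i j * ew j k + ew j k * ew k i + ew k i * ew i j \<in> Rel {1..n}"
      unfolding Rel_def by blast
    with arnold show ?thesis by blast
  qed
next
  fix r assume "r \<in> cf ` Rel {1..n}"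
  then obtain a where a: "a \<in> Rel {1..n}" "r = cf a" by blast
  from a(1) show "r \<in> rels n"
    by (cases rule: Rel_cases; simp only: a(2) cf_ring cf_gens; unfold rels_def; blast)
qed

lemma Id_cfE:
  assumes "f \<in> Id n" obtains a where "f = cf a" "a \<in> I {1..n}" "a \<in> LamG (gensE {1..n})"
proof -
  from assms have "\<exists>a. f = cf a \<and> a \<in> I {1..n} \<and> a \<in> LamG (gensE {1..n})"
  proof induction
    case (rel r)
    then obtain a where "a \<in> Rel {1..n}" "r = cf a" by (auto simp: rels_cf)
    then show ?case by (auto intro: I.rel LamG_Rel)
  next
    case zero
    then show ?case by (intro exI[of _ 0]) (auto simp: cf_ring I.zero)
  next
    case (add a b)
    then show ?case by (metis cf_ring(1) I.add LamG_add)
  next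
    case (scal a c)
    then show ?case by (metis cf_ring(6) I.smul LamG_smul)
  next
    case (lmult a u)
    then obtain a' u' where "a = cf a'" "a' \<in> I {1..n}" "a' \<in> LamG (gensE {1..n})"
      "u = cf u'" "u' \<in> LamG (gensE {1..n})" by (metis Lam_cfE)
    then show ?case by (intro exI[of _ "u' * a'"]) (simp add: cf_ring I_lmult LamG_mult)
  next
    case (rmult a u)
    then obtain a' u' where "a = cf a'" "a' \<in> I {1..n}" "a' \<in> LamG (gensE {1..n})"
      "u = cf u'" "u' \<in> LamG (gensE {1..n})" by (metis Lam_cfE)
    then show ?case by (intro exI[of _ "a' * u'"]) (simp add: cf_ring I_rmult LamG_mult)
  qed
  then show thesis using that by blast
qed

text \<open>\<open>I\<close> admits multipliers with arbitrary generators, \<open>Id n\<close> only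
  those from \<open>Lam n\<close>. Killing the foreign generators fixes the relations and sends
  every multiplier into \<open>Lam n\<close>.\<close>

lemma I_kill_Id:
  assumes "a \<in> I {1..n}" shows "cf (kill (- gensE {1..n}) a) \<in> Id n"
  using assms
proof (induction rule: I.induct)
  case (rel r)
  have "kill (- gensE {1..n}) r = r" by (rule kill_fix[OF LamG_Rel[OF rel]]) auto
  moreover have "cf r \<in> rels n" using rel by (simp add: rels_cf)
  ultimately show ?case by (simp add: Id.rel)
next
  case (gen a s)
  show ?case
  proof (cases "s \<in> gensE {1..n}")
    case True
    then have "cf (e s) \<in> Lam n" by (simp add: Lam_cf_iff LamG_e)
    then show ?thesis using True gen by (simp add: kill.mult cf_ring Id.lmult)
  next
    case False
    then have "kill (- gensE {1..n}) (e s * a) = 0" by (simp add: kill.mult)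
    then show ?thesis by (simp only: cf_ring Id.zero)
  qed
qed (simp_all only: kill.zero kill.add kill.smul cf_ring Id.zero Id.add Id.scal)

lemma Id_cf_iff: "cf a \<in> Id n \<longleftrightarrow> a \<in> I {1..n} \<and> a \<in> LamG (gensE {1..n})"
proof
  assume "cf a \<in> Id n"
  then show "a \<in> I {1..n} \<and> a \<in> LamG (gensE {1..n})"
    by (rule Id_cfE) (simp add: cf_eq_iff)
next
  assume a: "a \<in> I {1..n} \<and> a \<in> LamG (gensE {1..n})"
  then have "kill (- gensE {1..n}) a = a" by (intro kill_fix[of a "gensE {1..n}"]) auto
  then show "cf a \<in> Id n" using I_kill_Id[of a n] a by simp
qed

lemma Sub_cf_iff: "f \<in> Sub n \<longleftrightarrow> (\<exists>a\<in>SubE {1..n}. f = cf a)"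
proof
  assume "f \<in> Sub n"
  then show "\<exists>a\<in>SubE {1..n}. f = cf a"
  proof induction
    case unit
    then show ?case by (intro bexI[of _ 1]) (auto simp: cf_ring SubE.one)
  next
    case (genx i j)
    then show ?case using SubE.x[OF _ _ SubE.one, of i "{1..n}" j]
      by (intro bexI[of _ "xd i j"]) (auto simp: cf_gens)
  next
    case (geny i j)
    then show ?case using SubE.y[OF _ _ SubE.one, of i "{1..n}" j]
      by (intro bexI[of _ "yd i j"]) (auto simp: cf_gens)
  next
    case (genw i j)
    then show ?case using SubE.w[OF _ _ _ SubE.one, of i "{1..n}" j]
      by (intro bexI[of _ "ew i j"]) (auto simp: cf_gens)
  next
    case (add a b)
    then show ?case by (metis cf_ring(1) SubE.add)
  next
    case (scal a c)
    then show ?case by (metis cf_ring(6) SubE.smul)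
  next
    case (mul a b)
    then show ?case by (metis cf_ring(3) SubE_mult)
  qed
next
  assume "\<exists>a\<in>SubE {1..n}. f = cf a"
  then obtain a where "a \<in> SubE {1..n}" "f = cf a" by blast
  then show "f \<in> Sub n"
  proof (induction arbitrary: f rule: SubE.induct)
    case (x i j a)
    then show ?case by (simp add: cf_ring cf_gens Sub.mul Sub.genx)
  next
    case (y i j a)
    then show ?case by (simp add: cf_ring cf_gens Sub.mul Sub.geny)
  next
    case (w i j a)
    then show ?case by (simp add: cf_ring cf_gens Sub.mul Sub.genw)
  qed (simp_all add: cf_ring Sub.unit Sub.add Sub.scal)
qed

lemma Lampq_cf_iff: "cf a \<in> Lampq n p q \<longleftrightarrow> gr (gensE {1..n}) (int p) (int q) a"
  by (auto simp: Lampq_def Lam_cf_iff gr_iff)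

lemma Zc_cf_iff: "cf a \<in> Zc n p q \<longleftrightarrow> a \<in> ZE {1..n} (int p) (int q)"
proof -
  have "(\<exists>s\<in>Sub n. \<exists>i\<in>Id n. cf a = s + i) \<longleftrightarrow> (\<exists>s\<in>SubE {1..n}. a - s \<in> I {1..n})"
    if a: "a \<in> LamG (gensE {1..n})"
  proof
    assume "\<exists>s\<in>Sub n. \<exists>i\<in>Id n. cf a = s + i"
    then obtain s i where "s \<in> SubE {1..n}" "i \<in> I {1..n}" "cf a = cf s + cf i"
      by (metis Sub_cf_iff Id_cfE)
    then show "\<exists>s\<in>SubE {1..n}. a - s \<in> I {1..n}"
      by (intro bexI[of _ s]) (auto simp: cf_ring[symmetric] cf_eq_iff)
  next
    assume "\<exists>s\<in>SubE {1..n}. a - s \<in> I {1..n}"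
    then obtain s where s: "s \<in> SubE {1..n}" "a - s \<in> I {1..n}" by blast
    have "cf a = cf s + cf (a - s)" by (simp add: cf_ring)
    moreover have "cf (a - s) \<in> Id n" using s SubE_LamG[OF s(1)] a by (simp add: Id_cf_iff LamG_diff)
    ultimately show "\<exists>s\<in>Sub n. \<exists>i\<in>Id n. cf a = s + i" using s Sub_cf_iff by blast
  qed
  then show ?thesis
    by (auto simp: Zc_def ZE_def Lampq_cf_iff cf_dE Id_cf_iff gr_LamG intro: LamG_dE dest: gr_LamG)
qed

lemma Bc_cf_iff: "cf a \<in> Bc n p q \<longleftrightarrow> a \<in> BE {1..n} (int p) (int q)"
proof -
  have "(\<exists>s\<in>Sub n. \<exists>i\<in>Id n. cf a = d2 s + i) \<longleftrightarrow> (\<exists>s\<in>SubE {1..n}. a - dE s \<in> I {1..n})"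
    if a: "a \<in> LamG (gensE {1..n})"
  proof
    assume "\<exists>s\<in>Sub n. \<exists>i\<in>Id n. cf a = d2 s + i"
    then obtain s i where "s \<in> SubE {1..n}" "i \<in> I {1..n}" "cf a = cf (dE s) + cf i"
      by (metis Sub_cf_iff Id_cfE cf_dE)
    then show "\<exists>s\<in>SubE {1..n}. a - dE s \<in> I {1..n}"
      by (intro bexI[of _ s]) (auto simp: cf_ring[symmetric] cf_eq_iff)
  next
    assume "\<exists>s\<in>SubE {1..n}. a - dE s \<in> I {1..n}"
    then obtain s where s: "s \<in> SubE {1..n}" "a - dE s \<in> I {1..n}" by blast
    have "cf a = d2 (cf s) + cf (a - dE s)" by (simp add: cf_ring cf_dE)
    moreover have "cf (a - dE s) \<in> Id n"
      using s LamG_dE[OF SubE_LamG[OF s(1)]] a by (simp add: Id_cf_iff LamG_diff)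
    ultimately show "\<exists>s\<in>Sub n. \<exists>i\<in>Id n. cf a = d2 s + i" using s Sub_cf_iff by blast
  qed
  then show ?thesis
    by (auto simp: Bc_def BE_def Lampq_cf_iff dest: gr_LamG)
qed

lemma Lampq_cfE:
  assumes "f \<in> Lampq n p q" obtains a where "f = cf a"
  using assms Lam_cfE unfolding Lampq_def by blast

section \<open>Dimension count\<close>

text \<open>Representatives of a basis of the quotient extend a basis of \<open>V0\<close>. The
  finite spanning set makes that basis finite, so that cardinalities add up.\<close>

lemma dim_quot_basis:
  fixes scale :: "rat \<Rightarrow> 'a \<Rightarrow> 'a :: ab_group_add"
  assumes vs: "vector_space scale" and V0: "module.subspace scale V0" "V0 \<subseteq> V"
    and fin: "finite A" "V0 \<subseteq> module.span scale A"
    and Q: "quot_basis scale V V0 N"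
  shows "vector_space.dim scale V = vector_space.dim scale V0 + N"
proof -
  interpret vector_space scale by (rule vs)
  from Q obtain b where b: "\<And>i. i < N \<Longrightarrow> b i \<in> V"
    and bspan: "\<And>v. v \<in> V \<Longrightarrow> \<exists>c. v - (\<Sum>i<N. scale (c i) (b i)) \<in> V0"
    and ind: "\<And>c i. (\<Sum>i<N. scale (c i) (b i)) \<in> V0 \<Longrightarrow> i < N \<Longrightarrow> c i = 0"
    unfolding quot_basis_def by blast
  obtain B where B: "B \<subseteq> V0" "independent B" "V0 \<subseteq> span B" "card B = dim V0"
    by (rule basis_exists)
  have finB: "finite B"
    using independent_span_bound[OF fin(1) B(2)] B(1) fin(2) by blast
  \<comment> \<open>Stated for initial segments of \<open>b\<close>, since independence is obtained
    by adjoining one vector at a time.\<close>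
  have span_le: "\<exists>c. v - (\<Sum>i<M. scale (c i) (b i)) \<in> V0" if "v \<in> span (B \<union> b ` {..<M})" for v M
  proof -
    have "span (B \<union> b ` {..<M}) \<subseteq> {v. \<exists>c. v - (\<Sum>i<M. scale (c i) (b i)) \<in> V0}"
    proof (rule span_minimal)
      show "B \<union> b ` {..<M} \<subseteq> {v. \<exists>c. v - (\<Sum>i<M. scale (c i) (b i)) \<in> V0}"
      proof (intro Un_least subsetI CollectI)
        fix v assume "v \<in> B"
        then show "\<exists>c. v - (\<Sum>i<M. scale (c i) (b i)) \<in> V0"
          using B(1) by (intro exI[of _ "\<lambda>_. 0"]) auto
      next
        fix v assume "v \<in> b ` {..<M}"
        then obtain j where j: "j < M" "v = b j" by blast
        have "(\<Sum>i<M. scale (if i = j then 1 else 0) (b i)) = (\<Sum>i<M. if i = j then b j else 0)"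
          by (intro sum.cong refl) auto
        then show "\<exists>c. v - (\<Sum>i<M. scale (c i) (b i)) \<in> V0"
          using j subspace_0[OF V0(1)] by (intro exI[of _ "\<lambda>i. if i = j then 1 else 0"]) simp
      qed
      show "subspace {v. \<exists>c. v - (\<Sum>i<M. scale (c i) (b i)) \<in> V0}"
        unfolding subspace_def mem_Collect_eq
      proof (intro conjI ballI allI)
        show "\<exists>c. 0 - (\<Sum>i<M. scale (c i) (b i)) \<in> V0"
          using subspace_0[OF V0(1)] by (intro exI[of _ "\<lambda>_. 0"]) simp
        show "\<exists>c. x + y - (\<Sum>i<M. scale (c i) (b i)) \<in> V0"
          if x: "x \<in> {v. \<exists>c. v - (\<Sum>i<M. scale (c i) (b i)) \<in> V0}"
            and y: "y \<in> {v. \<exists>c. v - (\<Sum>i<M. scale (c i) (b i)) \<in> V0}" for x y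
        proof -
          obtain c d where cd: "x - (\<Sum>i<M. scale (c i) (b i)) \<in> V0" "y - (\<Sum>i<M. scale (d i) (b i)) \<in> V0"
            using x y by blast
          show ?thesis
            using subspace_add[OF V0(1) cd]
            by (intro exI[of _ "\<lambda>i. c i + d i"]) (simp add: scale_left_distrib sum.distrib algebra_simps)
        qed
        show "\<exists>c. scale r x - (\<Sum>i<M. scale (c i) (b i)) \<in> V0"
          if x: "x \<in> {v. \<exists>c. v - (\<Sum>i<M. scale (c i) (b i)) \<in> V0}" for r x
        proof -
          obtain c where c: "x - (\<Sum>i<M. scale (c i) (b i)) \<in> V0" using x by blast
          show ?thesis
            using subspace_scale[OF V0(1) c, of r]
            by (intro exI[of _ "\<lambda>i. r * c i"]) (simp add: scale_right_diff_distrib scale_sum_right)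
        qed
      qed
    qed
    then show ?thesis using that by blast
  qed
  have "independent (B \<union> b ` {..<M}) \<and> card (B \<union> b ` {..<M}) = card B + M" if "M \<le> N" for M
    using that
  proof (induction M)
    case 0
    then show ?case using B by simp
  next
    case (Suc M)
    have notin: "b M \<notin> span (B \<union> b ` {..<M})"
    proof
      assume "b M \<in> span (B \<union> b ` {..<M})"
      then obtain c where c: "b M - (\<Sum>i<M. scale (c i) (b i)) \<in> V0" using span_le by blast
      \<comment> \<open>The dependence is rewritten as a combination of all N vectors with
        coefficient 1 at \<open>M\<close>; independence modulo \<open>V0\<close> forces that
        coefficient to be 0.\<close>
      define d where "d i = (if i < M then - c i else if i = M then 1 else 0)" for i
      have "(\<Sum>i<N. scale (d i) (b i)) = (\<Sum>i<Suc M. scale (d i) (b i))"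
        by (rule sum.mono_neutral_right) (use Suc.prems in \<open>auto simp: d_def\<close>)
      also have "\<dots> = b M - (\<Sum>i<M. scale (c i) (b i))"
        by (simp add: d_def sum_negf)
      finally have "d M = 0" using ind[of d M] c Suc.prems by simp
      then show False by (simp add: d_def)
    qed
    have eq: "B \<union> b ` {..<Suc M} = insert (b M) (B \<union> b ` {..<M})"
      by (auto simp: lessThan_Suc)
    have "b M \<notin> B \<union> b ` {..<M}" using notin span_base[of "b M" "B \<union> b ` {..<M}"] by auto
    then show ?case
      unfolding eq using Suc notin finB by (simp add: independent_insertI)
  qed
  from this[of N] have "independent (B \<union> b ` {..<N})" "card (B \<union> b ` {..<N}) = dim V0 + N"
    using B(4) by auto
  moreover have "B \<union> b ` {..<N} \<subseteq> V" using B V0 b by auto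
  moreover have "V \<subseteq> span (B \<union> b ` {..<N})"
  proof
    fix v assume "v \<in> V"
    then obtain c where c: "v - (\<Sum>i<N. scale (c i) (b i)) \<in> V0" using bspan by blast
    then have "v - (\<Sum>i<N. scale (c i) (b i)) \<in> span (B \<union> b ` {..<N})"
      using B(3) span_mono[of B "B \<union> b ` {..<N}"] by blast
    moreover have "(\<Sum>i<N. scale (c i) (b i)) \<in> span (B \<union> b ` {..<N})"
      by (intro span_sum span_scale span_base) auto
    ultimately have "v - (\<Sum>i<N. scale (c i) (b i)) + (\<Sum>i<N. scale (c i) (b i)) \<in> span (B \<union> b ` {..<N})"
      by (rule span_add)
    then show "v \<in> span (B \<union> b ` {..<N})" by simp
  qed
  ultimately show ?thesis by (metis dim_unique)
qed

interpretation scF: vector_space scF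
  by unfold_locales (auto simp: scF_def sc_def fun_eq_iff algebra_simps)

lemma sc_zero: "sc c 0 = 0" by (simp add: sc_def fun_eq_iff)

lemma Bc_cfE: assumes "f \<in> Bc n p q" obtains a where "f = cf a" "a \<in> BE {1..n} (int p) (int q)"
proof -
  have "f \<in> Lampq n p q" using assms by (simp add: Bc_def)
  then obtain a where a: "f = cf a" by (rule Lampq_cfE)
  then show thesis using that assms by (simp add: Bc_cf_iff)
qed

lemma Zc_cfE: assumes "f \<in> Zc n p q" obtains a where "f = cf a" "a \<in> ZE {1..n} (int p) (int q)"
proof -
  have "f \<in> Lampq n p q" using assms by (simp add: Zc_def)
  then obtain a where a: "f = cf a" by (rule Lampq_cfE)
  then show thesis using that assms by (simp add: Zc_cf_iff)
qed

lemma Bc_add: "f \<in> Bc n p q \<Longrightarrow> h \<in> Bc n p q \<Longrightarrow> f + h \<in> Bc n p q"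
  and Bc_sc: "f \<in> Bc n p q \<Longrightarrow> sc c f \<in> Bc n p q"
  and Bc_zero: "0 \<in> Bc n p q"
proof -
  note V = subspace_BE[of "{1..n}" "int p" "int q"]
  show "f + h \<in> Bc n p q" if "f \<in> Bc n p q" "h \<in> Bc n p q"
    using that smul.subspace_add[OF V] by (auto elim!: Bc_cfE simp flip: cf_ring simp: Bc_cf_iff)
  show "sc c f \<in> Bc n p q" if "f \<in> Bc n p q"
    using that smul.subspace_scale[OF V] by (auto elim!: Bc_cfE simp flip: cf_ring simp: Bc_cf_iff)
  show "0 \<in> Bc n p q"
    using smul.subspace_0[OF V] by (simp flip: cf_ring(4) add: Bc_cf_iff)
qed

lemma subspace_HomZero: "scF.subspace (HomZero n p q k)"
  by (auto simp: scF.subspace_def HomZero_def scF_def sc_zero intro: Bc_zero Bc_add Bc_sc)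

lemma HomLift_cf_iff:
  assumes "\<And>j. j > k \<Longrightarrow> G j = 0"
  shows "(\<lambda>j. cf (G j)) \<in> HomLift n p q k \<longleftrightarrow> (\<forall>j\<le>k. G j \<in> ZE {1..n} (int p) (int q)) \<and>
     (\<forall>g\<in>SL2. \<forall>j\<le>k. (\<Sum>m\<le>k. smul (vmat k g m j) (G m)) - actE g (G j) \<in> BE {1..n} (int p) (int q))"
  using assms
  by (simp add: HomLift_def Zc_cf_iff cf_actE Bc_cf_iff cf_ring(4) flip: cf_ring(6) cf_sum_fun cf_ring(2))

lemma HomLift_cfE:
  assumes "F \<in> HomLift n p q k"
  obtains G where "F = (\<lambda>j. cf (G j))" "\<And>j. j > k \<Longrightarrow> G j = 0"
proof -
  have "\<exists>a. F j = cf a \<and> (j > k \<longrightarrow> a = 0)" for j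
  proof (cases "j > k")
    case True
    then show ?thesis using assms by (intro exI[of _ 0]) (simp add: HomLift_def cf_ring)
  next
    case False
    then have "F j \<in> Zc n p q" using assms by (simp add: HomLift_def)
    then show ?thesis using False by (metis Zc_cfE)
  qed
  then obtain G where "\<And>j. F j = cf (G j) \<and> (j > k \<longrightarrow> G j = 0)" by metis
  then show thesis using that[of G] by auto
qed

lemma HomZero_subset_HomLift: "HomZero n p q k \<subseteq> HomLift n p q k"
proof
  fix F assume F: "F \<in> HomZero n p q k"
  have "\<exists>a. F j = cf a \<and> (j > k \<longrightarrow> a = 0) \<and> a \<in> BE {1..n} (int p) (int q)" for j
  proof (cases "j > k")
    case True
    then show ?thesis using F smul.subspace_0[OF subspace_BE]
      by (intro exI[of _ 0]) (simp add: HomZero_def cf_ring)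
  next
    case False
    then have "F j \<in> Bc n p q" using F by (simp add: HomZero_def)
    then show ?thesis using False by (metis Bc_cfE)
  qed
  then obtain G where G: "\<And>j. F j = cf (G j)" "\<And>j. j > k \<Longrightarrow> G j = 0"
    "\<And>j. G j \<in> BE {1..n} (int p) (int q)" by metis
  have "(\<lambda>j. cf (G j)) \<in> HomLift n p q k"
    by (rule HomLift_cf_iff[of k G, OF G(2), THEN iffD2])
       (auto intro!: BE_ZE G(3) smul.subspace_diff[OF subspace_BE] smul.subspace_sum[OF subspace_BE]
        smul.subspace_scale[OF subspace_BE] BE_actE simp del: One_nat_def)
  moreover have "F = (\<lambda>j. cf (G j))" using G(1) by (rule HOL.ext)
  ultimately show "F \<in> HomLift n p q k" by simp
qed

text \<open>There are finitely many monomials and k + 1 slots. Finiteness is what allows the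
  dimension of the coboundary part to be subtracted.\<close>

lemma HomZero_finite_dim: "\<exists>A. finite A \<and> HomZero n p q k \<subseteq> scF.span A"
proof -
  define u where "u i S = (\<lambda>j. if j = i then mon S else 0)" for i :: nat and S
  let ?A = "(\<lambda>(i, S). u i S) ` ({..k} \<times> Pow (gens n))"
  have "finite ?A" by (simp add: finite_gens)
  moreover have "F \<in> scF.span ?A" if F: "F \<in> HomZero n p q k" for F
  proof -
    have "F j U = (\<Sum>i\<le>k. \<Sum>S\<in>Pow (gens n). scF (F i S) (u i S)) j U" for j U
    proof -
      have "(\<Sum>i\<le>k. \<Sum>S\<in>Pow (gens n). scF (F i S) (u i S)) j U
          = (\<Sum>i\<le>k. \<Sum>S\<in>Pow (gens n). if S = U then (if i = j then F j U else 0) else 0)"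
        unfolding sum_apply
        by (intro sum.cong refl) (auto simp: scF_def sc_def u_def mon_def)
      also have "\<dots> = (if j \<le> k \<and> U \<subseteq> gens n then F j U else 0)"
        by (cases "U \<subseteq> gens n") (simp_all add: finite_gens)
      also have "\<dots> = F j U"
      proof (cases "j \<le> k")
        case True
        then have "F j \<in> Lam n" using F by (simp add: HomZero_def Bc_def Lampq_def)
        then show ?thesis using True by (auto simp: Lam_def)
      next
        case False
        then show ?thesis using F by (simp add: HomZero_def)
      qed
      finally show ?thesis by simp
    qed
    then have "F = (\<Sum>i\<le>k. \<Sum>S\<in>Pow (gens n). scF (F i S) (u i S))" by (intro ext)
    also have "\<dots> \<in> scF.span ?A"
      by (intro scF.span_sum scF.span_scale scF.span_base) force
    finally show ?thesis .
  qed
  ultimately show ?thesis by blast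
qed

lemma lift_above: "j > p \<Longrightarrow> lift p z j = 0"
  by (simp add: lift_def)

text \<open>An equivariant map out of V_p is determined by its highest weight vector. Accordingly
  \<open>lift p\<close> induces an isomorphism from the cocycle classes in \<open>K\<close> onto the
  equivariant maps modulo those with coboundary values.\<close>

lemma HomLift_basis:
  assumes "n \<ge> 1" and Q: "quot_basis smul (K {1..n} (int p) (int q)) (I {1..n}) N"
  shows "quot_basis scF (HomLift n p q p) (HomZero n p q p) N"
proof (rule quot_basis_transfer[OF _ subspace_K subspace_HomZero Q])
  let ?g = "\<lambda>z j. cf (lift p z j)"
  interpret y: lin_map "ypart m" for m by (rule lin_map_ypart)
  have lift_lin: "lift p (a + b) j = lift p a j + lift p b j" "lift p (smul c a) j = smul c (lift p a j)" for a b c j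
    by (simp_all add: lift_def actE.add actE.smul y.add y.smul smul_add mult.commute)
  show "module_hom smul scF ?g"
    by unfold_locales (auto simp: lift_lin cf_ring scF_def fun_eq_iff)
  fix z assume z: "z \<in> K {1..n} (int p) (int q)"
  then have "xs {1..n} (int p) (int q) z" by (simp add: K_def)
  note lift_eq = lift_equivariant[OF xs_gr[OF this]]
  show "?g z \<in> HomLift n p q p"
    by (rule HomLift_cf_iff[of p "lift p z" n p q, OF lift_above, THEN iffD2])
       (simp_all add: lift_eq lift_ZE[OF z] smul.subspace_0[OF subspace_BE] del: One_nat_def)
  show "?g z \<in> HomZero n p q p \<longleftrightarrow> z \<in> I {1..n}"
    using lift_BE_iff[OF z] lift_above by (auto simp: HomZero_def Bc_cf_iff cf_ring)
next
  fix F assume F: "F \<in> HomLift n p q p"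
  obtain G where G: "F = (\<lambda>j. cf (G j))" "\<And>j. j > p \<Longrightarrow> G j = 0"
    using HomLift_cfE[OF F] by blast
  have "(\<lambda>j. cf (G j)) \<in> HomLift n p q p" using F G(1) by simp
  then have GL: "(\<forall>j\<le>p. G j \<in> ZE {1..n} (int p) (int q)) \<and> (\<forall>g\<in>SL2. \<forall>j\<le>p.
      (\<Sum>m\<le>p. smul (vmat p g m j) (G m)) - actE g (G j) \<in> BE {1..n} (int p) (int q))"
    using HomLift_cf_iff[of p G n p q] G(2) by blast
  have "\<exists>z\<in>K {1..n} (int p) (int q). \<forall>j\<le>p. G j - lift p z j \<in> BE {1..n} (int p) (int q)"
    by (rule highest_weight_part[of p G _ _ 1]) (use GL assms(1) in \<open>auto simp del: One_nat_def\<close>)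
  then obtain z where z: "z \<in> K {1..n} (int p) (int q)"
    "\<And>j. j \<le> p \<Longrightarrow> G j - lift p z j \<in> BE {1..n} (int p) (int q)" by blast
  have "F - (\<lambda>j. cf (lift p z j)) = (\<lambda>j. cf (G j - lift p z j))"
    by (auto simp: G(1) cf_ring)
  also have "\<dots> \<in> HomZero n p q p"
    unfolding HomZero_def mem_Collect_eq Bc_cf_iff
    using z(2) G(2) lift_above by (auto simp: cf_ring(4) simp del: One_nat_def)
  finally show "\<exists>z\<in>K {1..n} (int p) (int q). F - (\<lambda>j. cf (lift p z j)) \<in> HomZero n p q p"
    using z(1) by blast
qed

theorem theorem3p11:
  fixes p q :: nat
  shows "e3 (p + q + 1) p q p = stirling (p + q) p"
proof -
  let ?n = "p + q + 1"
  have "quot_basis smul (K {1..?n} (int p) (int q)) (I {1..?n}) (stirling_int (card {1..?n} - 1) (int p))"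
    by (rule K_basis[of _ 1]) auto
  then have "quot_basis scF (HomLift ?n p q p) (HomZero ?n p q p) (stirling (p + q) p)"
    by (intro HomLift_basis) (auto simp: stirling_int_def)
  note Q = this
  obtain A where A: "finite A" "HomZero ?n p q p \<subseteq> scF.span A"
    using HomZero_finite_dim by blast
  \<comment> \<open>Stated as a sum, so that the subtraction of natural numbers in \<open>e3\<close>
    is exact.\<close>
  have "scF.dim (HomLift ?n p q p) = scF.dim (HomZero ?n p q p) + stirling (p + q) p"
    by (rule dim_quot_basis[OF scF.vector_space_axioms subspace_HomZero HomZero_subset_HomLift A Q])
  then show ?thesis by (simp add: e3_def qdim_def)
qed

end
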